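(* Let $p=q^k$ for some $k\in\mathbb Z$, and let $\langle\cdot,\cdot\rangle$ be the bilinear form on $\mathbb V^{\otimes d}$ given by $\langle x,y\rangle=(x,\mathsf D(\psi_\imath(y)))$. (1) The bilinear form $\langle\cdot,\cdot\rangle$ on $\mathbb V^{\otimes d}$ is symmetric. (2) The $\imath$canonical basis and the dual $\imath$canonical basis of $\mathbb V^{\otimes d}$ are dual with respect to $\langle\cdot,\cdot\rangle$, i.e., for every anti-dominant $f\in\mathbb I^d$, $$\langle C_g,C^*_{-h}\rangle=\delta_{g,h}\qquad\text{for all } g,h\in f\cdot W_d.$$
   Context: Fix $r,m\in\mathbb N=\{0,1,\dots\}$, not both zero, $d\ge1$, and $n=m/2$. For $x\in\mathbb R$, $k\in\mathbb N$ write $[x,x+k]=\{x,x+1,\dots,x+k\}$. Let $\mathbb I=[\frac{1-2r-m}2,\frac{2r+m-1}2]=\mathbb I_\circ^-\cup\mathbb I_\bullet\cup\mathbb I_\circ^+$, where $\mathbb I_\circ^+=[\frac{m+1}2,r+\frac{m-1}2]$, $\mathbb I_\bullet=[\frac{1-m}2,\frac{m-1}2]$, $\mathbb I_\circ^-=-\mathbb I_\circ^+$. "Anti-linear" means $\mathbb Q$-linear and semilinear for $q\mapsto q^{-1}$. $\mathbb V=\bigoplus_{a\in\mathbb I}\mathbb Q(q)v_a$ and $M_f=v_{f(1)}\otimes\dots\otimes v_{f(d)}$ for $f\in\mathbb I^d$. The Weyl group $W_d$ of type $B_d$ (simple reflections $s_0,\dots,s_{d-1}$) acts on the right on $\mathbb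 I^d$: for $j>0$, $f\cdot s_j$ swaps the entries $f(j),f(j+1)$; $f\cdot s_0=(-f(1),f(2),\dots,f(d))$ if $f(1)\in\mathbb I_\circ^-\cup\mathbb I_\circ^+$, and $f\cdot s_0=f$ if $f(1)\in\mathbb I_\bullet$. $f$ is anti-dominant if $\frac{m-1}2\ge f(1)\ge\dots\ge f(d)$. For $h\in\mathbb I^d$, $-h=(-h(1),\dots,-h(d))$. $I=[1-n-r,n+r-1]$ indexes the simple roots of type $A_{2r+m-1}$ (Cartan matrix $a_{ii}=2$, $a_{ij}=-1$ if $|i-j|=1$, else $0$). $\mathbf U=\mathbf U_q(\mathfrak{sl}_{2r+m})$ is the Drinfeld–Jimbo $\mathbb Q(q)$-algebra generated by $E_i,F_i,K_i^{\pm1}$ ($i\in I$) with $K_iE_jK_i^{-1}=q^{a_{ij}}E_j$, $K_iF_jK_i^{-1}=q^{-a_{ij}}F_j$, $[E_i,F_j]=\delta_{ij}\frac{K_i-K_i^{-1}}{q-q^{-1}}$, commuting $K_i$'s, and $q$-Serre relations; $K_\mu=\prod K_i^{a_i}$ for $\mu=\sum a_i i\in Y=\mathbb ZI$. $\Delta(E_i)=E_i\otimes1+K_i\otimes E_i$, $\Delta(F_i)=F_i\otimes K_i^{-1}+1\otimes F_i$, $\Delta(K_\mu)=K_\mu\otimes K_\mu$. $\mathbb V$ is the natural representation: $E_iv_{i+\frac12}=v_{i-\frac12}$, $F_iv_{i-\frac12}=v_{i+\frac12}$, $E_i,F_i$ kill the other $v_a$; $K_iv_{i-\frac12}=qv_{i-\frac12}$,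 $K_iv_{i+\frac12}=q^{-1}v_{i+\frac12}$, $K_iv_a=v_a$ otherwise; $\mathbb V^{\otimes d}$ is a $\mathbf U$-module via $\Delta$. $T_i=T''_{i,+1}$ are Lusztig's braid group automorphisms of $\mathbf U$: $T_i(E_i)=-F_iK_i$, $T_i(E_j)=\sum_{u+s=-a_{ij}}(-1)^uq^{-u}E_i^{(s)}E_jE_i^{(u)}$ for $j\ne i$; $T_w$ via reduced expressions. $\tau(i)=-i$ on $I$. $I_\bullet=[1-n,n-1]$ (empty if $m\le1$), $I_\circ=I\setminus I_\bullet$; $w_\bullet$ is the longest element of the parabolic subgroup of the Weyl group of $I_\bullet$; $Y^\imath=\{\nu-w_\bullet\tau(\nu)\mid\nu\in Y\}$. $\mathbf U^\imath\subset\mathbf U$ is the subalgebra generated by $K_\mu$ ($\mu\in Y^\imath$), $E_i,F_i$ ($i\in I_\bullet$) and $B_i=F_i+\varsigma_iT_{w_\bullet}(E_{\tau(i)})K_i^{-1}$ ($i\in I_\circ$), except that for $m=0$, $B_0=F_0+\varsigma_0E_0K_0^{-1}+\kappa_0K_0^{-1}$. Parameters: if $m\ge1$, $\varsigma_i=1$ for $i\ne\pm n$, $\varsigma_{-n}=p$, $\varsigma_n=(-1)^{m-1}q^mp^{-1}$; if $m=0$, $\varsigma_i=1$ for $i\ne0$, $\varsigma_0=q^{-1}$, $\kappa_0=\frac{p-p^{-1}}{q-q^{-1}}$. Bar involutions (existence known). $\psi$ on $\mathbf U$: anti-linear algebra involution fixing $E_i,F_i$ with $K_\mu\mapsto K_{-\mu}$.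 $\psi_\imath$ on $\mathbf U^\imath$: anti-linear algebra involution fixing $B_j$ ($j\in I_\circ$), $E_i,F_i$ ($i\in I_\bullet$) with $K_\mu\mapsto K_{-\mu}$. Quasi R-matrix $\Theta=\sum_\nu\Theta_\nu$: unique with $\Theta_\nu\in\mathbf U^-_{-\nu}\otimes\mathbf U^+_\nu$, $\Theta_0=1\otimes1$, $\Delta(u)\Theta=\Theta(\psi\otimes\psi)\Delta(\psi(u))$ for $u\in\mathbf U$. $\psi$ on $\mathbb V^{\otimes d}$: anti-linear, $\psi(v_a)=v_a$ on $\mathbb V$, and inductively $\psi(x\otimes y)=\Theta(\psi(x)\otimes\psi(y))$. Quasi K-matrix $\Upsilon=\sum_\mu\Upsilon_\mu$: unique with $\Upsilon_\mu\in\mathbf U^+_\mu$, $\Upsilon_0=1$, $\psi_\imath(u)\Upsilon=\Upsilon\psi(u)$ for $u\in\mathbf U^\imath$. The bar involution on $\mathbb V^{\otimes d}$ is $\psi_\imath=\Upsilon\circ\psi$. The $\imath$canonical basis $\{C_g\mid g\in\mathbb I^d\}$ (resp. dual $\imath$canonical basis $\{C^*_g\}$) of $\mathbb V^{\otimes d}$ is the unique set of $\psi_\imath$-invariant elements with $C_g\in M_g+\sum_{g'\in\mathbb I^d}q^{-1}\mathbb Z[q^{-1}]M_{g'}$ (resp. $C^*_g\in M_g+\sum_{g'\in\mathbb I^d}q\mathbb Z[q]M_{g'}$). $(\cdot,\cdot)$ is the $\mathbb Q(q)$-bilinear form on $\mathbb V^{\otimes d}$ with $(M_f,M_g)=\delta_{f,g}$;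 $\mathsf D:\mathbb V^{\otimes d}\to\mathbb V^{\otimes d}$ is the anti-linear map with $\mathsf D(M_f)=M_{-f}$ for $f\in\mathbb I^d$. *)

theory Defs
  imports
    "HOL-Computational_Algebra.Polynomial_Factorial"
    "HOL-Computational_Algebra.Normalized_Fraction"
    "HOL-Computational_Algebra.Field_as_Ring"
    "HOL-Library.Poly_Mapping"
    "HOL-Library.Product_Plus"
    "HOL-Library.Groups_Big_Fun"
    "HOL-Library.Multiset"
begin

section \<open>The field of rational functions over the rationals and its bar involution\<close>

type_synonym qf = "rat poly fract"

definition qq :: qf where
  "qq = to_fract [:0, 1:]"

definition eval_at :: "qf \<Rightarrow> rat poly \<Rightarrow> qf" where
  "eval_at z a = poly (map_poly (\<lambda>c. to_fract [:c:]) a) z"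

text \<open>The field automorphism over the rationals that sends \<open>q\<close> to \<open>1/q\<close>: substitute \<open>1/q\<close> for \<open>q\<close>
  in numerator and denominator (the latter does not vanish, since \<open>1/q\<close> is transcendental).\<close>

definition qbar :: "qf \<Rightarrow> qf" where
  "qbar x = (case quot_of_fract x of (a, b) \<Rightarrow>
     eval_at (inverse qq) a / eval_at (inverse qq) b)"

definition qint :: "nat \<Rightarrow> qf" where
  "qint k = (qq ^ k - inverse qq ^ k) / (qq - inverse qq)"

definition qfact :: "nat \<Rightarrow> qf" where
  "qfact k = (\<Prod>j=1..k. qint j)"

text \<open>The sets \<open>q\<int>[q]\<close> (for \<open>z = q\<close>) and \<open>q\<^sup>-\<^sup>1\<int>[q\<^sup>-\<^sup>1]\<close> (for \<open>z = 1/q\<close>).\<close>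

definition int_poly_multiples :: "qf \<Rightarrow> qf set" where
  "int_poly_multiples z = {z * poly (map_poly of_int P) z | P :: int poly. True}"


section \<open>Free algebras\<close>

text \<open>The free monoid on a type, written additively so that the convolution product of
  \<open>\<Rightarrow>\<^sub>0\<close> makes \<open>'a fword \<Rightarrow>\<^sub>0 qf\<close> the free associative algebra on \<open>'a\<close>.\<close>

datatype 'a fword = Word (letters: "'a list")

instantiation fword :: (type) monoid_add
begin

definition zero_fword :: "'a fword" where
  "zero_fword = Word []"

definition plus_fword :: "'a fword \<Rightarrow> 'a fword \<Rightarrow> 'a fword" where
  "plus_fword u v = Word (letters u @ letters v)"

instance
  by standard (simp_all add: zero_fword_def plus_fword_def)

end

type_synonym 'a falg = "'a fword \<Rightarrow>\<^sub>0 qf"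

text \<open>The tensor square of the free algebra: the monoid algebra of the product monoid.\<close>

type_synonym 'a falg2 = "('a fword \<times> 'a fword) \<Rightarrow>\<^sub>0 qf"

abbreviation coeff_at :: "('k \<Rightarrow>\<^sub>0 qf) \<Rightarrow> 'k \<Rightarrow> qf" where
  "coeff_at \<equiv> Poly_Mapping.lookup"

definition smul :: "qf \<Rightarrow> ('k::monoid_add \<Rightarrow>\<^sub>0 qf) \<Rightarrow> ('k \<Rightarrow>\<^sub>0 qf)" (infixr \<open>*\<^sub>q\<close> 75) where
  "c *\<^sub>q x = Poly_Mapping.single 0 c * x"

abbreviation lspan :: "('k::monoid_add \<Rightarrow>\<^sub>0 qf) set \<Rightarrow> ('k \<Rightarrow>\<^sub>0 qf) set" where
  "lspan \<equiv> module.span (*\<^sub>q)"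

definition mon :: "'a list \<Rightarrow> 'a falg" where
  "mon as = Poly_Mapping.single (Word as) 1"

definition lin_ext :: "('k \<Rightarrow> ('l::monoid_add \<Rightarrow>\<^sub>0 qf)) \<Rightarrow> ('k \<Rightarrow>\<^sub>0 qf) \<Rightarrow> ('l \<Rightarrow>\<^sub>0 qf)" where
  "lin_ext \<phi> x = (\<Sum>k\<in>Poly_Mapping.keys x. coeff_at x k *\<^sub>q \<phi> k)"

definition antilin_ext :: "('k \<Rightarrow> ('l::monoid_add \<Rightarrow>\<^sub>0 qf)) \<Rightarrow> ('k \<Rightarrow>\<^sub>0 qf) \<Rightarrow> ('l \<Rightarrow>\<^sub>0 qf)" where
  "antilin_ext \<phi> x = (\<Sum>k\<in>Poly_Mapping.keys x. qbar (coeff_at x k) *\<^sub>q \<phi> k)"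

text \<open>The linear, respectively anti-linear, algebra homomorphism with prescribed values on the
  free generators.\<close>

definition alg_hom :: "('a \<Rightarrow> ('l::monoid_add \<Rightarrow>\<^sub>0 qf)) \<Rightarrow> 'a falg \<Rightarrow> ('l \<Rightarrow>\<^sub>0 qf)" where
  "alg_hom \<phi> = lin_ext (\<lambda>w. prod_list (map \<phi> (letters w)))"

definition anti_alg_hom :: "('a \<Rightarrow> ('l::monoid_add \<Rightarrow>\<^sub>0 qf)) \<Rightarrow> 'a falg \<Rightarrow> ('l \<Rightarrow>\<^sub>0 qf)" where
  "anti_alg_hom \<phi> = antilin_ext (\<lambda>w. prod_list (map \<phi> (letters w)))"

definition tensor :: "'a falg \<Rightarrow> 'a falg \<Rightarrow> 'a falg2" (infixr \<open>\<otimes>\<^sub>t\<close> 72) where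
  "x \<otimes>\<^sub>t y = (\<Sum>u\<in>Poly_Mapping.keys x. \<Sum>v\<in>Poly_Mapping.keys y.
     Poly_Mapping.single (u, v) (coeff_at x u * coeff_at y v))"

inductive_set two_sided_ideal :: "'a::ring_1 set \<Rightarrow> 'a set" for S where
  ideal_zero: "0 \<in> two_sided_ideal S"
| ideal_base: "s \<in> S \<Longrightarrow> a * s * b \<in> two_sided_ideal S"
| ideal_add: "x \<in> two_sided_ideal S \<Longrightarrow> y \<in> two_sided_ideal S \<Longrightarrow> x + y \<in> two_sided_ideal S"


section \<open>Index sets and the Weyl groups\<close>

definition seg :: "rat \<Rightarrow> rat \<Rightarrow> rat set" where
  "seg x y = {x + of_nat k | k. x + of_nat k \<le> y}"

definition II :: "nat \<Rightarrow> nat \<Rightarrow> rat set" where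
  "II r m = seg ((1 - 2 * of_nat r - of_nat m) / 2) ((2 * of_nat r + of_nat m - 1) / 2)"

definition II_white_plus :: "nat \<Rightarrow> nat \<Rightarrow> rat set" where
  "II_white_plus r m = seg ((of_nat m + 1) / 2) (of_nat r + (of_nat m - 1) / 2)"

definition II_white_minus :: "nat \<Rightarrow> nat \<Rightarrow> rat set" where
  "II_white_minus r m = uminus ` II_white_plus r m"

definition indices :: "nat \<Rightarrow> nat \<Rightarrow> nat \<Rightarrow> rat list set" where
  "indices r m d = {f. length f = d \<and> set f \<subseteq> II r m}"

text \<open>The entry \<open>f(j)\<close>, \<open>1 \<le> j \<le> d\<close>, is the list element \<open>f ! (j - 1)\<close>.\<close>

definition refl_B :: "nat \<Rightarrow> nat \<Rightarrow> nat \<Rightarrow> rat list \<Rightarrow> rat list" where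
  "refl_B r m j f =
     (if j = 0
      then (if hd f \<in> II_white_minus r m \<union> II_white_plus r m then (- hd f) # tl f else f)
      else f[j - 1 := f ! j, j := f ! (j - 1)])"

inductive_set orbit_B :: "nat \<Rightarrow> nat \<Rightarrow> rat list \<Rightarrow> rat list set" for r m f where
  orbit_base: "f \<in> orbit_B r m f"
| orbit_step: "g \<in> orbit_B r m f \<Longrightarrow> j < length f \<Longrightarrow> refl_B r m j g \<in> orbit_B r m f"

definition antidominant :: "nat \<Rightarrow> rat list \<Rightarrow> bool" where
  "antidominant m f \<longleftrightarrow> hd f \<le> (of_nat m - 1) / 2 \<and> sorted_wrt (\<ge>) f"

definition half :: "nat \<Rightarrow> rat" where
  "half m = of_nat m / 2"

definition Iset :: "nat \<Rightarrow> nat \<Rightarrow> rat set" where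
  "Iset r m = seg (1 - half m - of_nat r) (half m + of_nat r - 1)"

definition Iblack :: "nat \<Rightarrow> rat set" where
  "Iblack m = seg (1 - half m) (half m - 1)"

definition Iwhite :: "nat \<Rightarrow> nat \<Rightarrow> rat set" where
  "Iwhite r m = Iset r m - Iblack m"

definition cartan :: "rat \<Rightarrow> rat \<Rightarrow> int" where
  "cartan i j = (if i = j then 2 else if \<bar>i - j\<bar> = 1 then -1 else 0)"

text \<open>\<open>Y = \<int>I\<close>, as integer-valued functions vanishing outside \<open>I\<close>.\<close>

definition Ylat :: "nat \<Rightarrow> nat \<Rightarrow> (rat \<Rightarrow> int) set" where
  "Ylat r m = {\<nu>. \<forall>i. i \<notin> Iset r m \<longrightarrow> \<nu> i = 0}"

definition refl_A :: "nat \<Rightarrow> nat \<Rightarrow> rat \<Rightarrow> (rat \<Rightarrow> int) \<Rightarrow> (rat \<Rightarrow> int)" where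
  "refl_A r m i \<nu> = \<nu>(i := \<nu> i - (\<Sum>j\<in>Iset r m. cartan i j * \<nu> j))"

definition weyl :: "nat \<Rightarrow> nat \<Rightarrow> rat list \<Rightarrow> (rat \<Rightarrow> int) \<Rightarrow> (rat \<Rightarrow> int)" where
  "weyl r m is = foldr (refl_A r m) is"

definition reduced :: "nat \<Rightarrow> nat \<Rightarrow> rat list \<Rightarrow> bool" where
  "reduced r m is \<longleftrightarrow> set is \<subseteq> Iset r m \<and>
     (\<forall>js. set js \<subseteq> Iset r m \<and> (\<forall>\<nu>\<in>Ylat r m. weyl r m js \<nu> = weyl r m is \<nu>)
        \<longrightarrow> length is \<le> length js)"

text \<open>\<open>is\<close> is a reduced expression of the longest element of the parabolic subgroup of \<open>I\<^sub>\<bullet>\<close>.\<close>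

definition longest_word :: "nat \<Rightarrow> nat \<Rightarrow> rat list \<Rightarrow> bool" where
  "longest_word r m is \<longleftrightarrow> set is \<subseteq> Iblack m \<and> reduced r m is \<and>
     (\<forall>js. set js \<subseteq> Iblack m \<and> reduced r m js \<longrightarrow> length js \<le> length is)"

text \<open>\<open>Y\<^sup>\<imath> = {\<nu> - w\<^sub>\<bullet>\<tau>(\<nu>) | \<nu> \<in> Y}\<close>, where \<open>ws\<close> is a word for \<open>w\<^sub>\<bullet>\<close>.\<close>

definition Y_iota :: "nat \<Rightarrow> nat \<Rightarrow> rat list \<Rightarrow> (rat \<Rightarrow> int) set" where
  "Y_iota r m ws = {(\<lambda>i. \<nu> i - weyl r m ws (\<lambda>j. \<nu> (- j)) i) | \<nu>. \<nu> \<in> Ylat r m}"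


section \<open>The quantum group\<close>

datatype gen = GenE (gidx: rat) | GenF (gidx: rat) | GenK (gidx: rat) | GenKinv (gidx: rat)

abbreviation gE :: "rat \<Rightarrow> gen falg" where "gE i \<equiv> mon [GenE i]"
abbreviation gF :: "rat \<Rightarrow> gen falg" where "gF i \<equiv> mon [GenF i]"
abbreviation gK :: "rat \<Rightarrow> gen falg" where "gK i \<equiv> mon [GenK i]"
abbreviation gKinv :: "rat \<Rightarrow> gen falg" where "gKinv i \<equiv> mon [GenKinv i]"

definition divpow :: "gen falg \<Rightarrow> nat \<Rightarrow> gen falg" where
  "divpow x k = inverse (qfact k) *\<^sub>q x ^ k"

definition serre :: "gen falg \<Rightarrow> gen falg \<Rightarrow> int \<Rightarrow> gen falg" where
  "serre x y a = (\<Sum>s\<le>nat (1 - a). (-1) ^ s * divpow x s * y * divpow x (nat (1 - a) - s))"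

text \<open>Since the generators are indexed by all rationals, those with index outside \<open>I\<close> are set
  to zero; the resulting quotient of the free algebra is the algebra generated by
  \<open>E\<^sub>i, F\<^sub>i, K\<^sub>i\<^sup>\<plusminus>\<^sup>1\<close> with \<open>i \<in> I\<close>.\<close>

inductive_set rels :: "nat \<Rightarrow> nat \<Rightarrow> gen falg set" for r m where
  rel_outside: "gidx g \<notin> Iset r m \<Longrightarrow> mon [g] \<in> rels r m"
| rel_KKinv: "i \<in> Iset r m \<Longrightarrow> gK i * gKinv i - 1 \<in> rels r m"
| rel_KinvK: "i \<in> Iset r m \<Longrightarrow> gKinv i * gK i - 1 \<in> rels r m"
| rel_KK: "i \<in> Iset r m \<Longrightarrow> j \<in> Iset r m \<Longrightarrow> gK i * gK j - gK j * gK i \<in> rels r m"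
| rel_KE: "i \<in> Iset r m \<Longrightarrow> j \<in> Iset r m \<Longrightarrow>
    gK i * gE j * gKinv i - qq powi cartan i j *\<^sub>q gE j \<in> rels r m"
| rel_KF: "i \<in> Iset r m \<Longrightarrow> j \<in> Iset r m \<Longrightarrow>
    gK i * gF j * gKinv i - qq powi (- cartan i j) *\<^sub>q gF j \<in> rels r m"
| rel_EF: "i \<in> Iset r m \<Longrightarrow> j \<in> Iset r m \<Longrightarrow>
    gE i * gF j - gF j * gE i
      - (if i = j then inverse (qq - inverse qq) *\<^sub>q (gK i - gKinv i) else 0) \<in> rels r m"
| rel_serreE: "i \<in> Iset r m \<Longrightarrow> j \<in> Iset r m \<Longrightarrow> i \<noteq> j \<Longrightarrow>
    serre (gE i) (gE j) (cartan i j) \<in> rels r m"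
| rel_serreF: "i \<in> Iset r m \<Longrightarrow> j \<in> Iset r m \<Longrightarrow> i \<noteq> j \<Longrightarrow>
    serre (gF i) (gF j) (cartan i j) \<in> rels r m"

text \<open>Elements of \<open>U\<close> are represented by elements of the free algebra, and equality in \<open>U\<close> is
  the congruence \<open>ueq\<close> modulo the ideal \<open>J\<close> of relations. Likewise \<open>U \<otimes> U\<close> is the tensor square of
  the free algebra modulo \<open>J \<otimes> A + A \<otimes> J\<close>, \<open>A\<close> being the free algebra.\<close>

definition ueq :: "nat \<Rightarrow> nat \<Rightarrow> gen falg \<Rightarrow> gen falg \<Rightarrow> bool" where
  "ueq r m x y \<longleftrightarrow> x - y \<in> two_sided_ideal (rels r m)"

definition ueq2 :: "nat \<Rightarrow> nat \<Rightarrow> gen falg2 \<Rightarrow> gen falg2 \<Rightarrow> bool" where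
  "ueq2 r m x y \<longleftrightarrow>
     x - y \<in> two_sided_ideal ({s \<otimes>\<^sub>t 1 | s. s \<in> rels r m} \<union> {1 \<otimes>\<^sub>t s | s. s \<in> rels r m})"

definition Kpow :: "rat \<Rightarrow> int \<Rightarrow> gen falg" where
  "Kpow i a = (if a \<ge> 0 then gK i ^ nat a else gKinv i ^ nat (- a))"

definition Kmu :: "nat \<Rightarrow> nat \<Rightarrow> (rat \<Rightarrow> int) \<Rightarrow> gen falg" where
  "Kmu r m \<nu> = prod_list (map (\<lambda>i. Kpow i (\<nu> i)) (sorted_list_of_set (Iset r m)))"

fun barU_gen :: "gen \<Rightarrow> gen falg" where
  "barU_gen (GenE i) = gE i"
| "barU_gen (GenF i) = gF i"
| "barU_gen (GenK i) = gKinv i"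
| "barU_gen (GenKinv i) = gK i"

definition barU :: "gen falg \<Rightarrow> gen falg" where
  "barU = anti_alg_hom barU_gen"

definition barUU :: "gen falg2 \<Rightarrow> gen falg2" where
  "barUU = antilin_ext (\<lambda>(u, v). barU (mon (letters u)) \<otimes>\<^sub>t barU (mon (letters v)))"

fun Delta_gen :: "gen \<Rightarrow> gen falg2" where
  "Delta_gen (GenE i) = gE i \<otimes>\<^sub>t 1 + gK i \<otimes>\<^sub>t gE i"
| "Delta_gen (GenF i) = gF i \<otimes>\<^sub>t gKinv i + 1 \<otimes>\<^sub>t gF i"
| "Delta_gen (GenK i) = gK i \<otimes>\<^sub>t gK i"
| "Delta_gen (GenKinv i) = gKinv i \<otimes>\<^sub>t gKinv i"

definition Delta :: "gen falg \<Rightarrow> gen falg2" where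
  "Delta = alg_hom Delta_gen"

text \<open>Lusztig's \<open>T''\<^bsub>i,+1\<^esub>\<close> [Introduction to Quantum Groups, 37.1.3].\<close>

fun T_gen :: "rat \<Rightarrow> gen \<Rightarrow> gen falg" where
  "T_gen i (GenE j) =
     (if j = i then - (gF i * gK i)
      else (\<Sum>u\<le>nat (- cartan i j). (-1) ^ u * (inverse qq ^ u *\<^sub>q
              (divpow (gE i) (nat (- cartan i j) - u) * gE j * divpow (gE i) u))))"
| "T_gen i (GenF j) =
     (if j = i then - (gKinv i * gE i)
      else (\<Sum>u\<le>nat (- cartan i j). (-1) ^ u * (qq ^ u *\<^sub>q
              (divpow (gF i) u * gF j * divpow (gF i) (nat (- cartan i j) - u)))))"
| "T_gen i (GenK j) = gK j * Kpow i (- cartan i j)"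
| "T_gen i (GenKinv j) = gKinv j * Kpow i (cartan i j)"

definition T_word :: "rat list \<Rightarrow> gen falg \<Rightarrow> gen falg" where
  "T_word is = foldr (\<lambda>i. alg_hom (T_gen i)) is"

text \<open>Weights \<open>\<nu> \<in> \<nat>I\<close> are multisets, \<open>size \<nu>\<close> being the height.\<close>

definition U_plus :: "nat \<Rightarrow> nat \<Rightarrow> rat multiset \<Rightarrow> gen falg set" where
  "U_plus r m \<mu> = {x. \<exists>y \<in> lspan {mon (map GenE is) | is. set is \<subseteq> Iset r m \<and> mset is = \<mu>}.
     ueq r m x y}"

definition U_minus_U_plus :: "nat \<Rightarrow> nat \<Rightarrow> rat multiset \<Rightarrow> gen falg2 set" where
  "U_minus_U_plus r m \<nu> = {x. \<exists>y \<in> lspan {mon (map GenF is) \<otimes>\<^sub>t mon (map GenE js) | is js.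
       set is \<subseteq> Iset r m \<and> mset is = \<nu> \<and> set js \<subseteq> Iset r m \<and> mset js = \<nu>}. ueq2 r m x y}"

definition weights_upto :: "nat \<Rightarrow> nat \<Rightarrow> nat \<Rightarrow> rat multiset set" where
  "weights_upto r m N = {\<nu>. set_mset \<nu> \<subseteq> Iset r m \<and> size \<nu> \<le> N}"

text \<open>Identities involving \<open>\<Upsilon> = \<Sum>\<Upsilon>\<^sub>\<mu>\<close> and \<open>\<Theta> = \<Sum>\<Theta>\<^sub>\<nu>\<close> live in the usual completions: of \<open>U\<close> with
  respect to the subspaces \<open>U\<^sup>-U\<^sup>0(\<Sum>\<^bsub>ht \<mu> \<ge> N\<^esub> U\<^sup>+\<^sub>\<mu>)\<close>, which is the left ideal generated by the
  \<open>U\<^sup>+\<^sub>\<mu>\<close> with \<open>ht \<mu> \<ge> N\<close>, and of \<open>U \<otimes> U\<close> with respect to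
  \<open>(U\<^sup>+U\<^sup>0(\<Sum>\<^bsub>ht \<nu> \<ge> N\<^esub> U\<^sup>-\<^sub>\<nu>)) \<otimes> U + U \<otimes> (U\<^sup>-U\<^sup>0(\<Sum>\<^bsub>ht \<nu> \<ge> N\<^esub> U\<^sup>+\<^sub>\<nu>))\<close> (Lusztig, 4.1.1), again a left ideal.
  An identity holds in the completion iff the difference of the partial sums tends to zero.\<close>

definition U_filt :: "nat \<Rightarrow> nat \<Rightarrow> nat \<Rightarrow> gen falg set" where
  "U_filt r m N = {x. \<exists>y \<in> lspan {a * mon (map GenE is) | a is.
     set is \<subseteq> Iset r m \<and> N \<le> length is}. ueq r m x y}"

definition UU_filt :: "nat \<Rightarrow> nat \<Rightarrow> nat \<Rightarrow> gen falg2 set" where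
  "UU_filt r m N = {x. \<exists>y \<in> lspan
     ({a * (mon (map GenF is) \<otimes>\<^sub>t 1) | a is. set is \<subseteq> Iset r m \<and> N \<le> length is} \<union>
      {a * (1 \<otimes>\<^sub>t mon (map GenE is)) | a is. set is \<subseteq> Iset r m \<and> N \<le> length is}).
     ueq2 r m x y}"

definition quasi_R_matrix :: "nat \<Rightarrow> nat \<Rightarrow> (rat multiset \<Rightarrow> gen falg2) \<Rightarrow> bool" where
  "quasi_R_matrix r m \<Theta> \<longleftrightarrow>
     (\<forall>\<nu>. \<Theta> \<nu> \<in> U_minus_U_plus r m \<nu>) \<and> ueq2 r m (\<Theta> {#}) (1 \<otimes>\<^sub>t 1) \<and>
     (\<forall>u N. \<exists>L0. \<forall>L\<ge>L0.
        (\<Sum>\<nu>\<in>weights_upto r m L. Delta u * \<Theta> \<nu> - \<Theta> \<nu> * barUU (Delta (barU u)))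
          \<in> UU_filt r m N)"


section \<open>The coideal subalgebra, its bar involution and the quasi K-matrix\<close>

definition varsigma :: "nat \<Rightarrow> qf \<Rightarrow> rat \<Rightarrow> qf" where
  "varsigma m p i =
     (if m \<ge> 1
      then (if i = - half m then p
            else if i = half m then (-1) ^ (m - 1) * qq ^ m * inverse p else 1)
      else (if i = 0 then inverse qq else 1))"

definition kappa0 :: "qf \<Rightarrow> qf" where
  "kappa0 p = (p - inverse p) / (qq - inverse qq)"

definition Bgen :: "nat \<Rightarrow> qf \<Rightarrow> rat list \<Rightarrow> rat \<Rightarrow> gen falg" where
  "Bgen m p ws i =
     (if m = 0 \<and> i = 0
      then gF 0 + varsigma m p 0 *\<^sub>q (gE 0 * gKinv 0) + kappa0 p *\<^sub>q gKinv 0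
      else gF i + varsigma m p i *\<^sub>q (T_word ws (gE (- i)) * gKinv i))"

inductive_set U_iota :: "nat \<Rightarrow> nat \<Rightarrow> qf \<Rightarrow> rat list \<Rightarrow> gen falg set" for r m p ws where
  Ui_scalar: "c *\<^sub>q 1 \<in> U_iota r m p ws"
| Ui_K: "\<mu> \<in> Y_iota r m ws \<Longrightarrow> Kmu r m \<mu> \<in> U_iota r m p ws"
| Ui_E: "i \<in> Iblack m \<Longrightarrow> gE i \<in> U_iota r m p ws"
| Ui_F: "i \<in> Iblack m \<Longrightarrow> gF i \<in> U_iota r m p ws"
| Ui_B: "i \<in> Iwhite r m \<Longrightarrow> Bgen m p ws i \<in> U_iota r m p ws"
| Ui_add: "x \<in> U_iota r m p ws \<Longrightarrow> y \<in> U_iota r m p ws \<Longrightarrow> x + y \<in> U_iota r m p ws"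
| Ui_mult: "x \<in> U_iota r m p ws \<Longrightarrow> y \<in> U_iota r m p ws \<Longrightarrow> x * y \<in> U_iota r m p ws"
| Ui_cong: "x \<in> U_iota r m p ws \<Longrightarrow> ueq r m x y \<Longrightarrow> y \<in> U_iota r m p ws"

definition bar_U_iota ::
  "nat \<Rightarrow> nat \<Rightarrow> qf \<Rightarrow> rat list \<Rightarrow> (gen falg \<Rightarrow> gen falg) \<Rightarrow> bool" where
  "bar_U_iota r m p ws \<psi> \<longleftrightarrow>
     (\<forall>x\<in>U_iota r m p ws. \<psi> x \<in> U_iota r m p ws \<and> ueq r m (\<psi> (\<psi> x)) x) \<and>
     (\<forall>x\<in>U_iota r m p ws. \<forall>y\<in>U_iota r m p ws.
        (ueq r m x y \<longrightarrow> ueq r m (\<psi> x) (\<psi> y)) \<and>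
        ueq r m (\<psi> (x + y)) (\<psi> x + \<psi> y) \<and> ueq r m (\<psi> (x * y)) (\<psi> x * \<psi> y)) \<and>
     (\<forall>c. \<forall>x\<in>U_iota r m p ws. ueq r m (\<psi> (c *\<^sub>q x)) (qbar c *\<^sub>q \<psi> x)) \<and>
     ueq r m (\<psi> 1) 1 \<and>
     (\<forall>j\<in>Iwhite r m. ueq r m (\<psi> (Bgen m p ws j)) (Bgen m p ws j)) \<and>
     (\<forall>i\<in>Iblack m. ueq r m (\<psi> (gE i)) (gE i) \<and> ueq r m (\<psi> (gF i)) (gF i)) \<and>
     (\<forall>\<mu>\<in>Y_iota r m ws. ueq r m (\<psi> (Kmu r m \<mu>)) (Kmu r m (\<lambda>i. - \<mu> i)))"

definition quasi_K_matrix ::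
  "nat \<Rightarrow> nat \<Rightarrow> qf \<Rightarrow> rat list \<Rightarrow> (gen falg \<Rightarrow> gen falg) \<Rightarrow> (rat multiset \<Rightarrow> gen falg) \<Rightarrow> bool"
where
  "quasi_K_matrix r m p ws \<psi> \<Upsilon> \<longleftrightarrow>
     (\<forall>\<mu>. \<Upsilon> \<mu> \<in> U_plus r m \<mu>) \<and> ueq r m (\<Upsilon> {#}) 1 \<and>
     (\<forall>u\<in>U_iota r m p ws. \<forall>N. \<exists>L0. \<forall>L\<ge>L0.
        (\<Sum>\<mu>\<in>weights_upto r m L. \<psi> u * \<Upsilon> \<mu> - \<Upsilon> \<mu> * barU u) \<in> U_filt r m N)"


section \<open>Tensor powers of the natural representation\<close>

text \<open>The tensor powers are the homogeneous components of the tensor algebra, that is, of the free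
  algebra on the \<open>v\<^sub>a\<close>: \<open>M\<^sub>f\<close> is the word \<open>f\<close>, and \<open>x \<otimes> y\<close> is the product \<open>x * y\<close>.\<close>

abbreviation Mf :: "rat list \<Rightarrow> rat falg" where
  "Mf f \<equiv> mon f"

definition tens :: "nat \<Rightarrow> nat \<Rightarrow> nat \<Rightarrow> rat falg set" where
  "tens r m d = {x. letters ` Poly_Mapping.keys x \<subseteq> indices r m d}"

fun nat_rep :: "gen \<Rightarrow> rat \<Rightarrow> rat falg" where
  "nat_rep (GenE i) a = (if a = i + 1/2 then Mf [i - 1/2] else 0)"
| "nat_rep (GenF i) a = (if a = i - 1/2 then Mf [i + 1/2] else 0)"
| "nat_rep (GenK i) a =
     (if a = i - 1/2 then qq *\<^sub>q Mf [a] else if a = i + 1/2 then inverse qq *\<^sub>q Mf [a] else Mf [a])"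
| "nat_rep (GenKinv i) a =
     (if a = i - 1/2 then inverse qq *\<^sub>q Mf [a] else if a = i + 1/2 then qq *\<^sub>q Mf [a] else Mf [a])"

text \<open>The action of a generator on \<open>v\<^sub>a \<otimes> M\<^sub>f\<close> through the coproduct, starting from the trivial
  module (on which a generator acts by its counit).\<close>

fun gen_act :: "gen \<Rightarrow> rat list \<Rightarrow> rat falg" where
  "gen_act (GenE i) [] = 0"
| "gen_act (GenF i) [] = 0"
| "gen_act (GenK i) [] = 1"
| "gen_act (GenKinv i) [] = 1"
| "gen_act (GenE i) (a # f) = nat_rep (GenE i) a * Mf f + nat_rep (GenK i) a * gen_act (GenE i) f"
| "gen_act (GenF i) (a # f) = nat_rep (GenF i) a * gen_act (GenKinv i) f + Mf [a] * gen_act (GenF i) f"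
| "gen_act (GenK i) (a # f) = nat_rep (GenK i) a * gen_act (GenK i) f"
| "gen_act (GenKinv i) (a # f) = nat_rep (GenKinv i) a * gen_act (GenKinv i) f"

definition word_act :: "nat \<Rightarrow> nat \<Rightarrow> gen fword \<Rightarrow> rat falg \<Rightarrow> rat falg" where
  "word_act r m w x = foldr
     (\<lambda>g. lin_ext (\<lambda>f. if gidx g \<in> Iset r m then gen_act g (letters f) else 0)) (letters w) x"

definition act :: "nat \<Rightarrow> nat \<Rightarrow> gen falg \<Rightarrow> rat falg \<Rightarrow> rat falg" where
  "act r m u x = lin_ext (\<lambda>w. word_act r m w x) u"

text \<open>The action of an element of \<open>U \<otimes> U\<close> on a pure tensor \<open>x \<otimes> y\<close>.\<close>

definition act2 :: "nat \<Rightarrow> nat \<Rightarrow> gen falg2 \<Rightarrow> rat falg \<Rightarrow> rat falg \<Rightarrow> rat falg" where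
  "act2 r m z x y = lin_ext (\<lambda>(u, v). word_act r m u x * word_act r m v y) z"

text \<open>The sums over all weights below are finite: on the finite-dimensional modules
  in question, all but finitely many \<open>\<Theta>\<^sub>\<nu>\<close> and \<open>\<Upsilon>\<^sub>\<mu>\<close> act by zero.\<close>

fun bar_M :: "nat \<Rightarrow> nat \<Rightarrow> (rat multiset \<Rightarrow> gen falg2) \<Rightarrow> rat list \<Rightarrow> rat falg" where
  "bar_M r m \<Theta> [] = 1"
| "bar_M r m \<Theta> [a] = Mf [a]"
| "bar_M r m \<Theta> (a # b # f) = Sum_any (\<lambda>\<nu>. act2 r m (\<Theta> \<nu>) (Mf [a]) (bar_M r m \<Theta> (b # f)))"

definition bar_tens ::
  "nat \<Rightarrow> nat \<Rightarrow> (rat multiset \<Rightarrow> gen falg2) \<Rightarrow> rat falg \<Rightarrow> rat falg" where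
  "bar_tens r m \<Theta> = antilin_ext (\<lambda>f. bar_M r m \<Theta> (letters f))"

definition ibar_tens ::
  "nat \<Rightarrow> nat \<Rightarrow> (rat multiset \<Rightarrow> gen falg2) \<Rightarrow> (rat multiset \<Rightarrow> gen falg) \<Rightarrow> rat falg \<Rightarrow> rat falg"
where
  "ibar_tens r m \<Theta> \<Upsilon> x = Sum_any (\<lambda>\<mu>. act r m (\<Upsilon> \<mu>) (bar_tens r m \<Theta> x))"

text \<open>\<open>\<Sum>\<^bsub>g'\<^esub> z\<int>[z] M\<^bsub>g'\<^esub>\<close>\<close>

definition M_lattice :: "nat \<Rightarrow> nat \<Rightarrow> nat \<Rightarrow> qf \<Rightarrow> rat falg set" where
  "M_lattice r m d z = {x \<in> tens r m d. \<forall>f. coeff_at x f \<in> int_poly_multiples z}"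

definition icanonical_basis ::
  "nat \<Rightarrow> nat \<Rightarrow> nat \<Rightarrow> (rat multiset \<Rightarrow> gen falg2) \<Rightarrow> (rat multiset \<Rightarrow> gen falg) \<Rightarrow>
   (rat list \<Rightarrow> rat falg) \<Rightarrow> bool" where
  "icanonical_basis r m d \<Theta> \<Upsilon> C \<longleftrightarrow> (\<forall>g\<in>indices r m d.
     ibar_tens r m \<Theta> \<Upsilon> (C g) = C g \<and> C g - Mf g \<in> M_lattice r m d (inverse qq))"

definition dual_icanonical_basis ::
  "nat \<Rightarrow> nat \<Rightarrow> nat \<Rightarrow> (rat multiset \<Rightarrow> gen falg2) \<Rightarrow> (rat multiset \<Rightarrow> gen falg) \<Rightarrow>
   (rat list \<Rightarrow> rat falg) \<Rightarrow> bool" where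
  "dual_icanonical_basis r m d \<Theta> \<Upsilon> C \<longleftrightarrow> (\<forall>g\<in>indices r m d.
     ibar_tens r m \<Theta> \<Upsilon> (C g) = C g \<and> C g - Mf g \<in> M_lattice r m d qq)"

definition std_form :: "rat falg \<Rightarrow> rat falg \<Rightarrow> qf" where
  "std_form x y = (\<Sum>f\<in>Poly_Mapping.keys x. coeff_at x f * coeff_at y f)"

definition Dmap :: "rat falg \<Rightarrow> rat falg" where
  "Dmap = antilin_ext (\<lambda>f. Mf (map uminus (letters f)))"

definition iform ::
  "nat \<Rightarrow> nat \<Rightarrow> (rat multiset \<Rightarrow> gen falg2) \<Rightarrow> (rat multiset \<Rightarrow> gen falg) \<Rightarrow>
   rat falg \<Rightarrow> rat falg \<Rightarrow> qf" where
  "iform r m \<Theta> \<Upsilon> x y = std_form x (Dmap (ibar_tens r m \<Theta> \<Upsilon> y))"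

end

theory Submission
  imports Defs "HOL-Combinatorics.Permutations"
begin

text \<open>
  Let \<open>(x, y)\<^sub>D = (x, D y)\<close>. With respect to this hermitian form, \<open>E\<^sub>i\<close>, \<open>F\<^sub>i\<close>, \<open>K\<^sub>i\<close> are adjoint to \<open>E\<^bsub>-i\<^esub>\<close>, \<open>F\<^bsub>-i\<^esub>\<close>,
  \<open>K\<^bsub>-i\<^esub>\<close>, and the parameters are such that \<open>B\<^sub>i\<close> is adjoint to \<open>B\<^bsub>-i\<^esub>\<close>. As \<open>\<psi>\<^sub>\<imath>\<close> fixes the generators \<open>B\<^sub>i\<close>
  (\<open>i\<close> white) and \<open>F\<^sub>i\<close> (\<open>i\<close> black), these are adjoint to \<open>B\<^bsub>-i\<^esub>\<close>, \<open>F\<^bsub>-i\<^esub>\<close> for both bilinear forms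
  \<open>\<langle>x, y\<rangle> = (x, \<Upsilon>\<psi> y)\<^sub>D\<close> and \<open>\<langle>y, x\<rangle>\<close>. If \<open>x\<close> is singular, that is, killed by all \<open>E\<^sub>i\<close>, then \<open>\<Upsilon>\<close> drops out of both, and
  they agree because \<open>(x, \<psi> y)\<^sub>D\<close> is symmetric. Modulo terms of lower degree in the \<open>F\<close>'s, \<open>B\<^sub>i\<close> is \<open>F\<^sub>i\<close>; hence the two
  forms agree for \<open>x\<close> in the submodule generated by the singular vectors. That is everything, since its
  orthogonal complement contains no nonzero singular vector, the field being formally real.

  The symmetry of \<open>(x, \<psi> y)\<^sub>D\<close> follows similarly by induction on \<open>d\<close>: \<open>V \<otimes> W\<close> is generated under the \<open>E\<^sub>i\<close> by
  \<open>v \<otimes> W\<close> with \<open>v\<close> of lowest weight, and there \<open>\<Theta>\<close> contributes only its leading term.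

  For the adjoint of \<open>B\<^bsub>\<plusminus>n\<^esub>\<close> one has to evaluate \<open>T\<^bsub>w\<^sub>\<bullet>\<^esub>(E\<^bsub>\<plusminus>n\<^esub>)\<close> for an arbitrary reduced word of the longest element.
  Finally, by symmetry \<open>\<langle>C\<^sub>g, C\<^sup>*\<^bsub>-h\<^esub>\<rangle> - \<delta>\<^bsub>g,h\<^esub>\<close> lies both in \<open>q\<^sup>-\<^sup>1\<int>[q\<^sup>-\<^sup>1]\<close> and in \<open>q\<int>[q]\<close>, so it vanishes.
\<close>

section \<open>The bar involution of the field\<close>

text \<open>Two forms share the work. For the hermitian form E_i is adjoint to E_{-i}, which suits
  the B_i, but v_a pairs with v_{-a}, so there are isotropic vectors. The standard form is a sum of
  squares, and for it E_i is adjoint to F_i K_i up to a scalar; orthogonality to the submodule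
  generated by the singular vectors is taken with respect to this one.

  Identities in completions are applied to vectors: in a deep filtration step a long word in the E_i
  or F_i acts first, and it vanishes on a tensor power of fixed degree.

  T along a word is followed through one letter. In a reduced black word the letter eps(n - 1/2)
  only moves inwards, the action of T_w(E_{eps n}) depends on how far it has moved, and the longest
  word moves it by m - 1 places. The resulting root vector consists of m - 1 nested q-commutators.
  Taking adjoints contributes (-q)^{m-1}, moving K_{-i}^{-1} past it contributes q, and p becomes
  1/p under conjugation; this is the origin of varsigma_n = (-1)^{m-1} q^m / p.\<close>

lemma eval_at_0 [simp]: "eval_at z 0 = 0"
  by (simp add: eval_at_def)

lemma eval_at_pCons [simp]: "eval_at z (pCons c a) = to_fract [:c:] + z * eval_at z a"
  by (cases "a = 0 \<and> c = 0") (auto simp: eval_at_def map_poly_pCons)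

lemma eval_at_add: "eval_at z (a + b) = eval_at z a + eval_at z b"
proof (induction a arbitrary: b)
  case (pCons c a)
  obtain d b' where b: "b = pCons d b'" by (cases b)
  have "to_fract [:c + d:] = to_fract [:c:] + to_fract [:d:]"
    by (simp flip: to_fract_add)
  then show ?case unfolding b add_pCons eval_at_pCons pCons.IH by (simp add: distrib_left)
qed simp

lemma eval_at_smult: "eval_at z (smult c a) = to_fract [:c:] * eval_at z a"
proof (induction a)
  case (pCons d a)
  have "to_fract [:c * d:] = to_fract [:c:] * to_fract [:d:]"
    by (simp flip: to_fract_mult)
  then show ?case by (simp only: smult_pCons eval_at_pCons pCons.IH distrib_left mult.left_commute)
qed simp

lemma eval_at_mult: "eval_at z (a * b) = eval_at z a * eval_at z b"
  by (induction a) (simp_all add: eval_at_add eval_at_smult algebra_simps)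

lemma eval_at_qq: "eval_at qq a = to_fract a"
proof (induction a)
  case (pCons c a)
  have "pCons c a = [:c:] + [:0, 1:] * a" by simp
  then have "to_fract (pCons c a) = to_fract [:c:] + qq * to_fract a"
    unfolding qq_def by (metis to_fract_add to_fract_mult)
  then show ?case by (simp only: eval_at_pCons pCons.IH)
qed simp

lemma qq_nonzero [simp]: "qq \<noteq> 0"
  by (simp add: qq_def)

text \<open>Multiplying a(1/q) by q^{deg a} clears denominators and leaves the polynomial with
  reversed coefficients. That one vanishes only for a = 0, so 1/q is transcendental.\<close>

lemma eval_at_inverse_qq: "qq ^ degree a * eval_at (inverse qq) a = to_fract (reflect_poly a)"
proof -
  define p where "p = map_poly (\<lambda>c. to_fract [:c:]) a"
  have d: "degree p = degree a" unfolding p_def by (rule degree_map_poly) simp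
  have "reflect_poly p = map_poly (\<lambda>c. to_fract [:c:]) (reflect_poly a)"
  proof (rule poly_eqI)
    show "coeff (reflect_poly p) n = coeff (map_poly (\<lambda>c. to_fract [:c:]) (reflect_poly a)) n" for n
      using d unfolding coeff_reflect_poly by (simp add: p_def coeff_map_poly coeff_reflect_poly)
  qed
  then have "poly (reflect_poly p) qq = to_fract (reflect_poly a)"
    using eval_at_qq[of "reflect_poly a"] by (simp only: eval_at_def)
  then show ?thesis
    using d unfolding p_def eval_at_def by (simp only: poly_reflect_poly_nz qq_nonzero not_False_eq_True)
qed

lemma eval_at_inverse_qq_eq_0_iff [simp]: "eval_at (inverse qq) a = 0 \<longleftrightarrow> a = 0"
proof
  assume "eval_at (inverse qq) a = 0"
  then have "to_fract (reflect_poly a) = (0 :: qf)" using eval_at_inverse_qq[of a] by simp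
  then show "a = 0" by simp
qed simp

text \<open>\<open>qbar\<close> is defined through the normalized fraction. Cross multiplication
  shows that any other fraction gives the same value, which makes sums and products
  accessible.\<close>

lemma qbar_quot:
  assumes "b \<noteq> 0"
  shows "qbar (to_fract a / to_fract b) = eval_at (inverse qq) a / eval_at (inverse qq) b"
proof -
  obtain c d where cd: "quot_of_fract (to_fract a / to_fract b) = (c, d)"
    by (cases "quot_of_fract (to_fract a / to_fract b)")
  have d: "d \<noteq> 0" using snd_quot_of_fract_nonzero[of "to_fract a / to_fract b"] cd by simp
  have "to_fract c / to_fract d = to_fract a / to_fract b"
    using Fract_quot_of_fract[of "to_fract a / to_fract b"] cd by (simp add: Fract_conv_to_fract)
  then have "to_fract (c * b) = to_fract (a * d)"
    using d assms by (simp add: field_simps)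
  then have "c * b = a * d" by (simp only: to_fract_eq_iff)
  then have "eval_at (inverse qq) c * eval_at (inverse qq) b = eval_at (inverse qq) a * eval_at (inverse qq) d"
    by (simp flip: eval_at_mult)
  then show ?thesis using d assms by (simp add: qbar_def cd frac_eq_eq)
qed

lemma qf_cases: obtains a b where "b \<noteq> 0" "x = to_fract a / to_fract b"
  by (cases x) (auto simp: Fract_conv_to_fract)

lemma qbar_add [simp]: "qbar (x + y) = qbar x + qbar y"
proof -
  obtain a b where x: "b \<noteq> 0" "x = to_fract a / to_fract b" by (rule qf_cases)
  obtain c d where y: "d \<noteq> 0" "y = to_fract c / to_fract d" by (rule qf_cases)
  have "x + y = to_fract (a * d + c * b) / to_fract (b * d)"
    using x y by (simp add: field_simps)
  then have "qbar (x + y) = (eval_at (inverse qq) a * eval_at (inverse qq) d +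
      eval_at (inverse qq) c * eval_at (inverse qq) b) / (eval_at (inverse qq) b * eval_at (inverse qq) d)"
    using x y by (simp only: qbar_quot eval_at_add eval_at_mult mult_eq_0_iff simp_thms)
  then show ?thesis using x y by (simp add: qbar_quot add_frac_eq)
qed

lemma qbar_mult [simp]: "qbar (x * y) = qbar x * qbar y"
proof -
  obtain a b where x: "b \<noteq> 0" "x = to_fract a / to_fract b" by (rule qf_cases)
  obtain c d where y: "d \<noteq> 0" "y = to_fract c / to_fract d" by (rule qf_cases)
  have "x * y = to_fract (a * c) / to_fract (b * d)"
    using x y by (simp add: field_simps)
  then have "qbar (x * y) = (eval_at (inverse qq) a * eval_at (inverse qq) c) /
      (eval_at (inverse qq) b * eval_at (inverse qq) d)"
    using x y by (simp only: qbar_quot eval_at_mult mult_eq_0_iff simp_thms)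
  then show ?thesis using x y by (simp add: qbar_quot)
qed

lemma qbar_to_fract: "qbar (to_fract a) = eval_at (inverse qq) a"
  using qbar_quot[of 1 a] by (simp add: one_pCons) (simp flip: one_pCons)

lemma qbar_0 [simp]: "qbar 0 = 0"
  using qbar_to_fract[of 0] by simp

lemma qbar_1 [simp]: "qbar 1 = 1"
proof -
  have "eval_at (inverse qq) [:1:] = to_fract [:1:]" by simp
  then show ?thesis using qbar_to_fract[of 1] by (simp flip: one_pCons)
qed

lemma qbar_uminus [simp]: "qbar (- x) = - qbar x"
  using qbar_add[of x "- x"] by (simp add: add_eq_0_iff del: qbar_add)

lemma qbar_diff [simp]: "qbar (x - y) = qbar x - qbar y"
  using qbar_add[of x "- y"] by simp

lemma qbar_inverse [simp]: "qbar (inverse x) = inverse (qbar x)"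
proof (cases "x = 0")
  case False
  then have "qbar x * qbar (inverse x) = 1" by (simp flip: qbar_mult)
  then show ?thesis by (metis inverse_unique)
qed simp

lemma qbar_divide [simp]: "qbar (x / y) = qbar x / qbar y"
  by (simp add: divide_inverse)

lemma qbar_power [simp]: "qbar (x ^ n) = qbar x ^ n"
  by (induction n) simp_all

lemma qbar_powi [simp]: "qbar (x powi n) = qbar x powi n"
  by (simp add: power_int_def)

lemma qbar_qq [simp]: "qbar qq = inverse qq"
proof -
  have "qbar (to_fract [:0, 1:]) = inverse qq * to_fract [:1:]"
    by (simp add: qbar_to_fract)
  then show ?thesis by (simp flip: one_pCons add: qq_def)
qed

lemma qq_neq_inverse [simp]: "qq - inverse qq \<noteq> 0"
proof
  assume "qq - inverse qq = 0"
  then have "qq * qq = 1" by (simp add: field_simps)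
  then have "to_fract ([:0, 1:] * [:0, 1:]) = (to_fract 1 :: qf)"
    unfolding qq_def by (simp only: to_fract_mult to_fract_1)
  then show False by (simp only: to_fract_eq_iff) (simp add: one_pCons)
qed

section \<open>Semilinear maps on free algebras\<close>

lemma lookup_smul [simp]: "coeff_at (c *\<^sub>q x) k = c * coeff_at x k"
  unfolding smul_def mult_map_scale_conv_mult[symmetric]
  by (simp add: Poly_Mapping.map.rep_eq when_def)

interpretation smul: vector_space smul
  by unfold_locales (auto intro!: poly_mapping_eqI simp: lookup_add algebra_simps)

lemma smul_mult_left: "(c *\<^sub>q x) * y = c *\<^sub>q (x * y)"
  by (simp add: smul_def mult.assoc)

lemma smul_single: "c *\<^sub>q Poly_Mapping.single k d = Poly_Mapping.single k (c * d)"
  by (rule poly_mapping_eqI) (simp add: lookup_single when_def)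

text \<open>Semilinear maps, for \<open>\<sigma>\<close> the identity or \<open>qbar\<close>.\<close>

definition slin :: "(qf \<Rightarrow> qf) \<Rightarrow> (('k::monoid_add \<Rightarrow>\<^sub>0 qf) \<Rightarrow> ('l::monoid_add \<Rightarrow>\<^sub>0 qf)) \<Rightarrow> bool" where
  "slin \<sigma> A \<longleftrightarrow> (\<forall>x y. A (x + y) = A x + A y) \<and> (\<forall>c x. A (c *\<^sub>q x) = \<sigma> c *\<^sub>q A x)"

abbreviation lin :: "(('k::monoid_add \<Rightarrow>\<^sub>0 qf) \<Rightarrow> ('l::monoid_add \<Rightarrow>\<^sub>0 qf)) \<Rightarrow> bool" where
  "lin \<equiv> slin (\<lambda>c. c)"

lemma slinI:
  "(\<And>x y. A (x + y) = A x + A y) \<Longrightarrow> (\<And>c x. A (c *\<^sub>q x) = \<sigma> c *\<^sub>q A x) \<Longrightarrow> slin \<sigma> A"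
  by (simp add: slin_def)

lemma slin_add: "slin \<sigma> A \<Longrightarrow> A (x + y) = A x + A y"
  and slin_smul: "slin \<sigma> A \<Longrightarrow> A (c *\<^sub>q x) = \<sigma> c *\<^sub>q A x"
  by (simp_all add: slin_def)

lemma slin_0: "slin \<sigma> A \<Longrightarrow> A 0 = 0"
  by (metis add_cancel_right_right slin_add)

lemma slin_uminus: "slin \<sigma> A \<Longrightarrow> A (- x) = - A x"
  using slin_add[of \<sigma> A x "- x"] by (simp add: slin_0 add_eq_0_iff)

lemma slin_diff: "slin \<sigma> A \<Longrightarrow> A (x - y) = A x - A y"
  using slin_add[of \<sigma> A x "- y"] by (simp add: slin_uminus)

lemma slin_sum: "slin \<sigma> A \<Longrightarrow> A (\<Sum>i\<in>I. f i) = (\<Sum>i\<in>I. A (f i))"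
  by (induction I rule: infinite_finite_induct) (simp_all add: slin_0 slin_add)

lemmas slin_simps = slin_add slin_smul slin_0 slin_uminus slin_diff slin_sum

lemma slin_comp: "slin \<sigma> A \<Longrightarrow> slin \<tau> B \<Longrightarrow> slin (\<lambda>c. \<tau> (\<sigma> c)) (\<lambda>x. B (A x))"
  by (simp add: slin_def)

lemma slin_ident: "lin (\<lambda>x. x)"
  by (simp add: slin_def)

lemma slin_zero: "slin \<sigma> (\<lambda>x. 0)"
  by (simp add: slin_def)

lemma slin_plus: "slin \<sigma> A \<Longrightarrow> slin \<sigma> B \<Longrightarrow> slin \<sigma> (\<lambda>x. A x + B x)"
  by (simp add: slin_def smul.scale_right_distrib)

lemma slin_minus: "slin \<sigma> A \<Longrightarrow> slin \<sigma> B \<Longrightarrow> slin \<sigma> (\<lambda>x. A x - B x)"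
  by (simp add: slin_def smul.scale_right_diff_distrib)

lemma slin_neg: "slin \<sigma> A \<Longrightarrow> slin \<sigma> (\<lambda>x. - A x)"
  by (simp add: slin_def)

lemma slin_if: "slin \<sigma> A \<Longrightarrow> slin \<sigma> B \<Longrightarrow> slin \<sigma> (\<lambda>x. if P then A x else B x)"
  by (cases P) simp_all

lemma slin_scale: "slin \<sigma> A \<Longrightarrow> slin \<sigma> (\<lambda>x. c *\<^sub>q A x)"
  by (simp add: slin_def smul.scale_right_distrib mult.commute)

lemma slin_summation: "(\<And>i. i \<in> I \<Longrightarrow> slin \<sigma> (A i)) \<Longrightarrow> slin \<sigma> (\<lambda>x. \<Sum>i\<in>I. A i x)"
  by (induction I rule: infinite_finite_induct) (simp_all add: slin_zero slin_plus)

lemma poly_mapping_expand: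
  "x = (\<Sum>k\<in>Poly_Mapping.keys x. coeff_at x k *\<^sub>q Poly_Mapping.single k (1 :: qf))"
proof (rule poly_mapping_eqI)
  fix j
  have "(\<Sum>k\<in>Poly_Mapping.keys x. coeff_at x k * coeff_at (Poly_Mapping.single k (1 :: qf)) j)
      = (\<Sum>k\<in>Poly_Mapping.keys x. if k = j then coeff_at x j else 0)"
    by (rule sum.cong) (auto simp: lookup_single)
  then show "coeff_at x j = coeff_at (\<Sum>k\<in>Poly_Mapping.keys x. coeff_at x k *\<^sub>q Poly_Mapping.single k (1 :: qf)) j"
    by (simp add: lookup_sum sum.delta in_keys_iff)
qed

lemma slin_ext_eq:
  assumes "slin \<sigma> A" "slin \<sigma> B"
    and "\<And>k. k \<in> Poly_Mapping.keys x \<Longrightarrow> A (Poly_Mapping.single k 1) = B (Poly_Mapping.single k 1)"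
  shows "A x = B x"
proof -
  have "A (\<Sum>k\<in>Poly_Mapping.keys x. coeff_at x k *\<^sub>q Poly_Mapping.single k 1)
      = B (\<Sum>k\<in>Poly_Mapping.keys x. coeff_at x k *\<^sub>q Poly_Mapping.single k 1)"
    using assms(3) by (simp add: slin_sum[OF assms(1)] slin_sum[OF assms(2)]
      slin_smul[OF assms(1)] slin_smul[OF assms(2)])
  then show ?thesis by (simp flip: poly_mapping_expand)
qed

text \<open>Scalar multiplication is left multiplication by a multiple of the zero key; that this
  element is central is checked on monomials.\<close>

lemma smul_mult_right: "x * (c *\<^sub>q y) = c *\<^sub>q (x * y)"
proof -
  have "lin (\<lambda>x. x * (c *\<^sub>q y))" "lin (\<lambda>x. c *\<^sub>q (x * y))"
    by (auto intro!: slinI simp: smul_mult_left distrib_right smul.scale_right_distrib mult.commute)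
  moreover have "Poly_Mapping.single k 1 * (c *\<^sub>q y) = c *\<^sub>q (Poly_Mapping.single k 1 * y)" for k
    by (simp add: smul_def mult_single mult.assoc[symmetric])
  ultimately show ?thesis by (rule slin_ext_eq)
qed

lemma slin_mult_left: "slin \<sigma> A \<Longrightarrow> slin \<sigma> (\<lambda>x. y * A x)"
  by (simp add: slin_def distrib_left smul_mult_right)

lemma slin_mult_right: "slin \<sigma> A \<Longrightarrow> slin \<sigma> (\<lambda>x. A x * y)"
  by (simp add: slin_def distrib_right smul_mult_left)

lemmas slin_intros = slin_ident slin_zero slin_plus slin_minus slin_neg slin_if slin_scale slin_summation
  slin_mult_left slin_mult_right

text \<open>The range of summation depends on x. Over a common finite superset of the keys the sum
  is additive term by term.\<close>

lemma lin_ext_superset: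
  "finite S \<Longrightarrow> Poly_Mapping.keys x \<subseteq> S \<Longrightarrow> lin_ext \<phi> x = (\<Sum>k\<in>S. coeff_at x k *\<^sub>q \<phi> k)"
  unfolding lin_ext_def by (rule sum.mono_neutral_left) (auto simp: in_keys_iff)

lemma antilin_ext_superset:
  "finite S \<Longrightarrow> Poly_Mapping.keys x \<subseteq> S \<Longrightarrow> antilin_ext \<phi> x = (\<Sum>k\<in>S. qbar (coeff_at x k) *\<^sub>q \<phi> k)"
  unfolding antilin_ext_def by (rule sum.mono_neutral_left) (auto simp: in_keys_iff)

lemma keys_smul: "Poly_Mapping.keys (c *\<^sub>q x) \<subseteq> Poly_Mapping.keys x"
  by (auto simp: in_keys_iff)

lemma slin_lin_ext: "lin (lin_ext \<phi>)"
proof (rule slinI)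
  show "lin_ext \<phi> (x + y) = lin_ext \<phi> x + lin_ext \<phi> y" for x y
    using keys_add[of x y]
    by (simp add: lin_ext_superset[where S = "Poly_Mapping.keys x \<union> Poly_Mapping.keys y"]
      lookup_add smul.scale_left_distrib sum.distrib)
  show "lin_ext \<phi> (c *\<^sub>q x) = c *\<^sub>q lin_ext \<phi> x" for c x
    using keys_smul[of c x]
    by (simp add: lin_ext_superset[where S = "Poly_Mapping.keys x"] smul.scale_sum_right)
qed

lemma slin_antilin_ext: "slin qbar (antilin_ext \<phi>)"
proof (rule slinI)
  show "antilin_ext \<phi> (x + y) = antilin_ext \<phi> x + antilin_ext \<phi> y" for x y
    using keys_add[of x y]
    by (simp add: antilin_ext_superset[where S = "Poly_Mapping.keys x \<union> Poly_Mapping.keys y"]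
      lookup_add smul.scale_left_distrib sum.distrib)
  show "antilin_ext \<phi> (c *\<^sub>q x) = qbar c *\<^sub>q antilin_ext \<phi> x" for c x
    using keys_smul[of c x]
    by (simp add: antilin_ext_superset[where S = "Poly_Mapping.keys x"] smul.scale_sum_right)
qed

lemma lin_ext_single [simp]: "lin_ext \<phi> (Poly_Mapping.single k c) = c *\<^sub>q \<phi> k"
  by (cases "c = 0") (simp_all add: lin_ext_def)

lemma antilin_ext_single [simp]: "antilin_ext \<phi> (Poly_Mapping.single k c) = qbar c *\<^sub>q \<phi> k"
  by (cases "c = 0") (simp_all add: antilin_ext_def)

lemmas lin_ext_simps [simp] = slin_simps[OF slin_lin_ext]
lemmas antilin_ext_simps [simp] = slin_simps[OF slin_antilin_ext]

lemma letters_zero [simp]: "letters 0 = []" and letters_plus [simp]: "letters (u + v) = letters u @ letters v"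
  by (simp_all add: zero_fword_def plus_fword_def)

lemma mon_Nil [simp]: "mon [] = 1"
  by (simp add: mon_def flip: zero_fword_def single_one)

lemma mon_append: "mon (as @ bs) = mon as * mon bs"
  by (simp add: mon_def mult_single plus_fword_def)

lemma mon_Cons: "mon (a # as) = mon [a] * mon as"
  using mon_append[of "[a]" as] by simp

lemma single_eq_mon: "Poly_Mapping.single w 1 = mon (letters w)"
  by (simp add: mon_def)

lemma lin_ext_mon [simp]: "lin_ext \<phi> (mon as) = \<phi> (Word as)"
  by (simp add: mon_def)

lemma antilin_ext_mon [simp]: "antilin_ext \<phi> (mon as) = \<phi> (Word as)"
  by (simp add: mon_def)

lemma slin_eq_mon:
  assumes "slin \<sigma> A" "slin \<sigma> B" "\<And>w. Word w \<in> Poly_Mapping.keys x \<Longrightarrow> A (mon w) = B (mon w)"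
  shows "A x = B x"
  using assms(1,2) by (rule slin_ext_eq) (use assms(3) in \<open>simp add: single_eq_mon\<close>)

lemma slin_alg_hom: "lin (alg_hom \<phi>)"
  by (simp add: alg_hom_def slin_lin_ext)

lemma slin_anti_alg_hom: "slin qbar (anti_alg_hom \<phi>)"
  by (simp add: anti_alg_hom_def slin_antilin_ext)

lemma alg_hom_mon: "alg_hom \<phi> (mon as) = prod_list (map \<phi> as)"
  and anti_alg_hom_mon: "anti_alg_hom \<phi> (mon as) = prod_list (map \<phi> as)"
  by (simp_all add: alg_hom_def anti_alg_hom_def)

lemma slin_mult_hom:
  assumes A: "slin \<sigma> A" and m: "\<And>as bs. A (mon (as @ bs)) = A (mon as) * A (mon bs)"
  shows "A (x * y) = A x * A y"
proof -
  have "slin \<sigma> (\<lambda>x. A (x * y))" "slin \<sigma> (\<lambda>x. A x * A y)"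
    by (auto intro!: slinI simp: slin_simps[OF A] distrib_right smul_mult_left)
  moreover have "A (mon w * y) = A (mon w) * A y" for w
  proof -
    have "slin \<sigma> (\<lambda>y. A (mon w * y))" "slin \<sigma> (\<lambda>y. A (mon w) * A y)"
      by (auto intro!: slinI simp: slin_simps[OF A] distrib_left smul_mult_right)
    then show ?thesis by (rule slin_eq_mon) (simp add: m flip: mon_append)
  qed
  ultimately show ?thesis by (rule slin_eq_mon)
qed

lemma alg_hom_mult: "alg_hom \<phi> (x * y) = alg_hom \<phi> x * alg_hom \<phi> y"
  by (rule slin_mult_hom[OF slin_alg_hom]) (simp add: alg_hom_mon)

lemma anti_alg_hom_mult: "anti_alg_hom \<phi> (x * y) = anti_alg_hom \<phi> x * anti_alg_hom \<phi> y"
  by (rule slin_mult_hom[OF slin_anti_alg_hom]) (simp add: anti_alg_hom_mon)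

lemma alg_hom_1 [simp]: "alg_hom \<phi> 1 = 1" and anti_alg_hom_1 [simp]: "anti_alg_hom \<phi> 1 = 1"
  using alg_hom_mon[of \<phi> "[]"] anti_alg_hom_mon[of \<phi> "[]"] by simp_all

lemma alg_hom_gen [simp]: "alg_hom \<phi> (mon [g]) = \<phi> g"
  and anti_alg_hom_gen [simp]: "anti_alg_hom \<phi> (mon [g]) = \<phi> g"
  by (simp_all add: alg_hom_mon anti_alg_hom_mon)

lemmas alg_hom_simps [simp] = slin_simps[OF slin_alg_hom] alg_hom_mult
lemmas anti_alg_hom_simps [simp] = slin_simps[OF slin_anti_alg_hom] anti_alg_hom_mult

section \<open>Bilinearity of the tensor product of free algebras\<close>

lemma tensor_superset:
  assumes "finite S" "finite T" "Poly_Mapping.keys x \<subseteq> S" "Poly_Mapping.keys y \<subseteq> T"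
  shows "x \<otimes>\<^sub>t y = (\<Sum>u\<in>S. \<Sum>v\<in>T. Poly_Mapping.single (u, v) (coeff_at x u * coeff_at y v))"
proof -
  have "x \<otimes>\<^sub>t y = (\<Sum>u\<in>Poly_Mapping.keys x. \<Sum>v\<in>T. Poly_Mapping.single (u, v) (coeff_at x u * coeff_at y v))"
    unfolding tensor_def using assms
    by (intro sum.cong sum.mono_neutral_left) (auto simp: in_keys_iff)
  also have "\<dots> = (\<Sum>u\<in>S. \<Sum>v\<in>T. Poly_Mapping.single (u, v) (coeff_at x u * coeff_at y v))"
    using assms by (intro sum.mono_neutral_left) (auto simp: in_keys_iff)
  finally show ?thesis .
qed

lemma slin_tensor_left: "lin (\<lambda>x. x \<otimes>\<^sub>t y)"
proof (rule slinI)
  fix x x' c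
  show "(x + x') \<otimes>\<^sub>t y = x \<otimes>\<^sub>t y + x' \<otimes>\<^sub>t y"
    using keys_add[of x x']
    by (simp add: tensor_superset[where S = "Poly_Mapping.keys x \<union> Poly_Mapping.keys x'"
        and T = "Poly_Mapping.keys y"] lookup_add distrib_right single_add sum.distrib)
  show "(c *\<^sub>q x) \<otimes>\<^sub>t y = c *\<^sub>q (x \<otimes>\<^sub>t y)"
    using keys_smul[of c x]
    by (simp add: tensor_superset[where S = "Poly_Mapping.keys x" and T = "Poly_Mapping.keys y"]
        smul.scale_sum_right smul_single mult.assoc)
qed

lemma slin_tensor_right: "lin (\<lambda>y. x \<otimes>\<^sub>t y)"
proof (rule slinI)
  fix y y' c
  show "x \<otimes>\<^sub>t (y + y') = x \<otimes>\<^sub>t y + x \<otimes>\<^sub>t y'"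
    using keys_add[of y y']
    by (simp add: tensor_superset[where S = "Poly_Mapping.keys x" and
        T = "Poly_Mapping.keys y \<union> Poly_Mapping.keys y'"] lookup_add distrib_left single_add sum.distrib)
  show "x \<otimes>\<^sub>t (c *\<^sub>q y) = c *\<^sub>q (x \<otimes>\<^sub>t y)"
    using keys_smul[of c y]
    by (simp add: tensor_superset[where S = "Poly_Mapping.keys x" and T = "Poly_Mapping.keys y"]
        smul.scale_sum_right smul_single mult.left_commute)
qed

lemmas tensor_simps = slin_simps[OF slin_tensor_left] slin_simps[OF slin_tensor_right]

lemma tensor_single [simp]:
  "Poly_Mapping.single u c \<otimes>\<^sub>t Poly_Mapping.single v d = Poly_Mapping.single (u, v) (c * d)"
  by (cases "c = 0"; cases "d = 0") (simp_all add: tensor_def)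

section \<open>The action on tensor powers\<close>

text \<open>The coproduct makes a generator act on a word through its first letter and its tail.
  Identities of operators are therefore proved by this induction, in which only the new first letter
  has to be analysed.\<close>

lemma tens_eqI:
  assumes "slin \<sigma> A" "slin \<sigma> B" "A 1 = B 1"
    and "\<And>a f. A (mon f) = B (mon f) \<Longrightarrow> A (mon [a] * mon f) = B (mon [a] * mon f)"
  shows "A x = B x"
proof -
  have "A (mon f) = B (mon f)" for f
  proof (induction f)
    case (Cons a f)
    then show ?case unfolding mon_Cons[of a f] by (rule assms(4))
  qed (simp add: assms(3))
  then show ?thesis by (rule slin_eq_mon[OF assms(1,2)])
qed

text \<open>The index of the generator is an arbitrary rational here: the relations between these
  operators hold for all indices, and \<open>gact\<close> brings back the restriction to
  \<open>Iset\<close>.\<close>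

definition opr :: "gen \<Rightarrow> rat falg \<Rightarrow> rat falg" where
  "opr g = lin_ext (\<lambda>f. gen_act g (letters f))"

abbreviation "oE i \<equiv> opr (GenE i)"
abbreviation "oF i \<equiv> opr (GenF i)"
abbreviation "oK i \<equiv> opr (GenK i)"
abbreviation "oL i \<equiv> opr (GenKinv i)"

definition kap :: "rat \<Rightarrow> rat \<Rightarrow> qf" where
  "kap i a = (if a = i - 1/2 then qq else if a = i + 1/2 then inverse qq else 1)"

lemma kap_nonzero [simp]: "kap i a \<noteq> 0"
  by (simp add: kap_def)

lemma slin_opr: "lin (opr g)"
  by (simp add: opr_def slin_lin_ext)

lemmas opr_lin [simp] = slin_simps[OF slin_opr]

lemma slin_opr_comp: "slin \<sigma> A \<Longrightarrow> slin \<sigma> (\<lambda>x. opr g (A x))"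
  by (drule slin_comp[OF _ slin_opr]) simp

lemma opr_mon: "opr g (mon f) = gen_act g f"
  by (simp add: opr_def)

lemma opr_mon_Cons: "opr g (mon [a] * mon f) = gen_act g (a # f)"
  by (simp add: opr_mon flip: mon_Cons)

lemma opr_one [simp]: "oE i 1 = 0" "oF i 1 = 0" "oK i 1 = 1" "oL i 1 = 1"
  unfolding mon_Nil[symmetric] opr_def lin_ext_mon by simp_all

lemma opr_K [simp]: "oK i (mon [a] * x) = kap i a *\<^sub>q (mon [a] * oK i x)"
  by (rule slin_eq_mon[where \<sigma> = "\<lambda>c. c" and x = x])
    (auto intro!: slin_intros slin_opr_comp simp: opr_mon opr_mon_Cons kap_def smul_mult_left)

lemma opr_L [simp]: "oL i (mon [a] * x) = inverse (kap i a) *\<^sub>q (mon [a] * oL i x)"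
  by (rule slin_eq_mon[where \<sigma> = "\<lambda>c. c" and x = x])
    (auto intro!: slin_intros slin_opr_comp simp: opr_mon opr_mon_Cons kap_def smul_mult_left)

lemma opr_E: "oE i (mon [a] * x) = (if a = i + 1/2 then mon [i - 1/2] * x else 0) + kap i a *\<^sub>q (mon [a] * oE i x)"
  by (rule slin_eq_mon[where \<sigma> = "\<lambda>c. c" and x = x])
    (auto intro!: slin_intros slin_opr_comp simp: opr_mon opr_mon_Cons kap_def smul_mult_left)

lemma opr_F: "oF i (mon [a] * x) = (if a = i - 1/2 then mon [i + 1/2] * oL i x else 0) + mon [a] * oF i x"
  by (rule slin_eq_mon[where \<sigma> = "\<lambda>c. c" and x = x])
    (auto intro!: slin_intros slin_opr_comp simp: opr_mon opr_mon_Cons kap_def smul_mult_left)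

section \<open>Commutation relations of the operators\<close>

lemma oK_oL [simp]: "oK i (oL i x) = x" and oL_oK [simp]: "oL i (oK i x) = x"
  by (rule tens_eqI[where \<sigma> = "\<lambda>c. c" and x = x]; auto intro!: slin_intros slin_opr_comp)+

lemma oK_comm: "oK i (oK j x) = oK j (oK i x)"
  by (rule tens_eqI[where \<sigma> = "\<lambda>c. c" and x = x]; auto intro!: slin_intros slin_opr_comp simp: mult.commute)

text \<open>E_j replaces the letter j + 1/2 by j - 1/2. This compares the eigenvalues of K_i on the
  two, whence the factor in K_i E_j = q^{a_ij} E_j K_i.\<close>

lemma kap_shift: "kap i (j - 1/2) = qq powi cartan i j * kap i (j + 1/2)"
  by (auto simp: kap_def cartan_def power_int_minus abs_if power2_eq_square split: if_splits)

lemma oK_oE: "oK i (oE j x) = qq powi cartan i j *\<^sub>q oE j (oK i x)"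
  by (rule tens_eqI[where \<sigma> = "\<lambda>c. c" and x = x])
     (auto intro!: slin_intros slin_opr_comp simp: opr_E kap_shift smul.scale_right_distrib smul_mult_right mult_ac)

lemma oK_oF: "oK i (oF j x) = qq powi (- cartan i j) *\<^sub>q oF j (oK i x)"
proof (rule tens_eqI[where \<sigma> = "\<lambda>c. c" and x = x])
  have KL: "oK i (oL j y) = oL j (oK i y)" for y
    by (metis oK_comm oK_oL oL_oK)
  have s: "kap i (j + 1/2) = qq powi (- cartan i j) * kap i (j - 1/2)"
    by (simp add: kap_shift power_int_minus)
  show "oK i (oF j (mon [a] * mon f)) = qq powi (- cartan i j) *\<^sub>q oF j (oK i (mon [a] * mon f))"
    if "oK i (oF j (mon f)) = qq powi (- cartan i j) *\<^sub>q oF j (oK i (mon f))" for a f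
    using that
    by (auto simp: opr_F s KL smul.scale_right_distrib smul_mult_right mult_ac)
qed (auto intro!: slin_intros slin_opr_comp)

lemma oL_oK_comm: "oL i (oK j x) = oK j (oL i x)"
  by (metis oK_comm oK_oL oL_oK)

lemma oL_comm: "oL i (oL j x) = oL j (oL i x)"
  by (metis oL_oK_comm oK_oL oL_oK)

lemma oL_oE: "oL i (oE j x) = qq powi (- cartan i j) *\<^sub>q oE j (oL i x)"
proof -
  have "oK i (qq powi (- cartan i j) *\<^sub>q oE j (oL i x)) = oE j x"
    by (simp add: oK_oE power_int_minus)
  then show ?thesis by (metis oL_oK)
qed

lemma oL_oF: "oL i (oF j x) = qq powi cartan i j *\<^sub>q oF j (oL i x)"
proof -
  have "oK i (qq powi cartan i j *\<^sub>q oF j (oL i x)) = oF j x"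
    by (simp add: oK_oF power_int_minus)
  then show ?thesis by (metis oL_oK)
qed

lemma cartan_commute: "cartan i j = cartan j i"
  by (auto simp: cartan_def)

lemma cartan_self [simp]: "cartan i i = 2"
  by (simp add: cartan_def)

lemma oE_oF: "oE i (oF j x) = oF j (oE i x)
    + (if i = j then inverse (qq - inverse qq) *\<^sub>q (oK i x - oL i x) else 0)"
proof (rule tens_eqI[where \<sigma> = "\<lambda>c. c" and x = x])
  fix a f
  assume IH: "oE i (oF j (mon f)) = oF j (oE i (mon f))
    + (if i = j then inverse (qq - inverse qq) *\<^sub>q (oK i (mon f) - oL i (mon f)) else 0)"
  show "oE i (oF j (mon [a] * mon f)) = oF j (oE i (mon [a] * mon f))
    + (if i = j then inverse (qq - inverse qq) *\<^sub>q (oK i (mon [a] * mon f) - oL i (mon [a] * mon f)) else 0)"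
  proof (cases "i = j")
    case True
    \<comment> \<open>Here and below the inverses become atoms bound only by the polynomial
      relations \<open>q\<close>. Comparing coefficients then leaves ideal membership problems,
      which \<open>algebra\<close> decides.\<close>
    define c r where "c = inverse (qq - inverse qq)" and "r = inverse qq"
    have q: "qq * r = 1" "c * (qq - r) = 1"
      by (simp_all only: c_def r_def left_inverse[OF qq_neq_inverse] right_inverse[OF qq_nonzero])
    have IH': "oE j (oF j (mon f)) = oF j (oE j (mon f)) + c *\<^sub>q (oK j (mon f) - oL j (mon f))"
      using IH True by (simp add: c_def)
    have LE: "oL j (oE j y) = (r * r) *\<^sub>q oE j (oL j y)" for y
      by (simp add: oL_oE power_int_minus r_def power2_eq_square)
    have ir: "inverse qq = r" "inverse r = qq" by (simp_all add: r_def)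
    note rules = opr_E opr_F IH' LE lookup_add lookup_minus smul_mult_right distrib_left right_diff_distrib
    consider "a = j - 1/2" | "a = j + 1/2" | "a \<noteq> j - 1/2" "a \<noteq> j + 1/2" by blast
    then show ?thesis
    proof cases
      case 1
      then have k: "kap j a = qq" "kap j (j + 1/2) = r" by (simp_all add: kap_def r_def)
      show ?thesis unfolding True c_def[symmetric]
        by (rule poly_mapping_eqI) (simp add: 1 rules k[unfolded 1] ir, use q in algebra)
    next
      case 2
      then have k: "kap j a = r" "kap j (j - 1/2) = qq" by (simp_all add: kap_def r_def)
      show ?thesis unfolding True c_def[symmetric]
        by (rule poly_mapping_eqI) (simp add: 2 rules k[unfolded 2] ir, use q in algebra)
    next
      case 3
      then have k: "kap j a = 1" by (simp_all add: kap_def)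
      show ?thesis unfolding True c_def[symmetric]
        by (rule poly_mapping_eqI) (simp add: 3 rules k ir)
    qed
  next
    case False
    then have n: "j + 1/2 \<noteq> i + 1/2" "i - 1/2 \<noteq> j - 1/2" by auto
    \<comment> \<open>In the cross terms F_j changes the first letter and E_i the tail. The change
      of the K_i eigenvalue cancels the factor from moving K_j^{-1} past E_i.\<close>
    have "kap i (j + 1/2) *\<^sub>q oE i (oL j y) = kap i (j - 1/2) *\<^sub>q oL j (oE i y)" for y
      by (simp add: oL_oE kap_shift power_int_minus cartan_commute[of j i] mult.commute)
    then show ?thesis
      using IH False n
      by (auto simp: opr_E opr_F distrib_left smul.scale_right_distrib smul_mult_right simp flip: smul_mult_right)
  qed
qed (auto intro!: slin_intros slin_opr_comp)

lemma kap_simps [simp]: "kap i (i - 1/2) = qq" "kap i (i + 1/2) = inverse qq"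
  by (simp_all add: kap_def)

lemma kap_other: "a \<noteq> i - 1/2 \<Longrightarrow> a \<noteq> i + 1/2 \<Longrightarrow> kap i a = 1"
  by (simp add: kap_def)

lemma oE_low: "oE i (mon [i - 1/2] * x) = qq *\<^sub>q (mon [i - 1/2] * oE i x)"
  and oE_high: "oE i (mon [i + 1/2] * x) = mon [i - 1/2] * x + inverse qq *\<^sub>q (mon [i + 1/2] * oE i x)"
  and oE_other: "a \<noteq> i - 1/2 \<Longrightarrow> a \<noteq> i + 1/2 \<Longrightarrow> oE i (mon [a] * x) = mon [a] * oE i x"
  by (simp_all add: opr_E kap_other)

lemma oF_low: "oF i (mon [i - 1/2] * x) = mon [i + 1/2] * oL i x + mon [i - 1/2] * oF i x"
  and oF_high: "oF i (mon [i + 1/2] * x) = mon [i + 1/2] * oF i x"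
  and oF_other: "a \<noteq> i - 1/2 \<Longrightarrow> oF i (mon [a] * x) = mon [a] * oF i x"
  by (simp_all add: opr_F)

lemma oE_far:
  assumes "cartan i j = 0"
  shows "oE i (oE j x) = oE j (oE i x)"
proof (rule tens_eqI[where \<sigma> = "\<lambda>c. c" and x = x])
  have n: "i \<noteq> j" "j - 1/2 \<noteq> i + 1/2" "i - 1/2 \<noteq> j + 1/2"
    using assms by (auto simp: cartan_def abs_if split: if_splits)
  have k: "kap i (j - 1/2) = kap i (j + 1/2)" "kap j (i - 1/2) = kap j (i + 1/2)"
    using kap_shift[of i j] kap_shift[of j i] assms by (simp_all add: cartan_commute[of j i])
  show "oE i (oE j (mon [a] * mon f)) = oE j (oE i (mon [a] * mon f))"
    if "oE i (oE j (mon f)) = oE j (oE i (mon f))" for a f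
    using that n by (auto simp: opr_E k smul.scale_right_distrib mult.commute)
qed (auto intro!: slin_intros slin_opr_comp)

lemma oF_far:
  assumes "cartan i j = 0"
  shows "oF i (oF j x) = oF j (oF i x)"
proof (rule tens_eqI[where \<sigma> = "\<lambda>c. c" and x = x])
  have n: "i \<noteq> j" "j - 1/2 \<noteq> i + 1/2" "i - 1/2 \<noteq> j + 1/2"
    using assms by (auto simp: cartan_def abs_if split: if_splits)
  have L: "oL i (oF j y) = oF j (oL i y)" "oL j (oF i y) = oF i (oL j y)" for y
    using assms by (simp_all add: oL_oF cartan_commute[of j i])
  show "oF i (oF j (mon [a] * mon f)) = oF j (oF i (mon [a] * mon f))"
    if "oF i (oF j (mon f)) = oF j (oF i (mon f))" for a f
    using that n by (auto simp: opr_F L)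
qed (auto intro!: slin_intros slin_opr_comp)

lemma adjacent_cases:
  assumes "cartan i j = - 1"
  obtains "j = i + 1" | "j = i - 1"
  using assms by (auto simp: cartan_def abs_if split: if_splits)

lemma half_shift:
  "i + 1 - 1/2 = i + (1/2 :: rat)" "i + 1 + 1/2 = i + (3/2 :: rat)"
  "i - 1 - 1/2 = i - (3/2 :: rat)" "i - 1 + 1/2 = i - (1/2 :: rat)"
  by simp_all

text \<open>The letters of i + 1 and i - 1 are written as offsets from i, so that letters shared by
  neighbouring indices are syntactically equal.\<close>

lemmas oE_up = oE_low[of "i + 1", unfolded half_shift] oE_high[of "i + 1", unfolded half_shift]
  oE_other[of _ "i + 1", unfolded half_shift] for i
lemmas oE_down = oE_low[of "i - 1", unfolded half_shift] oE_high[of "i - 1", unfolded half_shift]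
  oE_other[of _ "i - 1", unfolded half_shift] for i
lemmas oF_up = oF_low[of "i + 1", unfolded half_shift] oF_high[of "i + 1", unfolded half_shift]
  oF_other[of _ "i + 1", unfolded half_shift] for i
lemmas oF_down = oF_low[of "i - 1", unfolded half_shift] oF_high[of "i - 1", unfolded half_shift]
  oF_other[of _ "i - 1", unfolded half_shift] for i

lemma letter_cases3: "P x \<Longrightarrow> P y \<Longrightarrow> (a \<noteq> x \<Longrightarrow> a \<noteq> y \<Longrightarrow> P a) \<Longrightarrow> P a"
  by blast

lemma letter_cases4: "P x \<Longrightarrow> P y \<Longrightarrow> P z \<Longrightarrow> (a \<noteq> x \<Longrightarrow> a \<noteq> y \<Longrightarrow> a \<noteq> z \<Longrightarrow> P a) \<Longrightarrow> P a"
  by blast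

lemma letter_cases5: "P x \<Longrightarrow> P y \<Longrightarrow> P z \<Longrightarrow> P w \<Longrightarrow>
    (a \<noteq> x \<Longrightarrow> a \<noteq> y \<Longrightarrow> a \<noteq> z \<Longrightarrow> a \<noteq> w \<Longrightarrow> P a) \<Longrightarrow> P a"
  by blast

text \<open>Only the three letters moved by E_i or E_j need a computation. The induction hypothesis
  is oriented as a rewrite rule for E_j E_i E_i, which brings both sides to a common form.\<close>

lemma serre_oE:
  assumes "cartan i j = - 1"
  shows "oE j (oE i (oE i x)) + oE i (oE i (oE j x)) = (qq + inverse qq) *\<^sub>q oE i (oE j (oE i x))"
proof (rule tens_eqI[where \<sigma> = "\<lambda>c. c" and x = x])
  fix a f
  assume IH: "oE j (oE i (oE i (mon f))) + oE i (oE i (oE j (mon f))) = (qq + inverse qq) *\<^sub>q oE i (oE j (oE i (mon f)))"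
  define r where "r = inverse qq"
  have q: "qq * r = 1" by (simp add: r_def)
  have IH': "oE j (oE i (oE i (mon f))) = (qq + r) *\<^sub>q oE i (oE j (oE i (mon f))) - oE i (oE i (oE j (mon f)))"
    using IH by (simp add: r_def algebra_simps)
  note rules = IH' lookup_add lookup_minus smul_mult_right distrib_left right_diff_distrib
    oE_low oE_high oE_other
  from assms show "oE j (oE i (oE i (mon [a] * mon f))) + oE i (oE i (oE j (mon [a] * mon f)))
      = (qq + inverse qq) *\<^sub>q oE i (oE j (oE i (mon [a] * mon f)))"
  proof (cases rule: adjacent_cases)
    case j: 1
    show ?thesis unfolding r_def[symmetric] j
      by (rule letter_cases4[where a = a and x = "i - 1/2" and y = "i + 1/2" and z = "i + 3/2"])
        (rule poly_mapping_eqI, simp add: oE_up rules[unfolded j] r_def[symmetric],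
          (use q in algebra)?)+
  next
    case j: 2
    show ?thesis unfolding r_def[symmetric] j
      by (rule letter_cases4[where a = a and x = "i - 3/2" and y = "i - 1/2" and z = "i + 1/2"])
        (rule poly_mapping_eqI, simp add: oE_down rules[unfolded j] r_def[symmetric],
          (use q in algebra)?)+
  qed
qed (auto intro!: slin_intros slin_opr_comp)

lemma serre_oF:
  assumes "cartan i j = - 1"
  shows "oF j (oF i (oF i x)) + oF i (oF i (oF j x)) = (qq + inverse qq) *\<^sub>q oF i (oF j (oF i x))"
proof (rule tens_eqI[where \<sigma> = "\<lambda>c. c" and x = x])
  fix a f
  assume IH: "oF j (oF i (oF i (mon f))) + oF i (oF i (oF j (mon f))) = (qq + inverse qq) *\<^sub>q oF i (oF j (oF i (mon f)))"
  define r where "r = inverse qq"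
  have q: "qq * r = 1" by (simp add: r_def)
  have IH': "oF j (oF i (oF i (mon f))) = (qq + r) *\<^sub>q oF i (oF j (oF i (mon f))) - oF i (oF i (oF j (mon f)))"
    using IH by (simp add: r_def algebra_simps)
  have L: "oL i (oF i y) = (qq * qq) *\<^sub>q oF i (oL i y)" "oL j (oF j y) = (qq * qq) *\<^sub>q oF j (oL j y)"
    "oL i (oF j y) = r *\<^sub>q oF j (oL i y)" "oL j (oF i y) = r *\<^sub>q oF i (oL j y)"
    "oL j (oL i y) = oL i (oL j y)" for y
    using assms by (simp_all add: oL_oF cartan_commute[of j i] r_def power2_eq_square power_int_minus oL_comm)
  note rules = IH' L lookup_add lookup_minus smul_mult_right distrib_left right_diff_distrib
    oF_low oF_high oF_other
  from assms show "oF j (oF i (oF i (mon [a] * mon f))) + oF i (oF i (oF j (mon [a] * mon f)))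
      = (qq + inverse qq) *\<^sub>q oF i (oF j (oF i (mon [a] * mon f)))"
  proof (cases rule: adjacent_cases)
    case j: 1
    show ?thesis unfolding r_def[symmetric] j
      by (rule letter_cases4[where a = a and x = "i - 1/2" and y = "i + 1/2" and z = "i + 3/2"])
        (rule poly_mapping_eqI, simp add: oF_up rules[unfolded j] r_def[symmetric],
          (use q in algebra)?)+
  next
    case j: 2
    show ?thesis unfolding r_def[symmetric] j
      by (rule letter_cases4[where a = a and x = "i - 3/2" and y = "i - 1/2" and z = "i + 1/2"])
        (rule poly_mapping_eqI, simp add: oF_down rules[unfolded j] r_def[symmetric],
          (use q in algebra)?)+
  qed
qed (auto intro!: slin_intros slin_opr_comp)

section \<open>The action of U: its defining relations act by zero\<close>

definition gact :: "nat \<Rightarrow> nat \<Rightarrow> gen \<Rightarrow> rat falg \<Rightarrow> rat falg" where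
  "gact r m g x = (if gidx g \<in> Iset r m then opr g x else 0)"

lemma slin_gact: "lin (gact r m g)"
  by (auto simp: gact_def intro!: slinI smul.scale_right_distrib)

lemma lin_ext_if_gact:
  "lin_ext (\<lambda>f. if gidx g \<in> Iset r m then gen_act g (letters f) else 0) = gact r m g"
proof
  show "lin_ext (\<lambda>f. if gidx g \<in> Iset r m then gen_act g (letters f) else 0) x = gact r m g x" for x
    by (rule slin_eq_mon[where \<sigma> = "\<lambda>c. c" and x = x])
      (simp_all add: slin_lin_ext slin_gact, simp add: gact_def opr_mon)
qed

lemma word_act_Nil [simp]: "word_act r m (Word []) x = x"
  by (simp add: word_act_def)

lemma word_act_Cons: "word_act r m (Word (g # gs)) x = gact r m g (word_act r m (Word gs) x)"
  by (simp add: word_act_def lin_ext_if_gact)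

lemma word_act_plus: "word_act r m (u + v) x = word_act r m u (word_act r m v x)"
  by (simp add: word_act_def lin_ext_if_gact)

lemma slin_word_act: "lin (word_act r m w)"
proof -
  have "lin (word_act r m (Word gs))" for gs
  proof (induction gs)
    case Nil
    show ?case by (simp add: slin_ident)
  next
    case (Cons g gs)
    from slin_comp[OF Cons slin_gact[of r m g]] show ?case by (simp add: word_act_Cons[abs_def])
  qed
  from this[of "letters w"] show ?thesis by simp
qed

lemma slin_act_left: "lin (\<lambda>u. act r m u x)"
  by (simp add: act_def slin_lin_ext)

lemma slin_act: "lin (act r m u)"
  unfolding act_def lin_ext_def
  by (intro slin_summation slin_scale) (simp add: slin_word_act)

lemmas act_lin [simp] = slin_simps[OF slin_act] slin_simps[OF slin_act_left]

lemma act_mon: "act r m (mon gs) x = word_act r m (Word gs) x"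
  by (simp add: act_def)

lemma act_gen [simp]: "act r m (mon [g]) x = gact r m g x"
  by (simp add: act_mon word_act_Cons)

lemma act_one [simp]: "act r m 1 x = x"
  using act_mon[of r m "[]" x] by simp

lemma act_mult [simp]: "act r m (u * v) x = act r m u (act r m v x)"
proof -
  have *: "act r m (mon gs * v) x = act r m (mon gs) (act r m v x)" for gs
  proof -
    have "lin (\<lambda>v. act r m (mon gs * v) x)" "lin (\<lambda>v. act r m (mon gs) (act r m v x))"
      by (auto intro!: slinI simp: distrib_left smul_mult_right)
    then show ?thesis
      by (rule slin_eq_mon) (simp add: act_mon word_act_plus flip: mon_append plus_fword_def,
        simp add: plus_fword_def flip: word_act_plus)
  qed
  have "lin (\<lambda>u. act r m (u * v) x)" "lin (\<lambda>u. act r m u (act r m v x))"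
    by (auto intro!: slinI simp: distrib_right smul_mult_left)
  then show ?thesis by (rule slin_eq_mon) (rule *)
qed

lemma act_ideal_zero:
  assumes "x \<in> two_sided_ideal S" "\<And>s v. s \<in> S \<Longrightarrow> act r m s v = 0"
  shows "act r m x v = 0"
  using assms(1) by induction (simp_all add: assms(2))

lemma qfact_simps: "qfact 0 = 1" "qfact (Suc 0) = 1" "qfact 2 = qq + inverse qq"
proof -
  have "(qq ^ 2 - inverse qq ^ 2) = (qq + inverse qq) * (qq - inverse qq)"
    by (simp add: power2_eq_square algebra_simps)
  then have "qint 2 = qq + inverse qq" "qint (Suc 0) = 1"
    by (simp_all only: qint_def nonzero_mult_div_cancel_right[OF qq_neq_inverse] power_one_right
      divide_self[OF qq_neq_inverse] flip: One_nat_def)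
  then show "qfact 0 = 1" "qfact (Suc 0) = 1" "qfact 2 = qq + inverse qq"
    by (simp_all add: qfact_def numeral_2_eq_2 atLeastAtMostSuc_conv)
qed

lemma qtwo_nonzero [simp]: "qq + inverse qq \<noteq> 0"
proof
  assume "qq + inverse qq = 0"
  then have "qq * qq + 1 = 0" by (simp add: field_simps)
  \<comment> \<open>The fraction field is ordered, so squares are nonnegative and q^2 + 1 is
    positive.\<close>
  moreover have "qq * qq \<ge> 0" by simp
  ultimately show False by (metis add_nonneg_pos less_irrefl zero_less_one)
qed

lemma divpow_simps: "divpow x 0 = 1" "divpow x (Suc 0) = x"
    "divpow x 2 = inverse (qq + inverse qq) *\<^sub>q (x * x)"
  by (simp_all add: divpow_def qfact_simps power2_eq_square)

lemma serre_0: "serre x y 0 = y * x - x * y"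
  by (simp add: serre_def divpow_simps)

lemma serre_m1: "serre x y (- 1) =
    inverse (qq + inverse qq) *\<^sub>q (y * x * x + x * x * y) - x * y * x"
  by (simp add: serre_def divpow_simps numeral_2_eq_2 atMost_Suc smul_mult_left smul_mult_right
     smul.scale_right_distrib mult.assoc) (simp add: divpow_simps smul_mult_left smul_mult_right mult.assoc flip: numeral_2_eq_2)

lemma cartan_neq: "i \<noteq> j \<Longrightarrow> cartan i j = 0 \<or> cartan i j = - 1"
  by (simp add: cartan_def)

lemma gact_simps:
  "i \<in> Iset r m \<Longrightarrow> gact r m (GenE i) x = oE i x"
  "i \<in> Iset r m \<Longrightarrow> gact r m (GenF i) x = oF i x"
  "i \<in> Iset r m \<Longrightarrow> gact r m (GenK i) x = oK i x"
  "i \<in> Iset r m \<Longrightarrow> gact r m (GenKinv i) x = oL i x"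
  by (simp_all add: gact_def)

lemma act_rels:
  assumes "s \<in> rels r m"
  shows "act r m s v = 0"
  using assms
proof cases
  case (rel_outside g)
  then show ?thesis by (simp add: gact_def)
next
  case (rel_EF i j)
  then show ?thesis by (simp add: gact_simps oE_oF[of i j])
next
  case (rel_serreE i j)
  then show ?thesis using cartan_neq[of i j]
    by (auto simp: gact_simps serre_0 serre_m1 serre_oE oE_far[of i j])
next
  case (rel_serreF i j)
  then show ?thesis using cartan_neq[of i j]
    by (auto simp: gact_simps serre_0 serre_m1 serre_oF oF_far[of i j])
qed (simp_all add: gact_simps oK_oE oK_oF oK_comm)

lemma ueq_act: "ueq r m x y \<Longrightarrow> act r m x v = act r m y v"
  using act_ideal_zero[of "x - y" "rels r m" r m v] by (simp add: ueq_def act_rels)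

section \<open>Braid operators\<close>

text \<open>Lusztig's operator \<open>T''\<^bsub>i,+1\<^esub>\<close> on tensor powers of the natural representation, by its formula
  \<open>T(v \<otimes> w) = (1 + (q - q\<^sup>-\<^sup>1) K\<^sub>i\<^sup>-\<^sup>1E\<^sub>i \<otimes> F\<^sub>iK\<^sub>i)(T v \<otimes> T w)\<close> on a tensor product.\<close>

fun braid_word :: "rat \<Rightarrow> rat list \<Rightarrow> rat falg" where
  "braid_word i [] = 1"
| "braid_word i (a # f) =
     (if a = i - 1/2
      then - (qq *\<^sub>q (mon [i + 1/2] * braid_word i f))
        - (qq - inverse qq) *\<^sub>q (mon [i - 1/2] * oF i (oK i (braid_word i f)))
      else if a = i + 1/2 then mon [i - 1/2] * braid_word i f
      else mon [a] * braid_word i f)"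

definition braid :: "rat \<Rightarrow> rat falg \<Rightarrow> rat falg" where
  "braid i = lin_ext (\<lambda>f. braid_word i (letters f))"

lemma slin_braid: "lin (braid i)"
  by (simp add: braid_def slin_lin_ext)

lemmas braid_lin [simp] = slin_simps[OF slin_braid]

lemma slin_braid_comp: "slin \<sigma> A \<Longrightarrow> slin \<sigma> (\<lambda>x. braid i (A x))"
  by (drule slin_comp[OF _ slin_braid]) simp

lemma braid_mon: "braid i (mon f) = braid_word i f"
  by (simp add: braid_def)

lemma braid_mon_Cons: "braid i (mon [a] * mon f) = braid_word i (a # f)"
  by (simp add: braid_mon flip: mon_Cons)

lemma braid_one [simp]: "braid i 1 = 1"
  using braid_mon[of i "[]"] by simp

lemma braid_low: "braid i (mon [i - 1/2] * x) = - (qq *\<^sub>q (mon [i + 1/2] * braid i x))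
    - (qq - inverse qq) *\<^sub>q (mon [i - 1/2] * oF i (oK i (braid i x)))"
  by (rule slin_eq_mon[where \<sigma> = "\<lambda>c. c" and x = x])
    (auto intro!: slin_intros slin_opr_comp slin_braid_comp simp: braid_mon_Cons braid_mon)

lemma braid_high: "braid i (mon [i + 1/2] * x) = mon [i - 1/2] * braid i x"
  by (rule slin_eq_mon[where \<sigma> = "\<lambda>c. c" and x = x])
    (auto intro!: slin_intros slin_opr_comp slin_braid_comp simp: braid_mon_Cons braid_mon)

lemma braid_other: "a \<noteq> i - 1/2 \<Longrightarrow> a \<noteq> i + 1/2 \<Longrightarrow> braid i (mon [a] * x) = mon [a] * braid i x"
  by (rule slin_eq_mon[where \<sigma> = "\<lambda>c. c" and x = x])
    (auto intro!: slin_intros slin_opr_comp slin_braid_comp simp: braid_mon_Cons braid_mon)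

lemma oK_low: "oK i (mon [i - 1/2] * x) = qq *\<^sub>q (mon [i - 1/2] * oK i x)"
  and oK_high: "oK i (mon [i + 1/2] * x) = inverse qq *\<^sub>q (mon [i + 1/2] * oK i x)"
  and oK_other: "a \<noteq> i - 1/2 \<Longrightarrow> a \<noteq> i + 1/2 \<Longrightarrow> oK i (mon [a] * x) = mon [a] * oK i x"
  by (simp_all add: kap_other)

lemma oL_low: "oL i (mon [i - 1/2] * x) = inverse qq *\<^sub>q (mon [i - 1/2] * oL i x)"
  and oL_high: "oL i (mon [i + 1/2] * x) = qq *\<^sub>q (mon [i + 1/2] * oL i x)"
  and oL_other: "a \<noteq> i - 1/2 \<Longrightarrow> a \<noteq> i + 1/2 \<Longrightarrow> oL i (mon [a] * x) = mon [a] * oL i x"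
  by (simp_all add: kap_other)

lemmas oK_up = oK_low[of "i + 1", unfolded half_shift] oK_high[of "i + 1", unfolded half_shift]
  oK_other[of _ "i + 1", unfolded half_shift] for i
lemmas oK_down = oK_low[of "i - 1", unfolded half_shift] oK_high[of "i - 1", unfolded half_shift]
  oK_other[of _ "i - 1", unfolded half_shift] for i
lemmas oL_up = oL_low[of "i + 1", unfolded half_shift] oL_high[of "i + 1", unfolded half_shift]
  oL_other[of _ "i + 1", unfolded half_shift] for i
lemmas oL_down = oL_low[of "i - 1", unfolded half_shift] oL_high[of "i - 1", unfolded half_shift]
  oL_other[of _ "i - 1", unfolded half_shift] for i

lemmas low_high = oE_low oE_high oE_other oF_low oF_high oF_other oK_low oK_high oK_other
  oL_low oL_high oL_other braid_low braid_high braid_other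
lemmas low_high_up = oE_up oF_up oK_up oL_up
lemmas low_high_down = oE_down oF_down oK_down oL_down

text \<open>As rewrite rules these bring every composite into a fixed order, F outermost, then E,
  then K.\<close>

lemma normal_order_self:
  "oK i (oE i y) = (qq * qq) *\<^sub>q oE i (oK i y)"
  "oK i (oF i y) = (inverse qq * inverse qq) *\<^sub>q oF i (oK i y)"
  "oL i (oE i y) = (inverse qq * inverse qq) *\<^sub>q oE i (oL i y)"
  "oL i (oF i y) = (qq * qq) *\<^sub>q oF i (oL i y)"
  "oE i (oF i y) = oF i (oE i y) + inverse (qq - inverse qq) *\<^sub>q (oK i y - oL i y)"
  by (simp_all add: oK_oE oK_oF oL_oE oL_oF oE_oF power2_eq_square power_int_minus)

lemmas braid_rules = low_high normal_order_self lookup_add lookup_minus smul_mult_right distrib_left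
  right_diff_distrib

lemma adjacent_rules:
  assumes "cartan i j = - 1"
  shows "oK i (oE j y) = inverse qq *\<^sub>q oE j (oK i y)" "oK j (oE i y) = inverse qq *\<^sub>q oE i (oK j y)"
    "oK i (oF j y) = qq *\<^sub>q oF j (oK i y)" "oK j (oF i y) = qq *\<^sub>q oF i (oK j y)"
    "oL i (oE j y) = qq *\<^sub>q oE j (oL i y)" "oL j (oE i y) = qq *\<^sub>q oE i (oL j y)"
    "oL i (oF j y) = inverse qq *\<^sub>q oF j (oL i y)" "oL j (oF i y) = inverse qq *\<^sub>q oF i (oL j y)"
    "oE i (oF j y) = oF j (oE i y)" "oE j (oF i y) = oF i (oE j y)"
    "oE j (oE i (oE i y)) = (qq + inverse qq) *\<^sub>q oE i (oE j (oE i y)) - oE i (oE i (oE j y))"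
    "oF j (oF i (oF i y)) = (qq + inverse qq) *\<^sub>q oF i (oF j (oF i y)) - oF i (oF i (oF j y))"
    "oK j (oK i y) = oK i (oK j y)" "oL j (oL i y) = oL i (oL j y)"
    "oL i (oK j y) = oK j (oL i y)" "oL j (oK i y) = oK i (oL j y)"
  using assms serre_oE[OF assms, of y] serre_oF[OF assms, of y]
  by (auto simp: oK_oE oK_oF oL_oE oL_oF oE_oF power_int_minus cartan_commute[of j i] eq_diff_eq
    oK_comm[of j i] oL_comm[of j i] oL_oK_comm)

lemma far_letters:
  assumes "cartan i j = 0"
  shows "i \<noteq> j" "j \<noteq> i" "j - 1/2 \<noteq> i + 1/2" "i - 1/2 \<noteq> j + 1/2" "j + 1/2 \<noteq> i - 1/2" "i + 1/2 \<noteq> j - 1/2"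
  using assms by (auto simp: cartan_def abs_if split: if_splits)

lemma far_rules:
  assumes "cartan i j = 0"
  shows "oK i (oE j y) = oE j (oK i y)" "oK j (oE i y) = oE i (oK j y)"
    "oK i (oF j y) = oF j (oK i y)" "oK j (oF i y) = oF i (oK j y)"
    "oL i (oE j y) = oE j (oL i y)" "oL j (oE i y) = oE i (oL j y)"
    "oL i (oF j y) = oF j (oL i y)" "oL j (oF i y) = oF i (oL j y)"
    "oE i (oF j y) = oF j (oE i y)" "oE j (oF i y) = oF i (oE j y)"
    "oE j (oE i y) = oE i (oE j y)" "oF j (oF i y) = oF i (oF j y)"
    "oK j (oK i y) = oK i (oK j y)" "oL j (oL i y) = oL i (oL j y)"
    "oL i (oK j y) = oK j (oL i y)" "oL j (oK i y) = oK i (oL j y)"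
  using assms
  by (auto simp: oK_oE oK_oF oL_oE oL_oF oE_oF cartan_commute[of j i] oE_far[OF assms] oF_far[OF assms]
    oK_comm[of j i] oL_comm[of j i] oL_oK_comm)

lemma braid_oE_self: "braid i (oE i x) = - oF i (oK i (braid i x))"
proof (rule tens_eqI[where \<sigma> = "\<lambda>c. c" and x = x])
  fix a f
  assume IH: "braid i (oE i (mon f)) = - oF i (oK i (braid i (mon f)))"
  define c r where "c = inverse (qq - inverse qq)" and "r = inverse qq"
  have q: "qq * r = 1" "c * (qq - r) = 1"
    by (simp_all only: c_def r_def left_inverse[OF qq_neq_inverse] right_inverse[OF qq_nonzero])
  note rules = braid_rules IH r_def[symmetric] c_def[symmetric, folded r_def]
  show "braid i (oE i (mon [a] * mon f)) = - oF i (oK i (braid i (mon [a] * mon f)))"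
    by (rule letter_cases3[where a = a and x = "i - 1/2" and y = "i + 1/2"];
        rule poly_mapping_eqI; simp (no_asm_simp) add: rules del: opr_K opr_L;
        ((use q in algebra) | simp add: algebra_simps))
qed (auto intro!: slin_intros slin_opr_comp slin_braid_comp)

lemma braid_oK_self: "braid i (oK i x) = oL i (braid i x)"
proof (rule tens_eqI[where \<sigma> = "\<lambda>c. c" and x = x])
  fix a f
  assume IH: "braid i (oK i (mon f)) = oL i (braid i (mon f))"
  define c r where "c = inverse (qq - inverse qq)" and "r = inverse qq"
  have q: "qq * r = 1" "c * (qq - r) = 1"
    by (simp_all only: c_def r_def left_inverse[OF qq_neq_inverse] right_inverse[OF qq_nonzero])
  note rules = braid_rules IH r_def[symmetric] c_def[symmetric, folded r_def]
  show "braid i (oK i (mon [a] * mon f)) = oL i (braid i (mon [a] * mon f))"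
    by (rule letter_cases3[where a = a and x = "i - 1/2" and y = "i + 1/2"];
        rule poly_mapping_eqI; simp (no_asm_simp) add: rules del: opr_K opr_L;
        ((use q in algebra) | simp add: algebra_simps))
qed (auto intro!: slin_intros slin_opr_comp slin_braid_comp)

lemma braid_oL_self: "braid i (oL i x) = oK i (braid i x)"
  by (metis braid_oK_self oK_oL)

lemma braid_oF_self: "braid i (oF i x) = - oL i (oE i (braid i x))"
proof (rule tens_eqI[where \<sigma> = "\<lambda>c. c" and x = x])
  fix a f
  assume IH: "braid i (oF i (mon f)) = - oL i (oE i (braid i (mon f)))"
  define c r where "c = inverse (qq - inverse qq)" and "r = inverse qq"
  have q: "qq * r = 1" "c * (qq - r) = 1"
    by (simp_all only: c_def r_def left_inverse[OF qq_neq_inverse] right_inverse[OF qq_nonzero])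
  note rules = braid_rules IH braid_oL_self r_def[symmetric] c_def[symmetric, folded r_def]
  show "braid i (oF i (mon [a] * mon f)) = - oL i (oE i (braid i (mon [a] * mon f)))"
    by (rule letter_cases3[where a = a and x = "i - 1/2" and y = "i + 1/2"];
        rule poly_mapping_eqI; simp (no_asm_simp) add: rules del: opr_K opr_L;
        ((use q in algebra) | simp add: algebra_simps))
qed (auto intro!: slin_intros slin_opr_comp slin_braid_comp)

lemma braid_oE_adjacent:
  assumes "cartan i j = - 1"
  shows "braid i (oE j x) = oE i (oE j (braid i x)) - inverse qq *\<^sub>q oE j (oE i (braid i x))"
proof (rule tens_eqI[where \<sigma> = "\<lambda>c. c" and x = x])
  fix a f
  assume IH: "braid i (oE j (mon f)) = oE i (oE j (braid i (mon f))) - inverse qq *\<^sub>q oE j (oE i (braid i (mon f)))"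
  define c r where "c = inverse (qq - inverse qq)" and "r = inverse qq"
  have q: "qq * r = 1" "c * (qq - r) = 1"
    by (simp_all only: c_def r_def left_inverse[OF qq_neq_inverse] right_inverse[OF qq_nonzero])
  note rules = IH braid_rules adjacent_rules[OF assms] r_def[symmetric] c_def[symmetric, folded r_def]
  from assms show "braid i (oE j (mon [a] * mon f)) = oE i (oE j (braid i (mon [a] * mon f))) - inverse qq *\<^sub>q oE j (oE i (braid i (mon [a] * mon f)))"
  proof (cases rule: adjacent_cases)
    case j: 1
    show ?thesis unfolding j
      by (rule letter_cases4[where a = a and x = "i - 1/2" and y = "i + 1/2" and z = "i + 3/2"];
          rule poly_mapping_eqI; simp (no_asm_simp) add: low_high_up rules[unfolded j] del: opr_K opr_L;
          ((use q in algebra) | simp add: algebra_simps))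
  next
    case j: 2
    show ?thesis unfolding j
      by (rule letter_cases4[where a = a and x = "i - 3/2" and y = "i - 1/2" and z = "i + 1/2"];
          rule poly_mapping_eqI; simp (no_asm_simp) add: low_high_down rules[unfolded j] del: opr_K opr_L;
          ((use q in algebra) | simp add: algebra_simps))
  qed
qed (auto intro!: slin_intros slin_opr_comp slin_braid_comp)

lemma braid_oK_adjacent:
  assumes "cartan i j = - 1"
  shows "braid i (oK j x) = oK j (oK i (braid i x))"
proof (rule tens_eqI[where \<sigma> = "\<lambda>c. c" and x = x])
  fix a f
  assume IH: "braid i (oK j (mon f)) = oK j (oK i (braid i (mon f)))"
  define c r where "c = inverse (qq - inverse qq)" and "r = inverse qq"
  have q: "qq * r = 1" "c * (qq - r) = 1"
    by (simp_all only: c_def r_def left_inverse[OF qq_neq_inverse] right_inverse[OF qq_nonzero])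
  note rules = IH braid_rules adjacent_rules[OF assms] r_def[symmetric] c_def[symmetric, folded r_def]
  from assms show "braid i (oK j (mon [a] * mon f)) = oK j (oK i (braid i (mon [a] * mon f)))"
  proof (cases rule: adjacent_cases)
    case j: 1
    show ?thesis unfolding j
      by (rule letter_cases4[where a = a and x = "i - 1/2" and y = "i + 1/2" and z = "i + 3/2"];
          rule poly_mapping_eqI; simp (no_asm_simp) add: low_high_up rules[unfolded j] del: opr_K opr_L;
          ((use q in algebra) | simp add: algebra_simps))
  next
    case j: 2
    show ?thesis unfolding j
      by (rule letter_cases4[where a = a and x = "i - 3/2" and y = "i - 1/2" and z = "i + 1/2"];
          rule poly_mapping_eqI; simp (no_asm_simp) add: low_high_down rules[unfolded j] del: opr_K opr_L;
          ((use q in algebra) | simp add: algebra_simps))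
  qed
qed (auto intro!: slin_intros slin_opr_comp slin_braid_comp)

lemma braid_oL_adjacent:
  assumes "cartan i j = - 1"
  shows "braid i (oL j x) = oL j (oL i (braid i x))"
  using braid_oK_adjacent[OF assms, of "oL j x"] by (metis oK_oL oL_oK oK_comm)

lemma braid_oF_adjacent:
  assumes "cartan i j = - 1"
  shows "braid i (oF j x) = oF j (oF i (braid i x)) - qq *\<^sub>q oF i (oF j (braid i x))"
proof (rule tens_eqI[where \<sigma> = "\<lambda>c. c" and x = x])
  fix a f
  assume IH: "braid i (oF j (mon f)) = oF j (oF i (braid i (mon f))) - qq *\<^sub>q oF i (oF j (braid i (mon f)))"
  define c r where "c = inverse (qq - inverse qq)" and "r = inverse qq"
  have q: "qq * r = 1" "c * (qq - r) = 1"
    by (simp_all only: c_def r_def left_inverse[OF qq_neq_inverse] right_inverse[OF qq_nonzero])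
  note rules = IH braid_oL_adjacent[OF assms] braid_rules adjacent_rules[OF assms] r_def[symmetric] c_def[symmetric, folded r_def]
  from assms show "braid i (oF j (mon [a] * mon f)) = oF j (oF i (braid i (mon [a] * mon f))) - qq *\<^sub>q oF i (oF j (braid i (mon [a] * mon f)))"
  proof (cases rule: adjacent_cases)
    case j: 1
    show ?thesis unfolding j
      by (rule letter_cases4[where a = a and x = "i - 1/2" and y = "i + 1/2" and z = "i + 3/2"];
          rule poly_mapping_eqI; simp (no_asm_simp) add: low_high_up rules[unfolded j] del: opr_K opr_L;
          ((use q in algebra) | simp add: algebra_simps))
  next
    case j: 2
    show ?thesis unfolding j
      by (rule letter_cases4[where a = a and x = "i - 3/2" and y = "i - 1/2" and z = "i + 1/2"];
          rule poly_mapping_eqI; simp (no_asm_simp) add: low_high_down rules[unfolded j] del: opr_K opr_L;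
          ((use q in algebra) | simp add: algebra_simps))
  qed
qed (auto intro!: slin_intros slin_opr_comp slin_braid_comp)

lemma braid_oE_far:
  assumes "cartan i j = 0"
  shows "braid i (oE j x) = oE j (braid i x)"
proof (rule tens_eqI[where \<sigma> = "\<lambda>c. c" and x = x])
  fix a f
  assume IH: "braid i (oE j (mon f)) = oE j (braid i (mon f))"
  note n = far_letters[OF assms]
  note rules = braid_rules IH far_rules[OF assms]
  show "braid i (oE j (mon [a] * mon f)) = oE j (braid i (mon [a] * mon f))"
    by (rule letter_cases5[where a = a and x = "i - 1/2" and y = "i + 1/2" and z = "j - 1/2" and w = "j + 1/2"];
        rule poly_mapping_eqI; simp (no_asm_simp) add: n rules del: opr_K opr_L)
qed (auto intro!: slin_intros slin_opr_comp slin_braid_comp)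

lemma braid_oK_far:
  assumes "cartan i j = 0"
  shows "braid i (oK j x) = oK j (braid i x)"
proof (rule tens_eqI[where \<sigma> = "\<lambda>c. c" and x = x])
  fix a f
  assume IH: "braid i (oK j (mon f)) = oK j (braid i (mon f))"
  note n = far_letters[OF assms]
  note rules = braid_rules IH far_rules[OF assms]
  show "braid i (oK j (mon [a] * mon f)) = oK j (braid i (mon [a] * mon f))"
    by (rule letter_cases5[where a = a and x = "i - 1/2" and y = "i + 1/2" and z = "j - 1/2" and w = "j + 1/2"];
        rule poly_mapping_eqI; simp (no_asm_simp) add: n rules del: opr_K opr_L)
qed (auto intro!: slin_intros slin_opr_comp slin_braid_comp)

lemma braid_oL_far:
  assumes "cartan i j = 0"
  shows "braid i (oL j x) = oL j (braid i x)"
  using braid_oK_far[OF assms, of "oL j x"] by (metis oK_oL oL_oK)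

lemma braid_oF_far:
  assumes "cartan i j = 0"
  shows "braid i (oF j x) = oF j (braid i x)"
proof (rule tens_eqI[where \<sigma> = "\<lambda>c. c" and x = x])
  fix a f
  assume IH: "braid i (oF j (mon f)) = oF j (braid i (mon f))"
  note n = far_letters[OF assms]
  note rules = braid_rules IH braid_oL_far[OF assms] far_rules[OF assms]
  show "braid i (oF j (mon [a] * mon f)) = oF j (braid i (mon [a] * mon f))"
    by (rule letter_cases5[where a = a and x = "i - 1/2" and y = "i + 1/2" and z = "j - 1/2" and w = "j + 1/2"];
        rule poly_mapping_eqI; simp (no_asm_simp) add: n rules del: opr_K opr_L)
qed (auto intro!: slin_intros slin_opr_comp slin_braid_comp)

text \<open>Needed to transfer identities: T_i(x) is known only on vectors of the form
  \<open>braid i v\<close>, and by surjectivity these are all vectors.\<close>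

lemma braid_surj: "\<exists>x. braid i x = y"
proof -
  have mul: "\<exists>x. braid i x = mon [a] * braid i y" for a y
  proof -
    consider "a = i - 1/2" | "a = i + 1/2" | "a \<noteq> i - 1/2" "a \<noteq> i + 1/2" by blast
    then show ?thesis
    proof cases
      case 1
      then show ?thesis using braid_high by metis
    next
      case 2
      \<comment> \<open>The witness solves \<open>braid_low\<close> for its first term. The unwanted
        F_i K_i term is cancelled because \<open>braid\<close> turns E_i into -F_i K_i.\<close>
      have "braid i (inverse qq *\<^sub>q ((qq - inverse qq) *\<^sub>q (mon [i + 1/2] * oE i y) - mon [i - 1/2] * y))
          = mon [a] * braid i y"
        by (simp add: 2 braid_low braid_high braid_oE_self smul.scale_right_distrib smul.scale_right_diff_distrib)
      then show ?thesis by blast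
    next
      case 3
      then show ?thesis using braid_other by metis
    qed
  qed
  have "\<exists>x. braid i x = mon f" for f
  proof (induction f)
    case Nil
    then show ?case by (metis braid_one mon_Nil)
  next
    case (Cons a f)
    then show ?case using mul mon_Cons by metis
  qed
  then obtain b where b: "braid i (b f) = mon f" for f by metis
  have "braid i (lin_ext (\<lambda>w. b (letters w)) y) = y"
    by (rule slin_eq_mon[where \<sigma> = "\<lambda>c. c" and x = y])
      (simp_all add: b slin_ident slin_braid_comp slin_lin_ext)
  then show ?thesis by blast
qed

section \<open>Lusztig's automorphisms are implemented by the braid operators\<close>

lemma T_gen_far:
  assumes "cartan i j = 0"
  shows "T_gen i (GenE j) = gE j" "T_gen i (GenF j) = gF j" "T_gen i (GenK j) = gK j" "T_gen i (GenKinv j) = gKinv j"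
  using assms by (auto simp: divpow_simps Kpow_def)

lemma T_gen_adjacent:
  assumes "cartan i j = - 1"
  shows "T_gen i (GenE j) = gE i * gE j - inverse qq *\<^sub>q (gE j * gE i)"
    "T_gen i (GenF j) = gF j * gF i - qq *\<^sub>q (gF i * gF j)"
    "T_gen i (GenK j) = gK j * gK i" "T_gen i (GenKinv j) = gKinv j * gKinv i"
  using assms by (auto simp: divpow_simps Kpow_def)

lemma T_gen_self:
  "T_gen i (GenE i) = - (gF i * gK i)" "T_gen i (GenF i) = - (gKinv i * gE i)"
  "T_gen i (GenK i) = gK i * (gKinv i * gKinv i)" "T_gen i (GenKinv i) = gKinv i * (gK i * gK i)"
  by (simp_all add: Kpow_def power2_eq_square)

lemma gact_outside: "gidx g \<notin> Iset r m \<Longrightarrow> gact r m g v = 0"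
  by (simp add: gact_def)

lemma act_T_gen:
  assumes i: "i \<in> Iset r m"
  shows "act r m (T_gen i g) (braid i v) = braid i (gact r m g v)"
proof -
  note [simp] = gact_simps[OF i] gact_simps gact_outside
  consider "gidx g = i" | "cartan i (gidx g) = - 1" | "cartan i (gidx g) = 0"
    using cartan_neq[of i "gidx g"] by fastforce
  then show ?thesis
  proof cases
    case 1
    then show ?thesis using i
      by (cases g) (simp_all add: T_gen_self braid_oE_self braid_oF_self braid_oK_self braid_oL_self
        del: T_gen.simps)
  next
    case 2
    then show ?thesis
      by (cases g; cases "gidx g \<in> Iset r m")
        (simp_all add: T_gen_adjacent braid_oE_adjacent braid_oF_adjacent braid_oK_adjacent braid_oL_adjacent
          del: T_gen.simps)
  next
    case 3
    then show ?thesis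
      by (cases g; cases "gidx g \<in> Iset r m")
        (simp_all add: T_gen_far braid_oE_far braid_oF_far braid_oK_far braid_oL_far del: T_gen.simps)
  qed
qed

lemma act_T:
  assumes "i \<in> Iset r m"
  shows "act r m (alg_hom (T_gen i) x) (braid i v) = braid i (act r m x v)"
proof -
  have *: "act r m (alg_hom (T_gen i) (mon gs)) (braid i v) = braid i (act r m (mon gs) v)" for gs
  proof (induction gs)
    case (Cons g gs)
    then show ?case unfolding mon_Cons[of g gs] alg_hom_mult act_mult
      by (simp add: act_T_gen[OF assms] del: T_gen.simps)
  qed simp
  have "lin (\<lambda>x. act r m (alg_hom (T_gen i) x) (braid i v))" "lin (\<lambda>x. braid i (act r m x v))"
    by (auto intro!: slinI)
  then show ?thesis by (rule slin_eq_mon) (rule *)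
qed

text \<open>Only the action on tensor powers matters, so it is enough that \<open>T\<^sub>i\<close> respects \<open>sim\<close>; that it respects
  the relations of \<open>U\<close> (in particular the Serre relations) need not be checked.\<close>

definition sim :: "nat \<Rightarrow> nat \<Rightarrow> gen falg \<Rightarrow> gen falg \<Rightarrow> bool" where
  "sim r m x y \<longleftrightarrow> (\<forall>v. act r m x v = act r m y v)"

lemma sim_T:
  assumes "i \<in> Iset r m" "sim r m x y"
  shows "sim r m (alg_hom (T_gen i) x) (alg_hom (T_gen i) y)"
  unfolding sim_def
proof
  fix v
  obtain w where "v = braid i w" using braid_surj[of i v] by metis
  then show "act r m (alg_hom (T_gen i) x) v = act r m (alg_hom (T_gen i) y) v"
    using assms by (simp add: act_T sim_def)
qed

lemma sim_refl [simp]: "sim r m x x"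
  and sim_sym: "sim r m x y \<Longrightarrow> sim r m y x"
  and sim_trans [trans]: "sim r m x y \<Longrightarrow> sim r m y z \<Longrightarrow> sim r m x z"
  and sim_mult: "sim r m x y \<Longrightarrow> sim r m x' y' \<Longrightarrow> sim r m (x * x') (y * y')"
  and sim_diff: "sim r m x y \<Longrightarrow> sim r m x' y' \<Longrightarrow> sim r m (x - x') (y - y')"
  and sim_smul: "sim r m x y \<Longrightarrow> sim r m (c *\<^sub>q x) (c *\<^sub>q y)"
  by (simp_all add: sim_def)

section \<open>Root vectors as iterated q-commutators\<close>

definition qcomm :: "gen falg \<Rightarrow> gen falg \<Rightarrow> gen falg" where
  "qcomm x y = x * y - inverse qq *\<^sub>q (y * x)"

lemma sim_qcomm: "sim r m x y \<Longrightarrow> sim r m x' y' \<Longrightarrow> sim r m (qcomm x x') (qcomm y y')"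
  unfolding qcomm_def by (intro sim_diff sim_mult sim_smul)

lemma alg_hom_qcomm [simp]: "alg_hom \<phi> (qcomm x y) = qcomm (alg_hom \<phi> x) (alg_hom \<phi> y)"
  by (simp add: qcomm_def)

text \<open>After expansion the outer terms xyz and zyx agree. The middle terms are yxz and zxy on
  one side, yzx and xzy on the other, and they match because x and z commute.\<close>

lemma qcomm_assoc:
  assumes "sim r m (x * z) (z * x)"
  shows "sim r m (qcomm (qcomm x y) z) (qcomm x (qcomm y z))"
  using assms
  by (simp add: sim_def qcomm_def algebra_simps smul.scale_right_diff_distrib)

text \<open>The index reached from eps n after t steps towards -eps n, with eps = 1 or -1. For n =
  m/2 the steps t = 1, ..., m - 1 run through the black indices, and t = m is -eps n itself.\<close>

definition root_ix :: "rat \<Rightarrow> rat \<Rightarrow> nat \<Rightarrow> rat" where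
  "root_ix n \<epsilon> t = \<epsilon> * (n - of_nat t)"

text \<open>Up to \<open>sim\<close>, these are the values \<open>T\<^sub>w(E\<^bsub>\<epsilon>n\<^esub>)\<close> for reduced words \<open>w\<close> in \<open>I\<^sub>\<bullet>\<close>; \<open>k\<close> is the number of
  places by which \<open>w\<close> moves the letter \<open>\<epsilon>(n - 1/2)\<close>.\<close>

fun root_E :: "rat \<Rightarrow> rat \<Rightarrow> nat \<Rightarrow> gen falg" where
  "root_E n \<epsilon> 0 = gE (root_ix n \<epsilon> 0)"
| "root_E n \<epsilon> (Suc k) = qcomm (gE (root_ix n \<epsilon> (Suc k))) (root_E n \<epsilon> k)"

lemma sim_E_far:
  assumes "cartan i j = 0"
  shows "sim r m (gE i * gE j) (gE j * gE i)"
  using oE_far[OF assms] by (auto simp: sim_def gact_def)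

lemma qcomm_commute:
  assumes "sim r m (z * x) (x * z)" "sim r m (z * y) (y * z)"
  shows "sim r m (z * qcomm x y) (qcomm x y * z)"
  using assms by (simp add: sim_def qcomm_def algebra_simps)

lemma cartan_root:
  assumes "\<bar>\<epsilon>\<bar> = (1 :: rat)"
  shows "cartan (root_ix n \<epsilon> l) (root_ix n \<epsilon> t) = (if l = t then 2 else if l = Suc t \<or> t = Suc l then -1 else 0)"
proof -
  have e: "\<epsilon> * (n - of_nat l) - \<epsilon> * (n - of_nat t) = \<epsilon> * (of_nat t - of_nat l)"
    by (simp add: algebra_simps)
  have "\<epsilon> \<noteq> 0" using assms by auto
  moreover have "\<bar>\<epsilon> * (of_nat t - of_nat l)\<bar> = \<bar>of_nat t - of_nat l\<bar>"
    by (simp add: abs_mult assms)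
  moreover have "\<bar>rat_of_nat t - of_nat l\<bar> = 1 \<longleftrightarrow> l = Suc t \<or> t = Suc l"
    by (auto simp: abs_if)
  ultimately show ?thesis unfolding cartan_def root_ix_def e by auto
qed

context
  fixes r m :: nat and n \<epsilon> :: rat
  assumes eps: "\<bar>\<epsilon>\<bar> = 1"
begin

abbreviation "ix t \<equiv> root_ix n \<epsilon> t"

lemma T_root_outer: "k + 2 \<le> l \<Longrightarrow> alg_hom (T_gen (ix l)) (root_E n \<epsilon> k) = root_E n \<epsilon> k"
  by (induction k) (simp_all add: root_E.simps cartan_root[OF eps] T_gen_far del: T_gen.simps)

lemma root_commute: "k + 2 \<le> l \<Longrightarrow> sim r m (gE (ix l) * root_E n \<epsilon> k) (root_E n \<epsilon> k * gE (ix l))"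
  by (induction k)
    (simp_all add: root_E.simps cartan_root[OF eps] sim_E_far qcomm_commute)

text \<open>For k > 0, applying T replaces the outermost E of the root vector by a q-commutator of
  two neighbours. The new E commutes with the rest of the root vector, so \<open>qcomm_assoc\<close>
  moves the brackets.\<close>

lemma T_root_step: "sim r m (alg_hom (T_gen (ix (Suc k))) (root_E n \<epsilon> k)) (root_E n \<epsilon> (Suc k))"
proof (cases k)
  case 0
  then show ?thesis
    by (simp add: root_E.simps cartan_root[OF eps] T_gen_adjacent qcomm_def del: T_gen.simps)
next
  case (Suc t)
  have "alg_hom (T_gen (ix (Suc k))) (root_E n \<epsilon> k)
      = qcomm (qcomm (gE (ix (Suc k))) (gE (ix k))) (root_E n \<epsilon> t)"
    by (simp add: Suc root_E.simps cartan_root[OF eps] T_gen_adjacent T_root_outer qcomm_def[of "gE _" "gE _"]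
      del: T_gen.simps)
  then show ?thesis
    using qcomm_assoc[OF root_commute[of t "Suc k"]] by (simp add: Suc root_E.simps)
qed

text \<open>Write E' for the E of the next index and E for that of the index of T. Regrouping
  exposes the q-commutator of [E', E] with \<open>root_E\<close> up to l. Then T turns [E', E] back
  into E' and lengthens the other factor by E, so the root vector is restored. Further E's are
  fixed.\<close>

lemma T_root_inner:
  assumes "l + 1 < k" "\<And>t. t \<le> k \<Longrightarrow> ix t \<in> Iset r m"
  shows "sim r m (alg_hom (T_gen (ix (Suc l))) (root_E n \<epsilon> k)) (root_E n \<epsilon> k)"
  using assms
proof (induction k)
  case (Suc k)
  let ?T = "alg_hom (T_gen (ix (Suc l)))"
  let ?E' = "gE (ix (Suc (Suc l)))" and ?E = "gE (ix (Suc l))"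
  show ?case
  proof (cases "k = Suc l")
    case True
    have I: "ix (Suc l) \<in> Iset r m" "ix (Suc (Suc l)) \<in> Iset r m"
      using Suc.prems(2)[of "Suc l"] Suc.prems(2)[of "Suc (Suc l)"] True by auto
    have c: "cartan (ix (Suc l)) (ix (Suc (Suc l))) = - 1" "cartan (ix (Suc (Suc l))) (ix (Suc l)) = - 1"
      by (simp_all only: cartan_root[OF eps]) simp_all
    have "sim r m (?T (qcomm ?E' ?E)) ?E'"
    proof -
      define i j where "i = ix (Suc l)" and "j = ix (Suc (Suc l))"
      have "T_gen i (GenE j) = qcomm (gE i) (gE j)"
        unfolding i_def j_def qcomm_def by (rule T_gen_adjacent(1)[OF c(1)])
      then have "?T (qcomm ?E' ?E) = qcomm (qcomm (gE i) (gE j)) (- (gF i * gK i))"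
        unfolding i_def[symmetric] j_def[symmetric] by (simp add: T_gen_self del: T_gen.simps)
      \<comment> \<open>T_i maps the q-commutator [E_j, E_i] to [[E_i, E_j], -F_i K_i]. In the
        latter E_i is cancelled against F_i K_i and E_j remains.\<close>
      moreover have "act r m (qcomm (qcomm (gE i) (gE j)) (- (gF i * gK i))) v = oE j v" for v
      proof (rule poly_mapping_eqI)
        fix w
        note ij = c[folded i_def j_def] and I' = I[folded i_def j_def]
        define c r' where "c = inverse (qq - inverse qq)" and "r' = inverse qq"
        have q: "qq * r' = 1" "c * (qq - r') = 1"
          by (simp_all only: c_def r'_def left_inverse[OF qq_neq_inverse] right_inverse[OF qq_nonzero])
        show "coeff_at (act r m (qcomm (qcomm (gE i) (gE j)) (- (gF i * gK i))) v) w = coeff_at (oE j v) w"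
          by (simp add: qcomm_def gact_simps[OF I'(1)] gact_simps[OF I'(2)] normal_order_self
            adjacent_rules[OF ij(1)] lookup_add lookup_minus
            right_diff_distrib distrib_left r'_def[symmetric] c_def[symmetric, folded r'_def])
            (use q in algebra)
      qed
      ultimately show ?thesis by (simp add: sim_def gact_simps I j_def)
    qed
    then have "sim r m (?T (qcomm (qcomm ?E' ?E) (root_E n \<epsilon> l))) (qcomm ?E' (root_E n \<epsilon> (Suc l)))"
      unfolding alg_hom_qcomm[of _ "qcomm _ _"] by (intro sim_qcomm T_root_step)
    moreover have "sim r m (?T (root_E n \<epsilon> (Suc k))) (?T (qcomm (qcomm ?E' ?E) (root_E n \<epsilon> l)))"
      unfolding True root_E.simps by (intro sim_T I sim_sym[OF qcomm_assoc] root_commute) simp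
    ultimately show ?thesis using sim_trans unfolding True root_E.simps by blast
  next
    case False
    then have "sim r m (?T (root_E n \<epsilon> k)) (root_E n \<epsilon> k)" using Suc by simp
    moreover have "?T (gE (ix (Suc k))) = gE (ix (Suc k))"
      using Suc.prems False by (simp add: cartan_root[OF eps] T_gen_far del: T_gen.simps)
    ultimately show ?thesis unfolding root_E.simps alg_hom_qcomm by (simp add: sim_qcomm)
  qed
qed simp

end

section \<open>Reduced words in type A\<close>

lemma seg_iff: "i \<in> seg x y \<longleftrightarrow> i - x \<in> \<int> \<and> x \<le> i \<and> i \<le> y"
proof
  assume *: "i - x \<in> \<int> \<and> x \<le> i \<and> i \<le> y"
  then obtain z where z: "i - x = of_int z" by (auto elim: Ints_cases)
  with * have "z \<ge> 0" by (metis diff_ge_0_iff_ge of_int_0_le_iff)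
  then have "i = x + of_nat (nat z)" using z by (simp add: algebra_simps)
  with * show "i \<in> seg x y" by (auto simp: seg_def)
qed (auto simp: seg_def)

lemma half_double: "half m + half m \<in> \<int>"
  by (simp add: half_def)

lemma Ints_shift: "z - w \<in> \<int> \<Longrightarrow> x - z \<in> \<int> \<longleftrightarrow> x - w \<in> (\<int> :: rat set)"
  using Ints_add[of "x - z" "z - w"] Ints_diff[of "x - w" "z - w"] by auto

lemma Iset_iff: "i \<in> Iset r m \<longleftrightarrow> i - half m \<in> \<int> \<and> \<bar>i\<bar> \<le> half m + of_nat r - 1"
proof -
  have "1 - half m - of_nat r - half m = 1 - of_nat r - (half m + half m)" by simp
  then have "1 - half m - of_nat r - half m \<in> \<int>"
    using half_double[of m] by (metis Ints_1 Ints_diff Ints_of_nat)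
  from Ints_shift[OF this, of i] show ?thesis unfolding Iset_def seg_iff by (auto simp: abs_le_iff)
qed

lemma Iblack_iff: "i \<in> Iblack m \<longleftrightarrow> i - half m \<in> \<int> \<and> \<bar>i\<bar> \<le> half m - 1"
proof -
  have "1 - half m - half m = 1 - (half m + half m)" by simp
  then have "1 - half m - half m \<in> \<int>"
    using half_double[of m] by (metis Ints_1 Ints_diff)
  from Ints_shift[OF this, of i] show ?thesis unfolding Iblack_def seg_iff by (auto simp: abs_le_iff)
qed

lemma finite_seg: "finite (seg x y)"
proof -
  have "seg x y \<subseteq> (\<lambda>k. x + of_nat k) ` {..nat \<lceil>y - x\<rceil>}"
  proof
    fix i assume "i \<in> seg x y"
    then obtain k where k: "i = x + of_nat k" "x + of_nat k \<le> y" by (auto simp: seg_def)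
    then have "rat_of_nat k \<le> y - x" by simp
    then have "int k \<le> \<lceil>y - x\<rceil>" by linarith
    then show "i \<in> (\<lambda>k. x + of_nat k) ` {..nat \<lceil>y - x\<rceil>}" using k by auto
  qed
  then show ?thesis by (rule finite_subset) simp
qed

lemma finite_Iset [simp]: "finite (Iset r m)"
  by (simp add: Iset_def finite_seg)

lemma Iblack_subset: "Iblack m \<subseteq> Iset r m"
  by (auto simp: Iset_iff Iblack_iff)

text \<open>\<open>letter_perm ws\<close> is the inverse of the permutation of the letters given by the word \<open>ws\<close>.\<close>

definition letter_swap :: "rat \<Rightarrow> rat \<Rightarrow> rat" where
  "letter_swap j = Transposition.transpose (j - 1/2) (j + 1/2)"

fun letter_perm :: "rat list \<Rightarrow> rat \<Rightarrow> rat" where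
  "letter_perm [] x = x"
| "letter_perm (i # is) x = letter_perm is (letter_swap i x)"

text \<open>With \<open>\<alpha>\<^sub>i = \<epsilon>\<^bsub>i-1/2\<^esub> - \<epsilon>\<^bsub>i+1/2\<^esub>\<close>, these are the coordinates of \<open>\<Sum> \<nu>\<^sub>i \<alpha>\<^sub>i\<close> with respect to the \<open>\<epsilon>\<^sub>a\<close>, which
  the Weyl group permutes.\<close>

definition wt_diff :: "(rat \<Rightarrow> int) \<Rightarrow> rat \<Rightarrow> int" where
  "wt_diff \<nu> a = \<nu> (a + 1/2) - \<nu> (a - 1/2)"

section \<open>The Weyl group of type A as a group of permutations of letters\<close>

lemma letter_swap_invol [simp]: "letter_swap i (letter_swap i x) = x"
  by (simp add: letter_swap_def)

lemma inj_letter_perm: "letter_perm ws x = letter_perm ws y \<longleftrightarrow> x = y"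
  by (induction ws arbitrary: x y) (auto, metis letter_swap_invol)

lemma refl_A_closed: "i \<in> Iset r m \<Longrightarrow> \<nu> \<in> Ylat r m \<Longrightarrow> refl_A r m i \<nu> \<in> Ylat r m"
  by (auto simp: Ylat_def refl_A_def)

lemma weyl_closed: "set ws \<subseteq> Iset r m \<Longrightarrow> \<nu> \<in> Ylat r m \<Longrightarrow> weyl r m ws \<nu> \<in> Ylat r m"
  by (induction ws) (auto simp: weyl_def refl_A_closed)

lemma sum_cartan:
  assumes "\<nu> \<in> Ylat r m" "i \<in> Iset r m"
  shows "(\<Sum>j\<in>Iset r m. cartan i j * \<nu> j) = 2 * \<nu> i - \<nu> (i - 1) - \<nu> (i + 1)"
proof -
  have "(\<Sum>j\<in>Iset r m. cartan i j * \<nu> j) = (\<Sum>j\<in>Iset r m \<union> {i - 1, i, i + 1}. cartan i j * \<nu> j)"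
    using assms by (intro sum.mono_neutral_left) (auto simp: Ylat_def)
  also have "\<dots> = (\<Sum>j\<in>{i - 1, i, i + 1}. cartan i j * \<nu> j)"
    by (intro sum.mono_neutral_right) (auto simp: cartan_def abs_if split: if_splits)
  also have "\<dots> = 2 * \<nu> i - \<nu> (i - 1) - \<nu> (i + 1)"
    by (simp add: cartan_def)
  finally show ?thesis .
qed

lemma wt_diff_refl:
  assumes "\<nu> \<in> Ylat r m" "i \<in> Iset r m"
  shows "wt_diff (refl_A r m i \<nu>) a = wt_diff \<nu> (letter_swap i a)"
proof -
  consider "a = i - 1/2" | "a = i + 1/2" | "a \<noteq> i - 1/2" "a \<noteq> i + 1/2" by blast
  then show ?thesis
  proof cases
    case 3
    then have "a + 1/2 \<noteq> i" "a - 1/2 \<noteq> i" by auto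
    with 3 show ?thesis by (simp add: wt_diff_def refl_A_def letter_swap_def)
  qed (simp_all add: wt_diff_def refl_A_def letter_swap_def sum_cartan[OF assms] add.commute[of 1 i])
qed

lemma wt_diff_weyl:
  "set ws \<subseteq> Iset r m \<Longrightarrow> \<nu> \<in> Ylat r m \<Longrightarrow> wt_diff (weyl r m ws \<nu>) a = wt_diff \<nu> (letter_perm ws a)"
proof (induction ws arbitrary: a)
  case (Cons i ws)
  have "weyl r m (i # ws) \<nu> = refl_A r m i (weyl r m ws \<nu>)" by (simp add: weyl_def)
  then show ?case using Cons by (simp add: wt_diff_refl weyl_closed)
qed (simp add: weyl_def)

text \<open>The difference of the two coefficient functions has period 1 and vanishes outside
  \<open>Iset\<close>, hence everywhere.\<close>

lemma wt_diff_inj: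
  assumes "\<nu> \<in> Ylat r m" "\<nu>' \<in> Ylat r m" "\<And>a. wt_diff \<nu> a = wt_diff \<nu>' a"
  shows "\<nu> = \<nu>'"
proof
  fix i
  define \<delta> where "\<delta> = (\<lambda>i. \<nu> i - \<nu>' i)"
  have step: "\<delta> x = \<delta> (x - 1)" for x
    using assms(3)[of "x - 1/2"] by (simp add: wt_diff_def \<delta>_def)
  have down: "\<delta> i = \<delta> (i - of_nat k)" for k
  proof (induction k)
    case (Suc k)
    then show ?case using step[of "i - of_nat k"] by (simp add: algebra_simps)
  qed simp
  obtain k where "of_nat k > i + half m + of_nat r" using reals_Archimedean2 by blast
  then have "i - of_nat k \<notin> Iset r m" by (auto simp: Iset_iff abs_le_iff)
  then have "\<delta> (i - of_nat k) = 0" using assms by (simp add: Ylat_def \<delta>_def)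
  then show "\<nu> i = \<nu>' i" using down[of k] by (simp add: \<delta>_def)
qed

lemma weyl_eqI:
  assumes "set ws \<subseteq> Iset r m" "set js \<subseteq> Iset r m" "\<And>a. letter_perm ws a = letter_perm js a" "\<nu> \<in> Ylat r m"
  shows "weyl r m ws \<nu> = weyl r m js \<nu>"
  by (rule wt_diff_inj[of _ r m]) (simp_all add: weyl_closed wt_diff_weyl assms)

lemma letter_perm_fixes:
  "(\<And>i. i \<in> set ws \<Longrightarrow> a \<noteq> i - 1/2 \<and> a \<noteq> i + 1/2) \<Longrightarrow> letter_perm ws a = a"
  by (induction ws) (simp_all add: letter_swap_def)

lemma letter_perm_closed:
  assumes "set ws \<subseteq> I" "a \<in> (\<lambda>i. i - 1/2) ` I \<union> (\<lambda>i. i + 1/2) ` I"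
  shows "letter_perm ws a \<in> (\<lambda>i. i - 1/2) ` I \<union> (\<lambda>i. i + 1/2) ` I"
  using assms by (induction ws arbitrary: a) (auto simp: letter_swap_def Transposition.transpose_def)

lemma letter_perm_eqI:
  assumes ws: "set ws \<subseteq> Iset r m" and js: "set js \<subseteq> Iset r m"
    and eq: "\<And>\<nu>. \<nu> \<in> Ylat r m \<Longrightarrow> weyl r m ws \<nu> = weyl r m js \<nu>"
  shows "letter_perm ws a = letter_perm js a"
proof (cases "a \<in> (\<lambda>i. i - 1/2) ` Iset r m \<union> (\<lambda>i. i + 1/2) ` Iset r m")
  case False
  then show ?thesis using ws js by (subst (1 2) letter_perm_fixes) (auto simp: image_iff subset_iff)
next
  case True
  define x y where "x = letter_perm ws a" and "y = letter_perm js a"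
  have xy: "x \<in> (\<lambda>i. i - 1/2) ` Iset r m \<union> (\<lambda>i. i + 1/2) ` Iset r m"
    unfolding x_def using letter_perm_closed[OF ws True] .
  \<comment> \<open>Test elements: the simple root of i has coordinate 1 only at the letter i - 1/2
    and -1 only at i + 1/2, so these values separate letters.\<close>
  have *: "wt_diff (\<lambda>j. if j = i then 1 else 0) x = wt_diff (\<lambda>j. if j = i then 1 else 0) y" if "i \<in> Iset r m" for i
  proof -
    have "(\<lambda>j. if j = i then 1 else 0) \<in> Ylat r m" using that by (auto simp: Ylat_def)
    then show ?thesis unfolding x_def y_def using eq wt_diff_weyl[OF ws] wt_diff_weyl[OF js] by metis
  qed
  from xy consider i where "i \<in> Iset r m" "x = i - 1/2" | i where "i \<in> Iset r m" "x = i + 1/2" by blast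
  then have "x = y"
    by cases (use * in \<open>force simp: wt_diff_def split: if_splits\<close>)+
  then show ?thesis by (simp add: x_def y_def)
qed

text \<open>Makes the parity of the length of a word an invariant of the permutation;
  \<open>longest_descent\<close> uses it to sharpen a bound on lengths by one.\<close>

lemma letter_perm_sign:
  "permutation (letter_perm ws) \<and> sign (letter_perm ws) = (- 1) ^ length ws"
proof (induction ws)
  case Nil
  have "letter_perm [] = id" by auto
  then show ?case by (simp add: sign_id)
next
  case (Cons i ws)
  have "letter_perm (i # ws) = letter_perm ws \<circ> letter_swap i" by auto
  moreover have i: "permutation (letter_swap i)" "sign (letter_swap i) = - 1"
    by (simp_all add: letter_swap_def permutation_swap_id sign_swap_id)
  moreover have "sign (letter_perm ws \<circ> letter_swap i) = (- 1) ^ length (i # ws)"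
    using Cons i by (subst sign_compose) simp_all
  ultimately show ?case using Cons by (simp only: permutation_compose simp_thms)
qed

text \<open>An adjacent transposition on the lattice i - 1/2 + Z reverses the order of no pair but
  the one that it swaps.\<close>

lemma letter_swap_mono:
  assumes "x - y \<in> \<int>" "x - (i - 1/2) \<in> \<int>" "x < y" "\<not> (x = i - 1/2 \<and> y = i + 1/2)"
  shows "letter_swap i x < letter_swap i y"
proof -
  obtain u v where u: "x = i - 1/2 + of_int u" and v: "x - y = of_int v"
    using assms(1,2) by (metis Ints_cases add_diff_cancel_left' diff_add_cancel add.commute)
  then have y: "y = i - 1/2 + of_int (u - v)" by simp
  have "v < 0" using v assms(3) by (metis diff_less_0_iff_less of_int_less_0_iff)
  moreover have "\<not> (u = 0 \<and> u - v = 1)" using assms(4) u y by auto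
  ultimately have lt: "(if u = 0 then 1 else if u = 1 then 0 else u)
      < (if u - v = 0 then 1 else if u - v = 1 then 0 else u - v)" by auto
  have "letter_swap i (i - 1/2 + of_int z) = i - 1/2 + of_int (if z = 0 then 1 else if z = 1 then 0 else z)" for z
    by (auto simp: letter_swap_def Transposition.transpose_def)
  then show ?thesis unfolding u(1) y using lt by (simp only: add_less_cancel_left of_int_less_iff)
qed

text \<open>The exchange condition. Follow x < y through the word: by
  \<open>letter_swap_mono\<close> the order can be reversed only by a letter that swaps the two
  current images. Deleting this letter has the effect of swapping x and y beforehand.\<close>

lemma letter_perm_exchange:
  assumes "x < y" "letter_perm ws y < letter_perm ws x" "x - y \<in> \<int>" "\<And>i. i \<in> set ws \<Longrightarrow> x - (i - 1/2) \<in> \<int>"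
  shows "\<exists>js. set js \<subseteq> set ws \<and> length js + 1 = length ws \<and>
    (\<forall>a. letter_perm js a = letter_perm ws (Transposition.transpose x y a))"
  using assms
proof (induction ws arbitrary: x y)
  case (Cons i ws)
  show ?case
  proof (cases "x = i - 1/2 \<and> y = i + 1/2")
    case True
    then show ?thesis by (intro exI[of _ ws]) (auto simp flip: letter_swap_def)
  next
    case False
    have d: "letter_swap i z - z \<in> \<int>" for z
      by (auto simp: letter_swap_def Transposition.transpose_def)
    let ?x = "letter_swap i x" and ?y = "letter_swap i y"
    have "?x < ?y" using Cons.prems False by (intro letter_swap_mono) auto
    moreover have "?x - ?y \<in> \<int>"
      using Ints_add[OF Ints_diff[OF d[of x] d[of y]] Cons.prems(3)] by simp
    moreover have "?x - (k - 1/2) \<in> \<int>" if "k \<in> set ws" for k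
      using Ints_add[OF d[of x] Cons.prems(4)[of k]] that by (simp add: algebra_simps)
    ultimately obtain js where js: "set js \<subseteq> set ws" "length js + 1 = length ws"
      "\<And>a. letter_perm js a = letter_perm ws (Transposition.transpose ?x ?y a)"
      using Cons.IH[of ?x ?y] Cons.prems(2) by auto
    have inj: "letter_swap i a = letter_swap i b \<longleftrightarrow> a = b" for a b
      by (metis letter_swap_invol)
    have "Transposition.transpose ?x ?y (letter_swap i a) = letter_swap i (Transposition.transpose x y a)" for a
      by (simp add: Transposition.transpose_def inj)
    then show ?thesis using js by (intro exI[of _ "i # js"]) auto
  qed
qed simp

section \<open>Reduced words and longest words\<close>

lemma reduced_le:
  assumes "reduced r m ws" "set js \<subseteq> Iset r m" "\<And>\<nu>. \<nu> \<in> Ylat r m \<Longrightarrow> weyl r m js \<nu> = weyl r m ws \<nu>"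
  shows "length ws \<le> length js"
  using assms by (simp add: reduced_def)

lemma reduced_tl: "reduced r m (j # ws) \<Longrightarrow> reduced r m ws"
  unfolding reduced_def
proof (elim conjE, intro conjI allI impI)
  fix js
  assume *: "\<forall>js. set js \<subseteq> Iset r m \<and> (\<forall>\<nu>\<in>Ylat r m. weyl r m js \<nu> = weyl r m (j # ws) \<nu>) \<longrightarrow> length (j # ws) \<le> length js"
    and js: "set js \<subseteq> Iset r m \<and> (\<forall>\<nu>\<in>Ylat r m. weyl r m js \<nu> = weyl r m ws \<nu>)" and "set (j # ws) \<subseteq> Iset r m"
  then have "length (j # ws) \<le> length (j # js)"
    by (intro *[rule_format]) (auto simp: weyl_def)
  then show "length ws \<le> length js" by simp
qed auto

text \<open>At a descent the exchange condition would delete a letter of \<open>ws\<close> and give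
  a word for the element of \<open>j # ws\<close> with two letters less.\<close>

lemma reduced_ascent:
  assumes "reduced r m (j # ws)"
  shows "letter_perm ws (j - 1/2) < letter_perm ws (j + 1/2)"
proof (rule ccontr)
  assume "\<not> ?thesis"
  then have "letter_perm ws (j + 1/2) < letter_perm ws (j - 1/2)"
    using inj_letter_perm[of ws "j - 1/2" "j + 1/2"] by auto
  moreover have I: "set (j # ws) \<subseteq> Iset r m" using assms by (simp add: reduced_def)
  moreover have "j - 1/2 - (i - 1/2) \<in> \<int>" if "i \<in> set ws" for i
    using I that Ints_diff[of "j - half m" "i - half m"] by (auto simp: Iset_iff)
  ultimately obtain js where js: "set js \<subseteq> set ws" "length js + 1 = length ws"
    "\<And>a. letter_perm js a = letter_perm ws (letter_swap j a)"
    using letter_perm_exchange[of "j - 1/2" "j + 1/2" ws] by (auto simp: letter_swap_def)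
  have "weyl r m js \<nu> = weyl r m (j # ws) \<nu>" if "\<nu> \<in> Ylat r m" for \<nu>
    by (rule weyl_eqI) (use js I that in auto)
  then have "length (j # ws) \<le> length js"
    using js I by (intro reduced_le[OF assms]) auto
  with js show False by simp
qed

text \<open>Suppose that j is an ascent. By maximality \<open>j # ws\<close> is not reduced, so its
  element has a shorter word \<open>js\<close>. By parity \<open>js\<close> is even shorter than
  \<open>ws\<close>, and then \<open>j # js\<close> is a reduced word for the element of
  \<open>ws\<close>. The ascent of \<open>js\<close> at j, from \<open>reduced_ascent\<close>, is a
  descent of \<open>ws\<close>.\<close>

lemma longest_descent:
  assumes "longest_word r m ws" "j \<in> Iblack m"
  shows "letter_perm ws (j + 1/2) < letter_perm ws (j - 1/2)"
proof (rule ccontr)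
  assume "\<not> ?thesis"
  then have asc: "letter_perm ws (j - 1/2) < letter_perm ws (j + 1/2)"
    using inj_letter_perm[of ws "j - 1/2" "j + 1/2"] by auto
  have I: "set ws \<subseteq> Iset r m" "j \<in> Iset r m" and red: "reduced r m ws"
    using assms Iblack_subset[of m r] by (auto simp: longest_word_def)
  have "\<not> reduced r m (j # ws)"
  proof
    assume "reduced r m (j # ws)"
    then have "length (j # ws) \<le> length ws"
      using assms unfolding longest_word_def by (metis insert_subset list.simps(15))
    then show False by simp
  qed
  then obtain js where js: "set js \<subseteq> Iset r m" "\<And>\<nu>. \<nu> \<in> Ylat r m \<Longrightarrow> weyl r m js \<nu> = weyl r m (j # ws) \<nu>"
    "length js < length (j # ws)"
    using I unfolding reduced_def by auto
  have perm: "letter_perm js a = letter_perm (j # ws) a" for a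
    by (rule letter_perm_eqI[of _ r m]) (use js I in auto)
  then have "letter_perm js = letter_perm (j # ws)" by blast
  then have "(- 1 :: int) ^ length js = (- 1) ^ length (j # ws)" by (metis letter_perm_sign)
  then have "even (length js) \<longleftrightarrow> even (length (j # ws))"
    by (metis neg_one_even_power neg_one_odd_power one_neq_neg_one)
  with js(3) have short: "length js < length ws" by (auto simp: less_Suc_eq)
  have weyl: "weyl r m (j # js) \<nu> = weyl r m ws \<nu>" if "\<nu> \<in> Ylat r m" for \<nu>
    by (rule weyl_eqI) (use js I that perm in auto)
  have "length (j # js) \<le> length ks"
    if "set ks \<subseteq> Iset r m" "\<forall>\<nu>\<in>Ylat r m. weyl r m ks \<nu> = weyl r m (j # js) \<nu>" for ks
    using reduced_le[OF red that(1)] that(2) weyl short by simp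
  then have "reduced r m (j # js)"
    using js(1) I by (simp add: reduced_def)
  from reduced_ascent[OF this] show False using asc perm by (simp add: letter_swap_def)
qed

section \<open>The root vector attached to the longest black word\<close>

lemma letter_perm_bound:
  assumes "set ws \<subseteq> Iblack m" "j \<in> Iblack m"
  shows "\<bar>letter_perm ws (j - 1/2)\<bar> \<le> half m - 1/2" "\<bar>letter_perm ws (j + 1/2)\<bar> \<le> half m - 1/2"
proof -
  have b: "\<bar>a\<bar> \<le> half m - 1/2" if "a \<in> (\<lambda>i. i - 1/2) ` Iblack m \<union> (\<lambda>i. i + 1/2) ` Iblack m" for a
    using that by (auto simp: Iblack_iff abs_le_iff)
  show "\<bar>letter_perm ws (j - 1/2)\<bar> \<le> half m - 1/2"
    by (rule b, rule letter_perm_closed[OF assms(1)]) (use assms(2) in auto)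
  show "\<bar>letter_perm ws (j + 1/2)\<bar> \<le> half m - 1/2"
    by (rule b, rule letter_perm_closed[OF assms(1)]) (use assms(2) in auto)
qed

lemma Iblack_root_ix:
  assumes "j \<in> Iblack m" "\<bar>\<epsilon>\<bar> = (1 :: rat)"
  obtains l where "l + 1 < m" "j = root_ix (half m) \<epsilon> (Suc l)"
proof -
  have e: "\<epsilon> = 1 \<or> \<epsilon> = - 1" using assms(2) by (auto simp: abs_if split: if_splits)
  have j: "j - half m \<in> \<int>" "\<bar>j\<bar> \<le> half m - 1" using assms(1) by (auto simp: Iblack_iff)
  have "half m - 1 - \<epsilon> * j \<in> \<int>"
  proof (cases "\<epsilon> = 1")
    case True
    then show ?thesis using Ints_minus[OF Ints_add[OF j(1) Ints_1]] by (simp add: algebra_simps)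
  next
    case False
    then show ?thesis using e Ints_diff[OF Ints_add[OF j(1) half_double[of m]] Ints_1] by (simp add: algebra_simps)
  qed
  moreover have "half m - 1 - \<epsilon> * j \<ge> 0" using j(2) e by (auto simp: abs_le_iff)
  ultimately obtain l :: nat where l: "half m - 1 - \<epsilon> * j = of_nat l"
    by (metis Ints_cases of_int_0_le_iff of_int_of_nat_eq zero_le_imp_eq_int)
  have "rat_of_nat (l + 1) \<le> 2 * half m - 1" using j(2) e l by (auto simp: abs_le_iff)
  then have "rat_of_nat (l + 1) + 1 \<le> of_nat m" by (simp add: half_def)
  then have "l + 1 < m" by (metis Suc_eq_plus1 Suc_le_lessD of_nat_Suc of_nat_le_iff add.commute)
  moreover have "j = root_ix (half m) \<epsilon> (Suc l)"
    using l e by (auto simp: root_ix_def algebra_simps)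
  ultimately show ?thesis by (rule that)
qed

lemma root_ix_Iset:
  assumes "t < m" "r \<ge> 1" "\<bar>\<epsilon>\<bar> = (1 :: rat)"
  shows "root_ix (half m) \<epsilon> t \<in> Iset r m"
proof -
  have e: "\<epsilon> = 1 \<or> \<epsilon> = - 1" using assms(3) by (auto simp: abs_if split: if_splits)
  have "half m - of_nat t - half m \<in> \<int>" by simp
  moreover have "- (half m - of_nat t) - half m \<in> \<int>"
    using Ints_diff[OF Ints_of_nat[of t] half_double[of m]] by (simp add: algebra_simps)
  moreover have "\<bar>half m - of_nat t\<bar> \<le> half m"
  proof -
    have "rat_of_nat t \<le> half m + half m" using assms(1) by (simp add: half_def)
    then show ?thesis by (simp add: abs_le_iff)
  qed
  ultimately show ?thesis using e assms(2) by (auto simp: Iset_iff root_ix_def)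
qed

text \<open>The letters numbered inwards from the extremal letter eps(n - 1/2). The transposition of
  \<open>root_ix n \<epsilon> (Suc l)\<close> swaps the letters with numbers l and l + 1.\<close>

definition root_letter :: "rat \<Rightarrow> rat \<Rightarrow> nat \<Rightarrow> rat" where
  "root_letter n \<epsilon> t = \<epsilon> * (n - 1/2 - of_nat t)"

lemma root_ix_letters:
  "root_ix n 1 (Suc l) - 1/2 = root_letter n 1 (Suc l)" "root_ix n 1 (Suc l) + 1/2 = root_letter n 1 l"
  "root_ix n (- 1) (Suc l) - 1/2 = root_letter n (- 1) l"
  "root_ix n (- 1) (Suc l) + 1/2 = root_letter n (- 1) (Suc l)"
  by (simp_all add: root_ix_def root_letter_def)

lemma letter_swap_root:
  assumes "\<bar>\<epsilon>\<bar> = (1 :: rat)"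
  shows "letter_swap (root_ix n \<epsilon> (Suc l)) (root_letter n \<epsilon> t) =
    root_letter n \<epsilon> (if t = l then Suc l else if t = Suc l then l else t)"
proof -
  have e: "\<epsilon> = 1 \<or> \<epsilon> = - 1" using assms by (auto simp: abs_if split: if_splits)
  have inj: "root_letter n \<epsilon> s = root_letter n \<epsilon> t \<longleftrightarrow> s = t" for s t
    using e by (auto simp: root_letter_def)
  have "letter_swap (root_ix n \<epsilon> (Suc l)) = Transposition.transpose (root_letter n \<epsilon> l) (root_letter n \<epsilon> (Suc l))"
    using e by (auto simp: letter_swap_def root_ix_letters transpose_commute)
  then show ?thesis by (simp add: Transposition.transpose_def inj)
qed

lemma T_word_root:
  assumes "set ws \<subseteq> Iblack m" "reduced r m ws" "m \<ge> 1" "r \<ge> 1" and eps: "\<bar>\<epsilon>\<bar> = (1 :: rat)"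
  shows "\<exists>k<m. sim r m (T_word ws (gE (\<epsilon> * half m))) (root_E (half m) \<epsilon> k) \<and>
    letter_perm ws (root_letter (half m) \<epsilon> k) = root_letter (half m) \<epsilon> 0"
  using assms(1,2)
proof (induction ws)
  case Nil
  show ?case using assms(3) by (intro exI[of _ 0]) (simp add: T_word_def root_ix_def)
next
  case (Cons j ws)
  let ?n = "half m"
  have e: "\<epsilon> = 1 \<or> \<epsilon> = - 1" using eps by (auto simp: abs_if split: if_splits)
  from Cons obtain k where k: "k < m" "sim r m (T_word ws (gE (\<epsilon> * ?n))) (root_E ?n \<epsilon> k)"
      "letter_perm ws (root_letter ?n \<epsilon> k) = root_letter ?n \<epsilon> 0"
    using reduced_tl[of r m j ws] by auto
  obtain l where l: "l + 1 < m" "j = root_ix ?n \<epsilon> (Suc l)"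
    using Iblack_root_ix[of j m \<epsilon>] Cons.prems eps by auto
  have jI: "j \<in> Iset r m" unfolding l(2) using l(1) assms(4) eps by (intro root_ix_Iset) auto
  have T: "sim r m (T_word (j # ws) (gE (\<epsilon> * ?n))) (alg_hom (T_gen j) (root_E ?n \<epsilon> k))"
    using sim_T[OF jI k(2)] by (simp add: T_word_def)
  \<comment> \<open>Otherwise prepending j would move the letter back outwards. But
    \<open>letter_perm ws\<close> takes letter number k to the extremal value, which then lies on
    the wrong side for the ascent at j.\<close>
  have "k \<noteq> Suc l"
  proof
    assume "k = Suc l"
    have "letter_perm ws (j - 1/2) < letter_perm ws (j + 1/2)"
      using Cons.prems by (intro reduced_ascent) auto
    moreover have "\<bar>letter_perm ws (j - 1/2)\<bar> \<le> half m - 1/2" "\<bar>letter_perm ws (j + 1/2)\<bar> \<le> half m - 1/2"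
      using Cons.prems letter_perm_bound[of ws m j] by auto
    moreover have "root_letter ?n 1 0 = ?n - 1/2" "root_letter ?n (- 1) 0 = 1/2 - ?n"
      by (simp_all add: root_letter_def)
    ultimately show False using k(3)[unfolded \<open>k = Suc l\<close>] e l(2)
      by (elim disjE) (simp_all only: root_ix_letters abs_le_iff, linarith+)
  qed
  \<comment> \<open>What remains: j continues the chain of indices in the root vector, lies apart
    from it, or lies strictly inside it. The root vector grows in the first case only.\<close>
  then consider "k = l" | "k + 2 \<le> Suc l" | "l + 1 < k" by linarith
  then show ?case
  proof cases
    case 1
    have "letter_perm (j # ws) (root_letter ?n \<epsilon> (Suc l)) = root_letter ?n \<epsilon> 0"
      using k(3) by (simp add: l(2) letter_swap_root[OF eps] 1)
    moreover have "sim r m (T_word (j # ws) (gE (\<epsilon> * ?n))) (root_E ?n \<epsilon> (Suc l))"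
      using sim_trans[OF T] T_root_step[OF eps, of r m ?n k] 1 l(2) by blast
    ultimately show ?thesis using l(1) by (intro exI[of _ "Suc l"]) simp
  next
    case 2
    have "letter_perm (j # ws) (root_letter ?n \<epsilon> k) = root_letter ?n \<epsilon> 0"
      using k(3) 2 by (simp add: l(2) letter_swap_root[OF eps])
    moreover have "sim r m (T_word (j # ws) (gE (\<epsilon> * ?n))) (root_E ?n \<epsilon> k)"
      using T T_root_outer[OF eps 2, of ?n] l(2) by simp
    ultimately show ?thesis using k(1) by blast
  next
    case 3
    have "letter_perm (j # ws) (root_letter ?n \<epsilon> k) = root_letter ?n \<epsilon> 0"
      using k(3) 3 by (simp add: l(2) letter_swap_root[OF eps])
    moreover have "sim r m (alg_hom (T_gen j) (root_E ?n \<epsilon> k)) (root_E ?n \<epsilon> k)"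
      unfolding l(2) by (rule T_root_inner[OF eps 3]) (use k(1) assms(4) eps in \<open>simp add: root_ix_Iset\<close>)
    ultimately show ?thesis using k(1) sim_trans[OF T] by blast
  qed
qed

lemma T_longest:
  assumes "longest_word r m ws" "m \<ge> 1" "r \<ge> 1" and eps: "\<bar>\<epsilon>\<bar> = (1 :: rat)"
  shows "sim r m (T_word ws (gE (\<epsilon> * half m))) (root_E (half m) \<epsilon> (m - 1))"
proof -
  let ?n = "half m"
  have e: "\<epsilon> = 1 \<or> \<epsilon> = - 1" using eps by (auto simp: abs_if split: if_splits)
  have ws: "set ws \<subseteq> Iblack m" "reduced r m ws" using assms(1) by (auto simp: longest_word_def)
  obtain k where k: "k < m" "sim r m (T_word ws (gE (\<epsilon> * ?n))) (root_E ?n \<epsilon> k)"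
      "letter_perm ws (root_letter ?n \<epsilon> k) = root_letter ?n \<epsilon> 0"
    using T_word_root[OF ws assms(2,3) eps] by blast
  have "k = m - 1"
  proof (rule ccontr)
    assume "k \<noteq> m - 1"
    with k(1) have "Suc k < m" by simp
    \<comment> \<open>The black index that would move letter number k one place further. Its descent
      would require a value of \<open>letter_perm ws\<close> beyond the extremal one.\<close>
    define j where "j = root_ix ?n \<epsilon> (Suc k)"
    have j: "j = \<epsilon> * (?n - 1 - of_nat k)" by (simp add: j_def root_ix_def algebra_simps)
    have n: "rat_of_nat k + 2 \<le> ?n + ?n" using \<open>Suc k < m\<close> by (simp add: half_def)
    have "j - ?n \<in> \<int>"
    proof (cases "\<epsilon> = 1")
      case True
      then show ?thesis by (simp add: j)
    next
      case False
      have "1 + of_nat k - (?n + ?n) \<in> \<int>" using half_double[of m] by (intro Ints_diff) auto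
      then show ?thesis using False e by (simp add: j algebra_simps)
    qed
    then have "j \<in> Iblack m" using n e by (auto simp: Iblack_iff j abs_le_iff)
    from longest_descent[OF assms(1) this] letter_perm_bound[OF ws(1) this]
    show False using k(3) e
      by (elim disjE) (simp_all only: j_def root_ix_letters abs_le_iff, simp_all add: root_letter_def)
  qed
  then show ?thesis using k by simp
qed

lemma T_word_far:
  assumes "\<And>j. j \<in> set ws \<Longrightarrow> cartan j i = 0"
  shows "T_word ws (gE i) = gE i"
  using assms by (induction ws) (simp_all add: T_word_def T_gen_far del: T_gen.simps)

section \<open>The hermitian form and adjoints\<close>

text \<open>Multiplying the unit by the value makes a functional into a semilinear map of the
  algebra, so that extension from words applies to scalar identities as well.\<close>

lemma functional_ext:
  fixes F G :: "'a falg \<Rightarrow> qf"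
  assumes F: "\<And>x y. F (x + y) = F x + F y" "\<And>c x. F (c *\<^sub>q x) = \<sigma> c * F x"
    and G: "\<And>x y. G (x + y) = G x + G y" "\<And>c x. G (c *\<^sub>q x) = \<sigma> c * G x"
    and eq: "\<And>f. Word f \<in> Poly_Mapping.keys x \<Longrightarrow> F (mon f) = G (mon f)"
  shows "F x = G x"
proof -
  define A B :: "'a falg \<Rightarrow> 'a falg" where "A = (\<lambda>x. F x *\<^sub>q 1)" and "B = (\<lambda>x. G x *\<^sub>q 1)"
  have "slin \<sigma> A" "slin \<sigma> B"
    by (auto intro!: slinI simp: A_def B_def F G smul.scale_left_distrib)
  then have "A x = B x" by (rule slin_eq_mon) (simp add: A_def B_def eq)
  then show ?thesis by (simp add: A_def B_def)
qed

lemma std_form_superset: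
  "finite S \<Longrightarrow> Poly_Mapping.keys x \<subseteq> S \<Longrightarrow> std_form x y = (\<Sum>f\<in>S. coeff_at x f * coeff_at y f)"
  unfolding std_form_def by (rule sum.mono_neutral_left) (auto simp: in_keys_iff)

lemma std_form_add_left: "std_form (x + x') y = std_form x y + std_form x' y"
  using keys_add[of x x']
  by (simp add: std_form_superset[where S = "Poly_Mapping.keys x \<union> Poly_Mapping.keys x'"]
      lookup_add distrib_right sum.distrib)

lemma std_form_smul_left: "std_form (c *\<^sub>q x) y = c * std_form x y"
  using keys_smul[of c x]
  by (simp add: std_form_superset[where S = "Poly_Mapping.keys x"] sum_distrib_left mult.assoc)

lemma std_form_add_right: "std_form x (y + y') = std_form x y + std_form x y'"
  by (simp add: std_form_def lookup_add distrib_left sum.distrib)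

lemma std_form_smul_right: "std_form x (c *\<^sub>q y) = c * std_form x y"
  by (simp add: std_form_def sum_distrib_left mult_ac)

lemma std_form_mon_left [simp]: "std_form (mon f) y = coeff_at y (Word f)"
  by (simp add: std_form_def mon_def)

lemma slin_Dmap: "slin qbar Dmap"
  by (simp add: Dmap_def slin_antilin_ext)

lemmas Dmap_simps [simp] = slin_simps[OF slin_Dmap]

lemma Dmap_mon [simp]: "Dmap (mon f) = mon (map uminus f)"
  by (simp add: Dmap_def)

definition hform :: "rat falg \<Rightarrow> rat falg \<Rightarrow> qf" where
  "hform x y = std_form x (Dmap y)"

lemma hform_add: "hform (x + x') y = hform x y + hform x' y" "hform x (y + y') = hform x y + hform x y'"
  and hform_smul: "hform (c *\<^sub>q x) y = c * hform x y" "hform x (c *\<^sub>q y) = qbar c * hform x y"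
  by (simp_all add: hform_def std_form_add_left std_form_smul_left std_form_add_right std_form_smul_right)

lemma hform_0 [simp]: "hform 0 y = 0" "hform x 0 = 0"
  using hform_smul(1)[of 0 0 y] hform_smul(2)[of x 0 0] by simp_all

lemma hform_uminus: "hform (- x) y = - hform x y" "hform x (- y) = - hform x y"
  using hform_add(1)[of x "- x" y] hform_add(2)[of x y "- y"] by (simp_all add: add_eq_0_iff)

lemma hform_diff: "hform (x - x') y = hform x y - hform x' y" "hform x (y - y') = hform x y - hform x y'"
  using hform_add(1)[of x "- x'" y] hform_add(2)[of x y "- y'"] by (simp_all add: hform_uminus)

lemmas hform_simps = hform_add hform_smul hform_uminus hform_diff

lemma hform_sum: "hform x (\<Sum>i\<in>I. f i) = (\<Sum>i\<in>I. hform x (f i))"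
  by (induction I rule: infinite_finite_induct) (simp_all add: hform_add)

lemma coeff_mon: "coeff_at (mon g) (Word f) = (if f = g then 1 else 0)"
  by (auto simp: mon_def lookup_single)

lemma hform_mon: "hform (mon f) (mon g) = (if f = map uminus g then 1 else 0)"
  by (auto simp: hform_def coeff_mon)

lemma hform_Cons [simp]: "hform (mon [a] * x) (mon [b] * y) = (if a = - b then hform x y else 0)"
proof -
  have "hform (mon [a] * mon f) (mon [b] * y) = (if a = - b then hform (mon f) y else 0)" for f
    by (rule functional_ext[where \<sigma> = qbar and x = y and F = "\<lambda>y. hform (mon [a] * mon f) (mon [b] * y)"
          and G = "\<lambda>y. if a = - b then hform (mon f) y else 0"])
      (simp_all add: hform_simps distrib_left smul_mult_right hform_mon mon_append[symmetric])
  then show ?thesis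
    by (intro functional_ext[where \<sigma> = "\<lambda>c. c" and x = x and F = "\<lambda>x. hform (mon [a] * x) (mon [b] * y)"
          and G = "\<lambda>x. if a = - b then hform x y else 0"])
      (simp_all add: hform_simps distrib_left smul_mult_right)
qed

lemma hform_one [simp]: "hform 1 1 = 1" "hform 1 (mon [b] * y) = 0" "hform (mon [a] * x) 1 = 0"
proof -
  show "hform 1 1 = 1" using hform_mon[of "[]" "[]"] by simp
  have "hform (mon []) (mon [b] * y) = 0"
    by (rule functional_ext[where \<sigma> = qbar and x = y and F = "\<lambda>y. hform (mon []) (mon [b] * y)"
          and G = "\<lambda>y. 0"])
      (simp_all add: hform_simps distrib_left smul_mult_right hform_mon mon_append[symmetric] del: mon_Nil)
  then show "hform 1 (mon [b] * y) = 0" by simp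
  have "hform (mon [a] * x) (mon []) = 0"
    by (rule functional_ext[where \<sigma> = "\<lambda>c. c" and x = x and F = "\<lambda>x. hform (mon [a] * x) (mon [])"
          and G = "\<lambda>x. 0"])
      (simp_all add: hform_simps distrib_left smul_mult_right hform_mon mon_append[symmetric] del: mon_Nil)
  then show "hform (mon [a] * x) 1 = 0" by simp
qed

section \<open>Adjoints of the generators\<close>

definition adj :: "(rat falg \<Rightarrow> rat falg) \<Rightarrow> (rat falg \<Rightarrow> rat falg) \<Rightarrow> bool" where
  "adj A B \<longleftrightarrow> (\<forall>x y. hform (A x) y = hform x (B y))"

lemma adjI_words:
  assumes A: "lin A" and B: "lin B" and eq: "\<And>f g. hform (A (mon f)) (mon g) = hform (mon f) (B (mon g))"
  shows "adj A B"
  unfolding adj_def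
proof (intro allI)
  fix x y
  have "hform (A (mon f)) y = hform (mon f) (B y)" for f
    by (rule functional_ext[where \<sigma> = qbar and x = y and F = "hform (A (mon f))"
          and G = "\<lambda>y. hform (mon f) (B y)"])
      (simp_all add: hform_simps slin_simps[OF B] eq)
  then show "hform (A x) y = hform x (B y)"
    by (intro functional_ext[where \<sigma> = "\<lambda>c. c" and x = x and F = "\<lambda>x. hform (A x) y"
          and G = "\<lambda>x. hform x (B y)"]) (simp_all add: hform_simps slin_simps[OF A])
qed

lemma adjI_tens:
  assumes A: "lin A" and B: "lin B" and one: "hform (A 1) 1 = hform 1 (B 1)"
    "\<And>a f. hform (A (mon [a] * mon f)) 1 = hform (mon [a] * mon f) (B 1)"
    "\<And>b g. hform (A 1) (mon [b] * mon g) = hform 1 (B (mon [b] * mon g))"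
    and Cons: "\<And>a f b g. hform (A (mon f)) (mon g) = hform (mon f) (B (mon g)) \<Longrightarrow>
      hform (A (mon [a] * mon f)) (mon [b] * mon g) = hform (mon [a] * mon f) (B (mon [b] * mon g))"
  shows "adj A B"
proof (rule adjI_words[OF A B])
  show "hform (A (mon f)) (mon g) = hform (mon f) (B (mon g))" for f g
  proof (induction f arbitrary: g)
    case Nil
    show ?case
    proof (cases g)
      case (Cons b g')
      then show ?thesis using one(3)[of b g'] by (simp flip: mon_Cons)
    qed (simp add: one)
  next
    case (Cons a f)
    show ?case
    proof (cases g)
      case (Cons b g')
      then show ?thesis using assms(6)[OF Cons.IH, of a b g'] by (simp flip: mon_Cons)
    qed (use one(2)[of a f] in \<open>simp flip: mon_Cons\<close>)
  qed
qed

text \<open>Negating letters exchanges the eigenvalues q and 1/q, and so does conjugation in the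
  second argument. The two effects cancel, hence the adjoint of K_i is K_{-i} and not its
  inverse.\<close>

lemma kap_neg: "kap i (- a) = inverse (kap (- i) a)"
  by (auto simp: kap_def)

lemma qbar_kap: "qbar (kap i a) = inverse (kap i a)"
  by (auto simp: kap_def)

lemma adj_oK: "adj (oK i) (oK (- i))"
  by (rule adjI_tens) (auto simp: slin_opr hform_simps kap_neg qbar_kap)

lemma adj_oL: "adj (oL i) (oL (- i))"
  by (rule adjI_tens) (auto simp: slin_opr hform_simps kap_neg qbar_kap)

lemma adj_oE: "adj (oE i) (oE (- i))"
proof (rule adjI_tens)
  fix a f b g
  assume IH: "hform (oE i (mon f)) (mon g) = hform (mon f) (oE (- i) (mon g))"
  have "kap i a * c = qbar (kap (- i) b) * c" if "a = - b" for c
    using that kap_neg[of i b] by (simp add: qbar_kap)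
  moreover have "(a = i + 1/2 \<and> i - 1/2 = - b) = (b = - i + 1/2 \<and> a = - (- i - 1/2))" by auto
  ultimately show "hform (oE i (mon [a] * mon f)) (mon [b] * mon g)
      = hform (mon [a] * mon f) (oE (- i) (mon [b] * mon g))"
    by (auto simp: opr_E hform_simps IH)
qed (auto simp: slin_opr hform_simps opr_E)

lemma adj_oF: "adj (oF i) (oF (- i))"
proof (rule adjI_tens)
  fix a f b g
  assume IH: "hform (oF i (mon f)) (mon g) = hform (mon f) (oF (- i) (mon g))"
  have "(a = i - 1/2 \<and> i + 1/2 = - b) = (b = - i - 1/2 \<and> a = - (- i + 1/2))" by auto
  then show "hform (oF i (mon [a] * mon f)) (mon [b] * mon g)
      = hform (mon [a] * mon f) (oF (- i) (mon [b] * mon g))"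
    using adj_oL[of i] by (auto simp: opr_F hform_simps IH adj_def)
qed (auto simp: slin_opr hform_simps opr_F)

lemma qbar_eval_at: "qbar (eval_at z a) = eval_at (qbar z) a"
proof (induction a)
  case (pCons c a)
  have "qbar (to_fract [:c:]) = to_fract [:c:]" by (simp add: qbar_to_fract)
  then show ?case by (simp only: eval_at_pCons qbar_add qbar_mult pCons.IH)
qed simp

lemma qbar_qbar [simp]: "qbar (qbar x) = x"
proof -
  obtain a b where "b \<noteq> 0" "x = to_fract a / to_fract b" by (rule qf_cases)
  then show ?thesis by (simp add: qbar_to_fract qbar_eval_at eval_at_qq)
qed

lemma adj_comp: "adj A B \<Longrightarrow> adj A' B' \<Longrightarrow> adj (\<lambda>x. A (A' x)) (\<lambda>x. B' (B x))"
  by (simp add: adj_def)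

lemma adj_add: "adj A B \<Longrightarrow> adj A' B' \<Longrightarrow> adj (\<lambda>x. A x + A' x) (\<lambda>x. B x + B' x)"
  by (simp add: adj_def hform_simps)

lemma adj_diff: "adj A B \<Longrightarrow> adj A' B' \<Longrightarrow> adj (\<lambda>x. A x - A' x) (\<lambda>x. B x - B' x)"
  by (simp add: adj_def hform_simps)

lemma adj_smul: "adj A B \<Longrightarrow> qbar d = c \<Longrightarrow> adj (\<lambda>x. c *\<^sub>q A x) (\<lambda>x. d *\<^sub>q B x)"
  by (simp add: adj_def hform_simps)

lemma Iset_neg: "- i \<in> Iset r m \<longleftrightarrow> i \<in> Iset r m"
proof -
  have "- i - half m \<in> \<int>" if "i - half m \<in> \<int>" for i
  proof -
    have "- (i - half m) - (half m + half m) \<in> \<int>"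
      by (rule Ints_diff[OF Ints_minus[OF that] half_double])
    then show ?thesis by (simp add: algebra_simps)
  qed
  from this[of i] this[of "- i"] show ?thesis by (auto simp: Iset_iff)
qed

lemma adj_gact:
  "adj (gact r m (GenE i)) (gact r m (GenE (- i)))"
  "adj (gact r m (GenF i)) (gact r m (GenF (- i)))"
  "adj (gact r m (GenK i)) (gact r m (GenK (- i)))"
  "adj (gact r m (GenKinv i)) (gact r m (GenKinv (- i)))"
  using adj_oE[of i] adj_oF[of i] adj_oK[of i] adj_oL[of i]
  by (auto simp: adj_def gact_def Iset_neg)

lemma root_ix_neg: "root_ix n (- \<epsilon>) t = - root_ix n \<epsilon> t"
  by (simp add: root_ix_def)

text \<open>Taking adjoints reverses products and conjugates 1/q to q. The adjoint of xy - q^{-1} yx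
  is thus -q times the q-commutator of the adjoints in the original order: one factor -q for each
  commutator.\<close>

lemma adj_root_E:
  "adj (act r m (root_E n \<epsilon> k)) (\<lambda>x. (- qq) ^ k *\<^sub>q act r m (root_E n (- \<epsilon>) k) x)"
proof (induction k)
  case 0
  show ?case using adj_gact(1)[of r m "root_ix n \<epsilon> 0"] by (simp add: adj_def root_ix_neg)
next
  case (Suc k)
  let ?i = "root_ix n \<epsilon> (Suc k)"
  have E: "adj (gact r m (GenE ?i)) (gact r m (GenE (- ?i)))" by (rule adj_gact)
  have "adj (\<lambda>x. gact r m (GenE ?i) (act r m (root_E n \<epsilon> k) x)
        - inverse qq *\<^sub>q act r m (root_E n \<epsilon> k) (gact r m (GenE ?i) x))
      (\<lambda>x. (- qq) ^ k *\<^sub>q act r m (root_E n (- \<epsilon>) k) (gact r m (GenE (- ?i)) x)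
        - qq *\<^sub>q gact r m (GenE (- ?i)) ((- qq) ^ k *\<^sub>q act r m (root_E n (- \<epsilon>) k) x))"
    by (intro adj_diff adj_smul adj_comp[OF E Suc] adj_comp[OF Suc E]) simp_all
  moreover have "(- qq) ^ k *\<^sub>q act r m (root_E n (- \<epsilon>) k) (gact r m (GenE (- ?i)) x)
        - qq *\<^sub>q gact r m (GenE (- ?i)) ((- qq) ^ k *\<^sub>q act r m (root_E n (- \<epsilon>) k) x)
      = (- qq) ^ Suc k *\<^sub>q act r m (root_E n (- \<epsilon>) (Suc k)) x" for x
  proof (rule poly_mapping_eqI)
    fix w
    define c r' where "c = (- qq) ^ k" and "r' = inverse qq"
    have q: "qq * r' = 1" by (simp add: r'_def)
    show "coeff_at ((- qq) ^ k *\<^sub>q act r m (root_E n (- \<epsilon>) k) (gact r m (GenE (- ?i)) x)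
        - qq *\<^sub>q gact r m (GenE (- ?i)) ((- qq) ^ k *\<^sub>q act r m (root_E n (- \<epsilon>) k) x)) w
      = coeff_at ((- qq) ^ Suc k *\<^sub>q act r m (root_E n (- \<epsilon>) (Suc k)) x) w"
      unfolding power_Suc c_def[symmetric]
      by (simp add: qcomm_def root_ix_neg lookup_minus slin_simps[OF slin_gact] r'_def[symmetric])
        (use q in algebra)
  qed
  ultimately show ?case by (simp add: adj_def qcomm_def del: power_Suc)
qed

lemma oL_gact_E: "oL j (gact r m (GenE i) x) = qq powi (- cartan j i) *\<^sub>q gact r m (GenE i) (oL j x)"
  by (simp add: gact_def oL_oE)

text \<open>The index -eps n continues the chain at t = m, so among the E's of the root vector only
  the one with t = m - 1 is adjacent to it. The factor q in the adjoint of B_i thus depends on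
  having the full root vector.\<close>

lemma oL_root_E:
  assumes "\<bar>\<epsilon>\<bar> = (1 :: rat)" "k < m"
  shows "oL (- (\<epsilon> * half m)) (act r m (root_E (half m) \<epsilon> k) x) =
    (if k = m - 1 then qq else 1) *\<^sub>q act r m (root_E (half m) \<epsilon> k) (oL (- (\<epsilon> * half m)) x)"
proof -
  have c: "cartan (- (\<epsilon> * half m)) (root_ix (half m) \<epsilon> k) = (if k = m - 1 then - 1 else 0)" if "k < m" for k
  proof -
    have "- (\<epsilon> * half m) = root_ix (half m) \<epsilon> m"
      by (simp add: root_ix_def half_def algebra_simps)
    then show ?thesis using that by (auto simp: cartan_root[OF assms(1)])
  qed
  show ?thesis using assms(2)
  proof (induction k arbitrary: x)
    case 0
    then show ?case using c[of 0] by (auto simp: oL_gact_E)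
  next
    case (Suc k)
    have "k < m" "k \<noteq> m - 1" using Suc.prems by auto
    note IH = Suc.IH[OF this(1), unfolded if_not_P[OF this(2)]]
    show ?case using c[OF Suc.prems]
      by (auto simp: qcomm_def oL_gact_E IH smul.scale_right_diff_distrib mult.commute slin_simps[OF slin_gact])
  qed
qed

lemma act_Bgen:
  assumes "i \<in> Iset r m" and "\<And>v. act r m (T_word ws (gE (- i))) v = Y v"
  shows "\<not> (m = 0 \<and> i = 0) \<Longrightarrow> act r m (Bgen m p ws i) x = oF i x + varsigma m p i *\<^sub>q Y (oL i x)"
  using assms by (auto simp: Bgen_def gact_simps)

text \<open>As |i| - n is an integer, a white index satisfies |i| >= n. The boundary |i| = n carries
  the special parameters; beyond it the indices i and -i are far from all black ones.\<close>

lemma Iwhite_cases: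
  assumes "i \<in> Iwhite r m"
  obtains "m = 0" "i = 0" | "m \<ge> 1" "r \<ge> 1" "i = half m" | "m \<ge> 1" "r \<ge> 1" "i = - half m"
    | "\<bar>i\<bar> \<ge> half m + 1" "i \<noteq> half m" "i \<noteq> - half m" "m = 0 \<Longrightarrow> i \<noteq> 0"
proof -
  have i: "i - half m \<in> \<int>" "\<bar>i\<bar> \<le> half m + of_nat r - 1" and b: "i \<notin> Iblack m"
    using assms by (auto simp: Iwhite_def Iset_iff)
  have b': "\<bar>i\<bar> > half m - 1" using b i(1) by (auto simp: Iblack_iff)
  have "\<bar>i\<bar> - half m \<in> \<int>"
    using i(1) Iset_neg[of i 0 m] Ints_minus[OF Ints_add[OF i(1) half_double[of m]]] by (auto simp: abs_if algebra_simps)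
  then obtain z where z: "\<bar>i\<bar> - half m = of_int z" by (auto elim: Ints_cases)
  have "z > - 1" using b' z by (metis add.commute less_diff_eq of_int_less_iff of_int_minus of_int_1 uminus_add_conv_diff)
  then consider "z = 0" | "z \<ge> 1" by linarith
  then show ?thesis
  proof cases
    case 1
    then have ai: "\<bar>i\<bar> = half m" using z by simp
    then have "r \<ge> 1" using i(2) by (cases r) auto
    then show ?thesis using ai that(1,2,3) by (cases "m = 0") (auto simp: half_def abs_if split: if_splits)
  next
    case 2
    then have "rat_of_int z \<ge> 1" by simp
    then have "\<bar>i\<bar> \<ge> half m + 1" using z by simp
    moreover have "half m \<ge> 0" by (simp add: half_def)
    ultimately show ?thesis using that(4) by fastforce
  qed
qed

lemma adj_Bgen:
  assumes i: "i \<in> Iwhite r m" and ws: "longest_word r m ws" and p: "p = qq powi k"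
  shows "adj (act r m (Bgen m p ws i)) (act r m (Bgen m p ws (- i)))"
proof -
  have iI: "i \<in> Iset r m" "- i \<in> Iset r m" using i by (auto simp: Iwhite_def Iset_neg)
  have p': "qbar p = inverse p" "p \<noteq> 0" by (simp_all add: p power_int_inverse)
  have main: "adj (act r m (Bgen m p ws i)) (act r m (Bgen m p ws (- i)))"
    if m: "m \<ge> 1" "r \<ge> 1" and e: "\<epsilon> = 1 \<or> \<epsilon> = - 1" and ie: "i = \<epsilon> * half m" for \<epsilon>
  proof -
    have eps: "\<bar>\<epsilon>\<bar> = 1" "\<bar>- \<epsilon>\<bar> = 1" using e by auto
    let ?X = "\<lambda>\<epsilon>. act r m (root_E (half m) \<epsilon> (m - 1))"
    have m0: "\<not> (m = 0 \<and> i = 0)" "\<not> (m = 0 \<and> - i = 0)" using m by auto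
    have X: "act r m (T_word ws (gE (- i))) v = ?X (- \<epsilon>) v" "act r m (T_word ws (gE (- (- i)))) v = ?X \<epsilon> v" for v
      using T_longest[OF ws m eps(1)] T_longest[OF ws m eps(2)] by (simp_all add: sim_def ie)
    have B: "act r m (Bgen m p ws i) x = oF i x + varsigma m p i *\<^sub>q ?X (- \<epsilon>) (oL i x)"
      "act r m (Bgen m p ws (- i)) x = oF (- i) x + varsigma m p (- i) *\<^sub>q ?X \<epsilon> (oL (- i) x)" for x
      using act_Bgen[OF iI(1) X(1) m0(1)] act_Bgen[OF iI(2) X(2) m0(2)] by simp_all
    have "half m > 0" using m by (simp add: half_def)
    \<comment> \<open>The equation that the parameters must satisfy for B_i and B_{-i} to be
      adjoint: (-q)^{m-1} comes from the root vector and q from moving K_{-i}^{-1} past it.\<close>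
    then have vs: "qbar (varsigma m p i) * ((- qq) ^ (m - 1) * qq) = varsigma m p (- i)"
    proof -
      have "inverse qq ^ m * ((- 1) ^ (m - 1) * ((- 1) ^ (m - 1) * qq ^ m)) = 1"
        by (simp flip: power_mult_distrib)
      then have "(- 1) ^ (m - 1) * (inverse qq ^ m * ((- 1) ^ (m - 1) * qq ^ m)) = 1"
        by (simp only: mult.left_commute)
      then show ?thesis
        using e m p' \<open>half m > 0\<close> unfolding ie varsigma_def power_minus[of qq]
        by (auto simp flip: power_Suc2)
    qed
    have "adj (\<lambda>x. oF i x + varsigma m p i *\<^sub>q ?X (- \<epsilon>) (oL i x))
       (\<lambda>x. oF (- i) x + qbar (varsigma m p i) *\<^sub>q oL (- i) ((- qq) ^ (m - 1) *\<^sub>q ?X \<epsilon> x))"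
      using adj_root_E[of r m "half m" "- \<epsilon>" "m - 1"]
      by (intro adj_add adj_oF adj_smul adj_comp[OF _ adj_oL]) simp_all
    moreover have "qbar (varsigma m p i) *\<^sub>q oL (- i) ((- qq) ^ (m - 1) *\<^sub>q ?X \<epsilon> x)
        = varsigma m p (- i) *\<^sub>q ?X \<epsilon> (oL (- i) x)" for x
      using oL_root_E[OF eps(1), of "m - 1" m r x] m by (simp add: ie[symmetric] vs[symmetric] mult.assoc)
    ultimately show ?thesis by (simp add: B adj_def)
  qed
  from i show ?thesis
  proof (cases rule: Iwhite_cases)
    case 1
    have k: "qbar (kappa0 p) = kappa0 p"
    proof -
      have "qbar (kappa0 p) = (inverse p - p) / (inverse qq - qq)" by (simp add: kappa0_def p')
      also have "\<dots> = (- (p - inverse p)) / (- (qq - inverse qq))" by (simp only: minus_diff_eq)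
      also have "\<dots> = kappa0 p" by (simp only: minus_divide_divide kappa0_def)
      finally show ?thesis .
    qed
    have B: "act r m (Bgen m p ws i) x = oF 0 x + inverse qq *\<^sub>q oE 0 (oL 0 x) + kappa0 p *\<^sub>q oL 0 x" for x
      using iI 1 by (simp add: Bgen_def varsigma_def gact_simps)
    have "adj (\<lambda>x. oF 0 x + inverse qq *\<^sub>q oE 0 (oL 0 x) + kappa0 p *\<^sub>q oL 0 x)
        (\<lambda>x. oF 0 x + qq *\<^sub>q oL 0 (oE 0 x) + kappa0 p *\<^sub>q oL 0 x)"
      using adj_oF[of 0] adj_oE[of 0] adj_oL[of 0] by (simp add: adj_def hform_simps k)
    \<comment> \<open>The adjoint of q^{-1} E_0 K_0^{-1} is q K_0^{-1} E_0, and K_0^{-1} E_0 =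
      q^{-2} E_0 K_0^{-1}: with varsigma_0 = 1/q the term is self-adjoint.\<close>
    moreover have "qq *\<^sub>q oL 0 (oE 0 x) = inverse qq *\<^sub>q oE 0 (oL 0 x)" for x
      by (simp add: oL_oE power_int_minus power2_eq_square mult.assoc[symmetric])
    ultimately show ?thesis using B 1 by (simp add: adj_def)
  next
    case 2
    then show ?thesis using main[of 1] by simp
  next
    case 3
    then show ?thesis using main[of "- 1"] by simp
  next
    case 4
    have h: "half m \<ge> 0" "m \<noteq> 0 \<Longrightarrow> half m \<ge> 1/2" by (simp_all add: half_def)
    \<comment> \<open>Black indices satisfy |j| <= n - 1 and here |i| >= n + 1, so both i and -i
      have distance at least 2 from j.\<close>
    have far: "cartan j (- i) = 0" "cartan j i = 0" if "j \<in> set ws" for j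
    proof -
      have "j \<in> Iblack m" using ws that by (auto simp: longest_word_def)
      then show "cartan j (- i) = 0" "cartan j i = 0" using 4(1)
        by (auto simp: Iblack_iff cartan_def abs_if split: if_splits)
    qed
    have c: "cartan (- i) i = 0" using 4(1) h
      by (auto simp: cartan_def abs_if split: if_splits)
    have B: "act r m (Bgen m p ws i) x = oF i x + oE (- i) (oL i x)"
      "act r m (Bgen m p ws (- i)) x = oF (- i) x + oE i (oL (- i) x)" for x
      using iI 4 by (auto simp: Bgen_def varsigma_def gact_simps T_word_far[OF far(1)] T_word_far[OF far(2)]
        minus_equation_iff[of i])
    have "adj (\<lambda>x. oF i x + oE (- i) (oL i x)) (\<lambda>x. oF (- i) x + oL (- i) (oE i x))"
      using adj_oF[of i] adj_oE[of "- i"] adj_oL[of i] by (simp add: adj_def hform_simps)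
    then show ?thesis by (simp add: adj_def B oL_oE c)
  qed
qed

section \<open>Nilpotency on tensor powers\<close>

lemma II_iff: "a \<in> II r m \<longleftrightarrow> a - (half m - 1/2) \<in> \<int> \<and> \<bar>a\<bar> \<le> of_nat r + half m - 1/2"
proof -
  have e: "(1 - 2 * of_nat r - of_nat m) / 2 = 1/2 - of_nat r - half m"
    "(2 * of_nat r + of_nat m - 1) / 2 = of_nat r + half m - 1/2"
    by (simp_all add: half_def add_divide_distrib diff_divide_distrib)
  have "1 - of_nat r - (half m + half m) \<in> \<int>"
    by (rule Ints_diff[OF Ints_diff[OF Ints_1 Ints_of_nat] half_double])
  moreover have "1 - of_nat r - (half m + half m) = 1/2 - of_nat r - half m - (half m - 1/2)" by simp
  ultimately have "1/2 - of_nat r - half m - (half m - 1/2) \<in> \<int>" by (simp only:)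
  from Ints_shift[OF this, of a] show ?thesis unfolding II_def seg_iff e by (auto simp: abs_le_iff)
qed

lemma II_neg: "- a \<in> II r m \<longleftrightarrow> a \<in> II r m"
proof -
  have "- a - (half m - 1/2) \<in> \<int>" if "a - (half m - 1/2) \<in> \<int>" for a
  proof -
    have "1 - (a - (half m - 1/2)) - (half m + half m) \<in> \<int>"
      by (rule Ints_diff[OF Ints_diff[OF Ints_1 that] half_double])
    then show ?thesis by (simp add: algebra_simps)
  qed
  from this[of a] this[of "- a"] show ?thesis by (auto simp: II_iff)
qed

lemma Iset_II:
  assumes "i \<in> Iset r m"
  shows "i - 1/2 \<in> II r m" "i + 1/2 \<in> II r m"
proof -
  have i: "i - half m \<in> \<int>" "\<bar>i\<bar> \<le> half m + of_nat r - 1" using assms by (auto simp: Iset_iff)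
  have "i + 1/2 - (half m - 1/2) = i - half m + 1" by simp
  then have "i + 1/2 - (half m - 1/2) \<in> \<int>" using Ints_add[OF i(1) Ints_1] by (simp only:)
  then show "i - 1/2 \<in> II r m" "i + 1/2 \<in> II r m" using i by (auto simp: II_iff abs_le_iff)
qed

lemma indices_Nil [simp]: "[] \<in> indices r m d \<longleftrightarrow> d = 0"
  and indices_Cons [simp]: "a # f \<in> indices r m d \<longleftrightarrow> a \<in> II r m \<and> (\<exists>e. d = Suc e \<and> f \<in> indices r m e)"
  by (auto simp: indices_def)

lemma tens_iff: "x \<in> tens r m d \<longleftrightarrow> (\<forall>w. Word w \<in> Poly_Mapping.keys x \<longrightarrow> w \<in> indices r m d)"
  by (auto simp: tens_def)

lemma tens_0 [simp]: "0 \<in> tens r m d"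
  and tens_smul [simp]: "x \<in> tens r m d \<Longrightarrow> c *\<^sub>q x \<in> tens r m d"
  and tens_mon [simp]: "mon f \<in> tens r m d \<longleftrightarrow> f \<in> indices r m d"
  using keys_smul[of c x] by (auto simp: tens_iff) (simp_all add: mon_def)

lemma tens_one [simp]: "1 \<in> tens r m d \<longleftrightarrow> d = 0"
  using tens_mon[of "[]" r m d] by simp

lemma tens_add [simp]: "x \<in> tens r m d \<Longrightarrow> y \<in> tens r m d \<Longrightarrow> x + y \<in> tens r m d"
  using keys_add[of x y] by (auto simp: tens_iff)

lemma tens_uminus [simp]: "x \<in> tens r m d \<Longrightarrow> - x \<in> tens r m d"
  using tens_smul[of x r m d "- 1"] by simp

lemma tens_diff [simp]: "x \<in> tens r m d \<Longrightarrow> y \<in> tens r m d \<Longrightarrow> x - y \<in> tens r m d"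
  using tens_add[of x r m d "- y"] by simp

lemma tens_sum: "(\<And>i. i \<in> I \<Longrightarrow> f i \<in> tens r m d) \<Longrightarrow> (\<Sum>i\<in>I. f i) \<in> tens r m d"
  by (induction I rule: infinite_finite_induct) simp_all

lemma tens_ext:
  assumes "slin \<sigma> A" "slin \<sigma> B" "x \<in> tens r m d" "\<And>f. f \<in> indices r m d \<Longrightarrow> A (mon f) = B (mon f)"
  shows "A x = B x"
  using assms(1,2) by (rule slin_eq_mon) (use assms(3,4) in \<open>auto simp: tens_iff\<close>)

lemma expand_mon: "x = (\<Sum>w\<in>Poly_Mapping.keys x. coeff_at x w *\<^sub>q mon (letters w))" for x :: "'a falg"
  using poly_mapping_expand[of x] by (simp add: single_eq_mon)

lemma slin_expand:
  fixes x :: "'a falg"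
  assumes "slin \<sigma> A"
  shows "A x = (\<Sum>w\<in>Poly_Mapping.keys x. \<sigma> (coeff_at x w) *\<^sub>q A (mon (letters w)))"
  by (subst expand_mon) (simp add: slin_simps[OF assms])

lemma tens_map:
  assumes "slin \<sigma> A" "x \<in> tens r m d" "\<And>f. f \<in> indices r m d \<Longrightarrow> A (mon f) \<in> tens r' m' e"
  shows "A x \<in> tens r' m' e"
proof -
  have "letters w \<in> indices r m d" if "w \<in> Poly_Mapping.keys x" for w
    using that assms(2) by (auto simp: tens_def)
  then show ?thesis
    by (subst slin_expand[OF assms(1)]) (intro tens_sum tens_smul assms(3))
qed

lemma tens_mult_letter [simp]:
  assumes "a \<in> II r m" "x \<in> tens r m d"
  shows "mon [a] * x \<in> tens r m (Suc d)"
  by (rule tens_map[where \<sigma> = "\<lambda>c. c" and A = "\<lambda>x. mon [a] * x", OF _ assms(2)])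
    (use assms in \<open>auto intro!: slin_intros simp flip: mon_append\<close>)

lemma opr_tens:
  assumes "f \<in> indices r m d" "gidx g \<in> Iset r m"
  shows "opr g (mon f) \<in> tens r m d"
proof -
  note [simp] = Iset_II
  have K: "oK i (mon f) \<in> tens r m d" if "f \<in> indices r m d" for i f d
    using that
  proof (induction f arbitrary: d)
    case (Cons a f)
    then show ?case unfolding mon_Cons[of a f] by auto
  qed simp
  have L: "oL i (mon f) \<in> tens r m d" if "f \<in> indices r m d" for i f d
    using that
  proof (induction f arbitrary: d)
    case (Cons a f)
    then show ?case unfolding mon_Cons[of a f] by auto
  qed simp
  have E: "oE i (mon f) \<in> tens r m d" if "f \<in> indices r m d" "i \<in> Iset r m" for i f d
    using that
  proof (induction f arbitrary: d)
    case (Cons a f)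
    then show ?case unfolding mon_Cons[of a f] by (auto simp: opr_E)
  qed simp
  have F: "oF i (mon f) \<in> tens r m d" if "f \<in> indices r m d" "i \<in> Iset r m" for i f d
    using that
  proof (induction f arbitrary: d)
    case (Cons a f)
    then show ?case unfolding mon_Cons[of a f] using L by (auto simp: opr_F)
  qed simp
  show ?thesis using assms K L E F by (cases g) auto
qed

lemma tens_gact [simp]: "x \<in> tens r m d \<Longrightarrow> gact r m g x \<in> tens r m d"
  by (rule tens_map[OF slin_gact]) (auto simp: gact_def opr_tens)

lemma tens_word_act [simp]: "x \<in> tens r m d \<Longrightarrow> word_act r m w x \<in> tens r m d"
proof -
  assume x: "x \<in> tens r m d"
  have "word_act r m (Word gs) x \<in> tens r m d" for gs
    by (induction gs) (simp_all add: x word_act_Cons)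
  from this[of "letters w"] show ?thesis by simp
qed

lemma tens_act [simp]: "x \<in> tens r m d \<Longrightarrow> act r m u x \<in> tens r m d"
  unfolding act_def lin_ext_def by (intro tens_sum tens_smul tens_word_act)

text \<open>The \<open>E\<^sub>i\<close> lower this filtration for \<open>\<delta> = 1\<close>, the \<open>F\<^sub>i\<close> for \<open>\<delta> = - 1\<close>; on words of fixed length in the
  letters of \<open>II r m\<close> it is bounded below, whence nilpotency.\<close>

definition letter_filt :: "rat \<Rightarrow> rat \<Rightarrow> rat falg set" where
  "letter_filt \<delta> s = {x. \<forall>w. Word w \<in> Poly_Mapping.keys x \<longrightarrow> \<delta> * sum_list w \<le> s}"

lemma letter_filt_0 [simp]: "0 \<in> letter_filt \<delta> s"
  and letter_filt_smul [simp]: "x \<in> letter_filt \<delta> s \<Longrightarrow> c *\<^sub>q x \<in> letter_filt \<delta> s"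
  and letter_filt_mon [simp]: "mon f \<in> letter_filt \<delta> s \<longleftrightarrow> \<delta> * sum_list f \<le> s"
  using keys_smul[of c x] by (auto simp: letter_filt_def mon_def)

lemma letter_filt_one [simp]: "1 \<in> letter_filt \<delta> s \<longleftrightarrow> 0 \<le> s"
  using letter_filt_mon[of "[]" \<delta> s] by simp

lemma letter_filt_add [simp]: "x \<in> letter_filt \<delta> s \<Longrightarrow> y \<in> letter_filt \<delta> s \<Longrightarrow> x + y \<in> letter_filt \<delta> s"
  using keys_add[of x y] by (auto simp: letter_filt_def)

lemma letter_filt_sum: "(\<And>i. i \<in> I \<Longrightarrow> f i \<in> letter_filt \<delta> s) \<Longrightarrow> (\<Sum>i\<in>I. f i) \<in> letter_filt \<delta> s"
  by (induction I rule: infinite_finite_induct) simp_all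

lemma letter_filt_map:
  assumes "lin A" "x \<in> letter_filt \<delta> s" "\<And>f. A (mon f) \<in> letter_filt \<delta> (\<delta> * sum_list f + c)"
  shows "A x \<in> letter_filt \<delta> (s + c)"
proof -
  have "A (mon f) \<in> letter_filt \<delta> (s + c)" if "Word f \<in> Poly_Mapping.keys x" for f
    using assms(2) assms(3)[of f] that unfolding letter_filt_def by force
  then show ?thesis
    by (subst slin_expand[OF assms(1)]) (auto intro!: letter_filt_sum letter_filt_smul)
qed

lemma letter_filt_Cons: "x \<in> letter_filt \<delta> s \<Longrightarrow> mon [a] * x \<in> letter_filt \<delta> (\<delta> * a + s)"
  using letter_filt_map[where A = "\<lambda>x. mon [a] * x" and c = "\<delta> * a" and s = s and \<delta> = \<delta>, of x]
  by (simp add: slin_intros distrib_left add.commute flip: mon_append)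

lemma opr_letter_filt:
  "oL i (mon f) \<in> letter_filt \<delta> (\<delta> * sum_list f)"
  "oE i (mon f) \<in> letter_filt 1 (sum_list f - 1)"
  "oF i (mon f) \<in> letter_filt (- 1) (- sum_list f - 1)"
proof -
  have L: "oL i (mon f) \<in> letter_filt \<delta> (\<delta> * sum_list f)" for \<delta> f
  proof (induction f)
    case (Cons a f)
    then show ?case unfolding mon_Cons[of a f]
      using letter_filt_Cons[OF Cons, of a] by (simp add: distrib_left)
  qed simp
  then show "oL i (mon f) \<in> letter_filt \<delta> (\<delta> * sum_list f)" .
  show "oE i (mon f) \<in> letter_filt 1 (sum_list f - 1)"
  proof (induction f)
    case (Cons a f)
    have "oE i (mon [a] * mon f) \<in> letter_filt 1 (a + (sum_list f - 1))"
      using letter_filt_Cons[OF Cons, of a] letter_filt_Cons[of "mon f" 1 "sum_list f" "a - 1"]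
      by (auto simp: opr_E algebra_simps)
    then show ?case unfolding mon_Cons[of a f] by (simp add: algebra_simps)
  qed simp
  show "oF i (mon f) \<in> letter_filt (- 1) (- sum_list f - 1)"
  proof (induction f)
    case (Cons a f)
    have "oF i (mon [a] * mon f) \<in> letter_filt (- 1) (- a + (- sum_list f - 1))"
    proof -
      have "mon [i + 1/2] * oL i (mon f) \<in> letter_filt (- 1) (- a + (- sum_list f - 1))" if "a = i - 1/2"
      proof -
        have e: "- 1 * (i + 1/2) + - 1 * sum_list f = - a + (- sum_list f - 1)" using that by simp
        from letter_filt_Cons[OF L[of f "- 1"], of "i + 1/2"] show ?thesis unfolding e .
      qed
      moreover have "mon [a] * oF i (mon f) \<in> letter_filt (- 1) (- a + (- sum_list f - 1))"
        using letter_filt_Cons[OF Cons, of a] by simp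
      ultimately show ?thesis
        unfolding opr_F by (intro letter_filt_add) (simp only: letter_filt_0 split: if_split, blast)
    qed
    then show ?case unfolding mon_Cons[of a f] by (simp add: algebra_simps)
  qed simp
qed

lemma gact_letter_filt:
  "x \<in> letter_filt 1 s \<Longrightarrow> gact r m (GenE i) x \<in> letter_filt 1 (s - 1)"
  "x \<in> letter_filt (- 1) s \<Longrightarrow> gact r m (GenF i) x \<in> letter_filt (- 1) (s - 1)"
  using letter_filt_map[OF slin_opr[of "GenE i"], of x 1 s "- 1"]
    letter_filt_map[OF slin_opr[of "GenF i"], of x "- 1" s "- 1"] opr_letter_filt(2,3)[of i]
  by (auto simp: gact_def)

lemma word_act_letter_filt:
  "x \<in> letter_filt 1 s \<Longrightarrow> act r m (mon (map GenE is)) x \<in> letter_filt 1 (s - of_nat (length is))"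
  "x \<in> letter_filt (- 1) s \<Longrightarrow> act r m (mon (map GenF is)) x \<in> letter_filt (- 1) (s - of_nat (length is))"
proof (induction "is")
  case (Cons i "is")
  {
    case 1
    then show ?case using gact_letter_filt(1)[OF Cons.IH(1)[OF 1], of r m i]
      by (simp add: act_mon word_act_Cons algebra_simps)
  next
    case 2
    then show ?case using gact_letter_filt(2)[OF Cons.IH(2)[OF 2], of r m i]
      by (simp add: act_mon word_act_Cons algebra_simps)
  }
qed simp_all

text \<open>Each E_i or F_i changes the sum of the letters by one, always in the same direction. On
  words of length d this sum lies between -d(r + n) and d(r + n), an interval of length d(2r +
  m).\<close>

definition nil_bound :: "nat \<Rightarrow> nat \<Rightarrow> nat \<Rightarrow> nat" where
  "nil_bound r m d = d * (2 * r + m) + 1"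

lemma sum_list_bound:
  assumes "f \<in> indices r m d"
  shows "\<bar>sum_list f\<bar> \<le> of_nat d * (of_nat r + half m)"
  using assms
proof (induction f arbitrary: d)
  case (Cons a f)
  then obtain e where e: "d = Suc e" "a \<in> II r m" "f \<in> indices r m e" by auto
  have "\<bar>a\<bar> \<le> of_nat r + half m" using e(2) by (auto simp: II_iff)
  moreover have "\<bar>a + sum_list f\<bar> \<le> \<bar>a\<bar> + \<bar>sum_list f\<bar>" by (rule abs_triangle_ineq)
  ultimately show ?case using Cons.IH[OF e(3)] by (simp add: e(1) distrib_right)
qed simp

lemma act_words_nilpotent:
  assumes x: "x \<in> tens r m d" and len: "nil_bound r m d \<le> length is"
  shows "act r m (mon (map GenE is)) x = 0" "act r m (mon (map GenF is)) x = 0"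
proof -
  let ?b = "of_nat d * (of_nat r + half m)"
  have "rat_of_nat (nil_bound r m d) = 2 * ?b + 1"
    by (simp add: nil_bound_def half_def algebra_simps)
  then have l: "rat_of_nat (length is) > 2 * ?b"
    using len by (metis less_add_one of_nat_le_iff order_less_le_trans)
  have zero: "y = 0" if y: "y \<in> tens r m d" "y \<in> letter_filt \<delta> (?b - of_nat (length is))" "\<delta> = 1 \<or> \<delta> = - 1" for y \<delta>
  proof -
    have False if w: "Word w \<in> Poly_Mapping.keys y" for w
    proof -
      have "w \<in> indices r m d" using w y(1) by (auto simp: tens_iff)
      then have "\<bar>sum_list w\<bar> \<le> ?b" by (rule sum_list_bound)
      moreover have "\<delta> * sum_list w \<le> ?b - of_nat (length is)"
        using w y(2) by (auto simp: letter_filt_def)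
      ultimately show False using l y(3) by (auto simp: abs_le_iff)
    qed
    then have "Poly_Mapping.keys y = {}" by (metis equals0I fword.collapse)
    then show ?thesis by simp
  qed
  have filt: "x \<in> letter_filt \<delta> ?b" if "\<delta> = 1 \<or> \<delta> = - 1" for \<delta>
    using x that sum_list_bound by (fastforce simp: tens_iff letter_filt_def abs_le_iff)
  show "act r m (mon (map GenE is)) x = 0"
    by (rule zero[where \<delta> = 1]) (use x filt word_act_letter_filt(1) in auto)
  show "act r m (mon (map GenF is)) x = 0"
    by (rule zero[where \<delta> = "- 1"]) (use x filt word_act_letter_filt(2) in auto)
qed

section \<open>The quasi R-matrix\<close>

lemma lspan_induct:
  assumes "z \<in> lspan S" "lin A" "P 0" "\<And>c x y. P x \<Longrightarrow> P y \<Longrightarrow> P (c *\<^sub>q x + y)" "\<And>s. s \<in> S \<Longrightarrow> P (A s)"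
  shows "P (A z)"
  using assms(1)
  by (induction rule: smul.span_induct_alt) (simp_all add: slin_simps[OF assms(2)] assms(3-5))

lemma slin_act2: "lin (\<lambda>z. act2 r m z x y)"
  by (simp add: act2_def slin_lin_ext)

lemma slin_act2_left: "lin (\<lambda>x. act2 r m z x y)"
  and slin_act2_right: "lin (\<lambda>y. act2 r m z x y)"
proof -
  have "lin (\<lambda>x. word_act r m u x * y)" "lin (\<lambda>y. x * word_act r m u y)" for u x y
    by (intro slin_intros slin_word_act)+
  then show "lin (\<lambda>x. act2 r m z x y)" "lin (\<lambda>y. act2 r m z x y)"
    unfolding act2_def lin_ext_def
    by (auto intro!: slin_summation slin_scale simp: split_beta)
qed

lemmas act2_lin = slin_simps[OF slin_act2] slin_simps[OF slin_act2_left] slin_simps[OF slin_act2_right]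

lemma act2_single [simp]: "act2 r m (Poly_Mapping.single (u, v) c) x y = c *\<^sub>q (word_act r m u x * word_act r m v y)"
  by (simp add: act2_def)

lemma act2_tensor: "act2 r m (u \<otimes>\<^sub>t v) x y = act r m u x * act r m v y"
proof -
  have *: "act2 r m (mon us \<otimes>\<^sub>t v) x y = act r m (mon us) x * act r m v y" for us
  proof -
    have "lin (\<lambda>v. act2 r m (mon us \<otimes>\<^sub>t v) x y)" "lin (\<lambda>v. act r m (mon us) x * act r m v y)"
      by (auto intro!: slinI simp: tensor_simps act2_lin distrib_left smul_mult_right)
    then show ?thesis by (rule slin_eq_mon) (simp add: mon_def act_def)
  qed
  have "lin (\<lambda>u. act2 r m (u \<otimes>\<^sub>t v) x y)" "lin (\<lambda>u. act r m u x * act r m v y)"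
    by (auto intro!: slinI simp: tensor_simps act2_lin distrib_right smul_mult_left)
  then show ?thesis by (rule slin_eq_mon) (rule *)
qed

text \<open>The action of \<open>U \<otimes> U\<close> on tensor powers that splits off the first factor (junk value \<open>0\<close> on the empty
  word).\<close>

definition op2 :: "nat \<Rightarrow> nat \<Rightarrow> gen falg2 \<Rightarrow> rat falg \<Rightarrow> rat falg" where
  "op2 r m z = lin_ext (\<lambda>w. case letters w of [] \<Rightarrow> 0 | a # f \<Rightarrow> act2 r m z (mon [a]) (mon f))"

lemma slin_op2: "lin (op2 r m z)"
  by (simp add: op2_def slin_lin_ext)

lemma slin_op2_left: "lin (\<lambda>z. op2 r m z x)"
proof -
  have "lin (\<lambda>z. case fs of [] \<Rightarrow> 0 | a # f \<Rightarrow> act2 r m z (mon [a]) (mon f))" for fs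
    by (cases fs) (simp_all add: slin_zero slin_act2)
  then show ?thesis unfolding op2_def lin_ext_def by (intro slin_summation slin_scale)
qed

lemmas op2_lin = slin_simps[OF slin_op2] slin_simps[OF slin_op2_left]

lemma indices_0 [simp]: "f \<in> indices r m 0 \<longleftrightarrow> f = []"
  by (auto simp: indices_def)

lemma indices_Suc: "f \<in> indices r m (Suc d) \<longleftrightarrow> (\<exists>a g. f = a # g \<and> a \<in> II r m \<and> g \<in> indices r m d)"
  by (cases f) auto

lemma op2_letter: "op2 r m z (mon [a] * y) = act2 r m z (mon [a]) y"
proof -
  have "lin (\<lambda>y. op2 r m z (mon [a] * y))"
    by (auto intro!: slinI simp: op2_lin distrib_left smul_mult_right)
  then show ?thesis using slin_act2_right
    by (rule slin_eq_mon) (simp add: op2_def flip: mon_append)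
qed

lemma op2_mult: "x \<in> tens r m 1 \<Longrightarrow> op2 r m z (x * y) = act2 r m z x y"
proof -
  assume x: "x \<in> tens r m 1"
  have "lin (\<lambda>x. op2 r m z (x * y))"
    by (auto intro!: slinI simp: op2_lin distrib_right smul_mult_left)
  then show ?thesis using slin_act2_left x
    by (rule tens_ext) (auto simp: indices_Suc op2_letter)
qed

text \<open>\<open>act2\<close> takes a pure tensor but returns a general one, so composites of
  elements of U tensor U have to be formed with \<open>op2\<close>.\<close>

lemma op2_times:
  assumes x: "x \<in> tens r m 1"
  shows "op2 r m (z * z') (x * y) = op2 r m z (op2 r m z' (x * y))"
proof -
  have single: "op2 r m (Poly_Mapping.single k 1 * Poly_Mapping.single k' 1) (x * y)
      = op2 r m (Poly_Mapping.single k 1) (op2 r m (Poly_Mapping.single k' 1) (x * y))" for k k'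
    using x by (cases k; cases k') (simp add: mult_single op2_mult word_act_plus)
  have *: "op2 r m (Poly_Mapping.single k 1 * z') (x * y) = op2 r m (Poly_Mapping.single k 1) (op2 r m z' (x * y))" for k
  proof -
    have "lin (\<lambda>z'. op2 r m (Poly_Mapping.single k 1 * z') (x * y))"
      "lin (\<lambda>z'. op2 r m (Poly_Mapping.single k 1) (op2 r m z' (x * y)))"
      by (auto intro!: slinI simp: op2_lin distrib_left smul_mult_right)
    then show ?thesis by (rule slin_ext_eq) (rule single)
  qed
  have "lin (\<lambda>z. op2 r m (z * z') (x * y))" "lin (\<lambda>z. op2 r m z (op2 r m z' (x * y)))"
    by (auto intro!: slinI simp: op2_lin distrib_right smul_mult_left)
  then show ?thesis by (rule slin_ext_eq) (rule *)
qed

text \<open>Intermediate vectors of a composite are not pure tensors, but they are sums of pure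
  tensors of the same degrees. Vanishing statements proved for pure tensors therefore extend to
  them.\<close>

lemma op2_range_zero:
  assumes x: "x \<in> tens r m 1" and y: "y \<in> tens r m d" and A: "lin A"
    and zero: "\<And>x y. x \<in> tens r m 1 \<Longrightarrow> y \<in> tens r m d \<Longrightarrow> A (x * y) = 0"
  shows "A (op2 r m z (x * y)) = 0"
proof -
  have "lin (\<lambda>z. A (op2 r m z (x * y)))"
    by (auto intro!: slinI simp: op2_lin slin_simps[OF A])
  then show ?thesis using slin_zero
  proof (rule slin_ext_eq)
    show "A (op2 r m (Poly_Mapping.single k 1) (x * y)) = 0" for k
      using x y by (cases k) (simp add: op2_mult zero)
  qed
qed

lemma act2_ideal_zero:
  assumes "z \<in> two_sided_ideal S" "\<And>s x y. s \<in> S \<Longrightarrow> x \<in> tens r m 1 \<Longrightarrow> y \<in> tens r m d \<Longrightarrow> act2 r m s x y = 0"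
    and "x \<in> tens r m 1" "y \<in> tens r m d"
  shows "act2 r m z x y = 0"
  using assms(1)
proof induction
  case (ideal_base s a b)
  have "op2 r m s (op2 r m b (x * y)) = 0"
    by (rule op2_range_zero[OF assms(3,4) slin_op2]) (simp add: op2_mult assms(2) ideal_base)
  then show ?case
    by (simp add: op2_mult[OF assms(3), symmetric] op2_times[OF assms(3)] mult.assoc op2_lin)
qed (simp_all add: act2_lin)

lemma ueq2_act2:
  assumes "ueq2 r m z z'" "x \<in> tens r m 1" "y \<in> tens r m d"
  shows "act2 r m z x y = act2 r m z' x y"
proof -
  have "act2 r m (z - z') x y = 0"
    using assms(1) unfolding ueq2_def
    by (rule act2_ideal_zero[OF _ _ assms(2,3)]) (auto simp: act2_tensor act_rels)
  then show ?thesis by (simp add: act2_lin)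
qed

lemma UU_filt_act2:
  assumes "z \<in> UU_filt r m N" "x \<in> tens r m 1" "y \<in> tens r m d" "nil_bound r m 1 \<le> N" "nil_bound r m d \<le> N"
  shows "act2 r m z x y = 0"
proof -
  obtain z' where z': "z' \<in> lspan
     ({a * (mon (map GenF is) \<otimes>\<^sub>t 1) | a is. set is \<subseteq> Iset r m \<and> N \<le> length is} \<union>
      {a * (1 \<otimes>\<^sub>t mon (map GenE is)) | a is. set is \<subseteq> Iset r m \<and> N \<le> length is})" "ueq2 r m z z'"
    using assms(1) unfolding UU_filt_def by blast
  have "act2 r m z' x y = 0"
    using z'(1) slin_act2
  proof (rule lspan_induct[where P = "\<lambda>u. u = 0"])
    fix s assume "s \<in> {a * (mon (map GenF is) \<otimes>\<^sub>t 1) | a is. set is \<subseteq> Iset r m \<and> N \<le> length is} \<union>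
      {a * (1 \<otimes>\<^sub>t mon (map GenE is)) | a is. set is \<subseteq> Iset r m \<and> N \<le> length is}"
    then consider a "is" where "s = a * (mon (map GenF is) \<otimes>\<^sub>t 1)" "N \<le> length is"
      | a "is" where "s = a * (1 \<otimes>\<^sub>t mon (map GenE is))" "N \<le> length is" by blast
    then show "act2 r m s x y = 0"
    proof cases
      case 1
      have "act r m (mon (map GenF is)) x = 0"
        by (rule act_words_nilpotent[OF assms(2)]) (use 1 assms(4) in simp)
      then have "op2 r m s (x * y) = 0"
        unfolding 1(1) op2_times[OF assms(2)] by (simp add: op2_mult[OF assms(2)] act2_tensor op2_lin)
      then show ?thesis by (simp add: op2_mult[OF assms(2)])
    next
      case 2
      have "act r m (mon (map GenE is)) y = 0"
        by (rule act_words_nilpotent[OF assms(3)]) (use 2 assms(5) in simp)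
      then have "op2 r m s (x * y) = 0"
        unfolding 2(1) op2_times[OF assms(2)] by (simp add: op2_mult[OF assms(2)] act2_tensor op2_lin)
      then show ?thesis by (simp add: op2_mult[OF assms(2)])
    qed
  qed simp_all
  then show ?thesis using ueq2_act2[OF z'(2) assms(2,3)] by simp
qed

lemma finite_weights_upto: "finite (weights_upto r m N)"
proof -
  have "weights_upto r m N \<subseteq> mset ` {xs. set xs \<subseteq> Iset r m \<and> length xs \<le> N}"
  proof
    fix \<nu> assume "\<nu> \<in> weights_upto r m N"
    moreover obtain xs where "\<nu> = mset xs" by (metis ex_mset)
    ultimately show "\<nu> \<in> mset ` {xs. set xs \<subseteq> Iset r m \<and> length xs \<le> N}"
      by (auto simp: weights_upto_def)
  qed
  then show ?thesis using finite_lists_length_le[OF finite_Iset] finite_surj by blast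
qed

lemma opr_letter:
  "oE i (mon [a]) = (if a = i + 1/2 then mon [i - 1/2] else 0)"
  "oF i (mon [a]) = (if a = i - 1/2 then mon [i + 1/2] else 0)"
  "oK i (mon [a]) = kap i a *\<^sub>q mon [a]"
  "oL i (mon [a]) = inverse (kap i a) *\<^sub>q mon [a]"
  using opr_E[of i a 1] opr_F[of i a 1] opr_K[of i a 1] opr_L[of i a 1] by simp_all

lemma op2_Delta_gen:
  assumes "z \<in> tens r m (Suc d)"
  shows "op2 r m (Delta (mon [g])) z = gact r m g z"
  using slin_op2 slin_gact assms
proof (rule tens_ext)
  fix f assume "f \<in> indices r m (Suc d)"
  then obtain a f' where f: "f = a # f'" by (auto simp: indices_Suc)
  show "op2 r m (Delta (mon [g])) (mon f) = gact r m g (mon f)"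
    unfolding f mon_Cons[of a f'] op2_letter
    by (cases g)
      (auto simp: Delta_def act2_tensor act2_lin gact_def opr_letter opr_E opr_F smul_mult_left)
qed

section \<open>The quasi R-matrix as an operator on tensor powers\<close>

definition Theta_op :: "nat \<Rightarrow> nat \<Rightarrow> (rat multiset \<Rightarrow> gen falg2) \<Rightarrow> nat \<Rightarrow> rat falg \<Rightarrow> rat falg" where
  "Theta_op r m \<Theta> d z = (\<Sum>\<nu>\<in>weights_upto r m (nil_bound r m d). op2 r m (\<Theta> \<nu>) z)"

lemma slin_Theta_op: "lin (Theta_op r m \<Theta> d)"
  unfolding Theta_op_def by (intro slin_summation slin_op2)

context
  fixes r m :: nat and \<Theta> :: "rat multiset \<Rightarrow> gen falg2"
  assumes Theta: "quasi_R_matrix r m \<Theta>"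
begin

lemma Theta_induct:
  assumes x: "x \<in> tens r m 1" and y: "y \<in> tens r m d"
    and P: "P 0" "\<And>c u v. P u \<Longrightarrow> P v \<Longrightarrow> P (c *\<^sub>q u + v)"
    and words: "\<And>is js. set is \<subseteq> Iset r m \<Longrightarrow> set js \<subseteq> Iset r m \<Longrightarrow> mset is = \<nu> \<Longrightarrow> mset js = \<nu> \<Longrightarrow>
      P (act r m (mon (map GenF is)) x * act r m (mon (map GenE js)) y)"
  shows "P (act2 r m (\<Theta> \<nu>) x y)"
proof -
  have "\<Theta> \<nu> \<in> U_minus_U_plus r m \<nu>" using Theta by (simp add: quasi_R_matrix_def)
  then obtain z where z: "z \<in> lspan {mon (map GenF is) \<otimes>\<^sub>t mon (map GenE js) | is js.
       set is \<subseteq> Iset r m \<and> mset is = \<nu> \<and> set js \<subseteq> Iset r m \<and> mset js = \<nu>}" "ueq2 r m (\<Theta> \<nu>) z"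
    unfolding U_minus_U_plus_def by blast
  have "P (act2 r m z x y)"
    using z(1) slin_act2 P by (rule lspan_induct) (auto simp: act2_tensor words)
  then show ?thesis using ueq2_act2[OF z(2) x y] by simp
qed

text \<open>The second factor of Theta_nu is made of E words of length \<open>size \<nu>\<close>,
  too long to act nontrivially. If nu has an entry outside \<open>Iset\<close>, there are no such
  words and the span is zero.\<close>

lemma Theta_vanish_aux:
  assumes "\<not> (set_mset \<nu> \<subseteq> Iset r m \<and> size \<nu> < nil_bound r m d)" "x \<in> tens r m 1" "y \<in> tens r m d"
  shows "act2 r m (\<Theta> \<nu>) x y = 0"
  using assms(2,3)
proof (rule Theta_induct[where P = "\<lambda>u. u = 0"])
  fix "is" js assume "set js \<subseteq> Iset r m" "mset js = \<nu>"
  then have "nil_bound r m d \<le> length js" using assms(1) by auto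
  then show "act r m (mon (map GenF is)) x * act r m (mon (map GenE js)) y = 0"
    using act_words_nilpotent(1)[OF assms(3)] by simp
qed simp_all

lemma Theta_vanish:
  "\<nu> \<notin> weights_upto r m (nil_bound r m d) \<Longrightarrow> x \<in> tens r m 1 \<Longrightarrow> y \<in> tens r m d \<Longrightarrow> act2 r m (\<Theta> \<nu>) x y = 0"
  by (rule Theta_vanish_aux) (auto simp: weights_upto_def)

lemma Theta_Sum_any:
  assumes "x \<in> tens r m 1" "y \<in> tens r m d"
  shows "Sum_any (\<lambda>\<nu>. act2 r m (\<Theta> \<nu>) x y) = Theta_op r m \<Theta> d (x * y)"
proof -
  have "{\<nu>. act2 r m (\<Theta> \<nu>) x y \<noteq> 0} \<subseteq> weights_upto r m (nil_bound r m d)"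
    using Theta_vanish[OF _ assms] by blast
  then show ?thesis
    by (simp add: Sum_any.expand_superset[OF finite_weights_upto] Theta_op_def op2_mult[OF assms(1)])
qed

lemma Theta_op_upto:
  assumes "nil_bound r m d \<le> L" "x \<in> tens r m 1" "y \<in> tens r m d"
  shows "(\<Sum>\<nu>\<in>weights_upto r m L. op2 r m (\<Theta> \<nu>) (x * y)) = Theta_op r m \<Theta> d (x * y)"
proof -
  have "weights_upto r m (nil_bound r m d) \<subseteq> weights_upto r m L"
    using assms(1) by (auto simp: weights_upto_def)
  then show ?thesis unfolding Theta_op_def
    by (intro sum.mono_neutral_right finite_weights_upto)
      (auto simp: op2_mult[OF assms(2)] Theta_vanish[OF _ assms(2,3)])
qed

lemma Theta_intertwines:
  assumes x: "x \<in> tens r m 1" and y: "y \<in> tens r m d"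
  shows "op2 r m (Delta u) (Theta_op r m \<Theta> d (x * y)) = Theta_op r m \<Theta> d (op2 r m (barUU (Delta (barU u))) (x * y))"
proof -
  let ?N = "max (nil_bound r m 1) (nil_bound r m d)" and ?u' = "barUU (Delta (barU u))"
  have "\<forall>u N. \<exists>L0. \<forall>L\<ge>L0. (\<Sum>\<nu>\<in>weights_upto r m L. Delta u * \<Theta> \<nu> - \<Theta> \<nu> * barUU (Delta (barU u)))
      \<in> UU_filt r m N"
    using Theta by (simp add: quasi_R_matrix_def)
  then obtain L0 where L0: "\<And>L. L \<ge> L0 \<Longrightarrow>
      (\<Sum>\<nu>\<in>weights_upto r m L. Delta u * \<Theta> \<nu> - \<Theta> \<nu> * ?u') \<in> UU_filt r m ?N"
    by blast
  \<comment> \<open>From \<open>L0\<close> on, the defect of the intertwining relation acts by zero;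
    from \<open>?N\<close> on, the partial sum is already \<open>Theta_op\<close>.\<close>
  define L where "L = max L0 ?N"
  define S where "S = weights_upto r m L"
  have 1: "op2 r m (\<Sum>\<nu>\<in>S. Delta u * \<Theta> \<nu> - \<Theta> \<nu> * ?u') (x * y) = 0"
    unfolding op2_mult[OF x] S_def
    by (rule UU_filt_act2[OF L0 x y]) (simp_all add: L_def)
  \<comment> \<open>The vector to which Theta is applied here is only a sum of pure tensors, whence
    the detour through \<open>op2_range_zero\<close>.\<close>
  have "(\<Sum>\<nu>\<in>S. op2 r m (\<Theta> \<nu>) (op2 r m ?u' (x * y))) - Theta_op r m \<Theta> d (op2 r m ?u' (x * y)) = 0"
    by (rule op2_range_zero[OF x y])
      (auto intro!: slin_minus slin_summation slin_op2 slin_Theta_op simp: S_def L_def Theta_op_upto)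
  moreover have "(\<Sum>\<nu>\<in>S. op2 r m (Delta u) (op2 r m (\<Theta> \<nu>) (x * y)))
      = (\<Sum>\<nu>\<in>S. op2 r m (\<Theta> \<nu>) (op2 r m ?u' (x * y)))"
    using 1 by (simp add: op2_lin op2_times[OF x] sum_subtractf del: op2_mult)
  moreover have "Theta_op r m \<Theta> d (x * y) = (\<Sum>\<nu>\<in>S. op2 r m (\<Theta> \<nu>) (x * y))"
    unfolding S_def by (rule Theta_op_upto[OF _ x y, symmetric]) (simp add: L_def)
  ultimately show ?thesis by (simp add: op2_lin)
qed

end

section \<open>The bar involution psi on tensor powers\<close>

lemma slin_bar_tens: "slin qbar (bar_tens r m \<Theta>)"
  by (simp add: bar_tens_def slin_antilin_ext)

lemmas bar_tens_simps = slin_simps[OF slin_bar_tens]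

lemma bar_tens_mon: "bar_tens r m \<Theta> (mon f) = bar_M r m \<Theta> f"
  by (simp add: bar_tens_def)

lemma slin_barUU: "slin qbar barUU"
  by (simp add: barUU_def slin_antilin_ext)

lemma barUU_mon: "barUU (mon us \<otimes>\<^sub>t mon vs) = barU (mon us) \<otimes>\<^sub>t barU (mon vs)"
  by (simp add: mon_def barUU_def)

lemma barU_gen [simp]: "barU (mon [g]) = barU_gen g" "barU 1 = 1"
  by (simp_all add: barU_def)

lemma barUU_Delta_gen:
  "barUU (Delta (gE i)) = gE i \<otimes>\<^sub>t 1 + gKinv i \<otimes>\<^sub>t gE i"
  "barUU (Delta (gF i)) = gF i \<otimes>\<^sub>t gK i + 1 \<otimes>\<^sub>t gF i"
  "barUU (Delta (gK i)) = gKinv i \<otimes>\<^sub>t gKinv i"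
  "barUU (Delta (gKinv i)) = gK i \<otimes>\<^sub>t gK i"
  using barUU_mon[of "[GenE i]" "[]"] barUU_mon[of "[GenK i]" "[GenE i]"] barUU_mon[of "[GenF i]" "[GenKinv i]"]
    barUU_mon[of "[]" "[GenF i]"] barUU_mon[of "[GenK i]" "[GenK i]"] barUU_mon[of "[GenKinv i]" "[GenKinv i]"]
  by (simp_all add: Delta_def slin_simps[OF slin_barUU])

fun gen_bar :: "gen \<Rightarrow> gen" where
  "gen_bar (GenE i) = GenE i"
| "gen_bar (GenF i) = GenF i"
| "gen_bar (GenK i) = GenKinv i"
| "gen_bar (GenKinv i) = GenK i"

lemma barU_gen_eq: "barU_gen g = mon [gen_bar g]" and gen_bar_bar: "gen_bar (gen_bar g) = g"
  by (cases g; simp)+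

lemma tens_letter [simp]: "a \<in> II r m \<Longrightarrow> mon [a] \<in> tens r m 1"
  by simp

context
  fixes r m :: nat and \<Theta> :: "rat multiset \<Rightarrow> gen falg2"
  assumes Theta: "quasi_R_matrix r m \<Theta>"
begin

abbreviation "psi \<equiv> bar_tens r m \<Theta>"

lemma tens_Theta_op:
  assumes "x \<in> tens r m 1" "y \<in> tens r m d"
  shows "Theta_op r m \<Theta> d (x * y) \<in> tens r m (Suc d)"
proof -
  have mult: "x * y \<in> tens r m (Suc d)" if "x \<in> tens r m 1" "y \<in> tens r m d" for x y
    by (rule tens_map[where A = "\<lambda>x. x * y" and \<sigma> = "\<lambda>c. c", OF _ that(1)])
      (use that in \<open>auto intro!: slin_intros simp: indices_Suc\<close>)
  have "act2 r m z x y \<in> tens r m (Suc d)" for z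
    unfolding act2_def lin_ext_def using assms
    by (intro tens_sum) (auto simp: split_beta intro!: tens_smul mult)
  then show ?thesis by (simp add: Theta_op_def op2_mult[OF assms(1)] tens_sum)
qed

text \<open>On V tensor the trivial module only the leading term acts, \<open>nil_bound\<close>
  being 1 in degree 0. Thus the clause of \<open>bar_M\<close> for a single letter is an instance of
  the general recursion, see \<open>bar_M_Cons\<close>.\<close>

lemma Theta_op_one:
  assumes x: "x \<in> tens r m 1"
  shows "Theta_op r m \<Theta> 0 (x * 1) = x"
proof -
  have "(\<Sum>\<nu>\<in>weights_upto r m (nil_bound r m 0). op2 r m (\<Theta> \<nu>) (x * 1)) = (\<Sum>\<nu>\<in>{{#}}. op2 r m (\<Theta> \<nu>) (x * 1))"
  proof (intro sum.mono_neutral_right finite_weights_upto ballI)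
    show "{{#}} \<subseteq> weights_upto r m (nil_bound r m 0)" by (simp add: weights_upto_def)
    fix \<nu> assume "\<nu> \<in> weights_upto r m (nil_bound r m 0) - {{#}}"
    then have "nil_bound r m 0 \<le> size \<nu>" by (simp add: nil_bound_def Suc_le_eq nonempty_has_size)
    then show "op2 r m (\<Theta> \<nu>) (x * 1) = 0"
      unfolding op2_mult[OF x] by (intro Theta_vanish_aux[OF Theta _ x, where d = 0]) auto
  qed
  moreover have "act2 r m (\<Theta> {#}) x 1 = act2 r m (1 \<otimes>\<^sub>t 1) x 1"
    using Theta by (intro ueq2_act2[OF _ x, where d = 0]) (auto simp: quasi_R_matrix_def)
  ultimately show ?thesis unfolding Theta_op_def by (simp add: op2_mult[OF x, of _ 1, simplified] act2_tensor)
qed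

lemma bar_M_Cons:
  assumes "a \<in> II r m" "f \<in> indices r m d" "bar_M r m \<Theta> f \<in> tens r m d"
  shows "bar_M r m \<Theta> (a # f) = Theta_op r m \<Theta> d (mon [a] * bar_M r m \<Theta> f)"
proof (cases f)
  case Nil
  then show ?thesis using assms Theta_op_one[of "mon [a]"] by simp
next
  case (Cons b g)
  then show ?thesis using Theta_Sum_any[OF Theta tens_letter[OF assms(1)] assms(3)] by simp
qed

lemma tens_bar_M: "f \<in> indices r m d \<Longrightarrow> bar_M r m \<Theta> f \<in> tens r m d"
proof (induction f arbitrary: d)
  case (Cons a f)
  then obtain e where e: "d = Suc e" "a \<in> II r m" "f \<in> indices r m e" by auto
  show ?case unfolding e(1) bar_M_Cons[OF e(2,3) Cons.IH[OF e(3)]]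
    by (rule tens_Theta_op[OF tens_letter[OF e(2)] Cons.IH[OF e(3)]])
qed simp

lemma tens_psi [simp]: "x \<in> tens r m d \<Longrightarrow> psi x \<in> tens r m d"
  by (rule tens_map[OF slin_bar_tens]) (auto simp: bar_tens_mon tens_bar_M)

lemma psi_Cons:
  assumes "a \<in> II r m" "y \<in> tens r m d"
  shows "psi (mon [a] * y) = Theta_op r m \<Theta> d (mon [a] * psi y)"
proof -
  have "slin qbar (\<lambda>y. psi (mon [a] * y))" "slin qbar (\<lambda>y. Theta_op r m \<Theta> d (mon [a] * psi y))"
    by (auto intro!: slinI simp: bar_tens_simps distrib_left smul_mult_right slin_simps[OF slin_Theta_op])
  then show ?thesis using assms(2)
    by (rule tens_ext) (simp add: bar_tens_mon bar_M_Cons[OF assms(1)] tens_bar_M flip: mon_Cons)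
qed

text \<open>The relation between Theta and Delta is used for u = bar g. It leaves the conjugate of
  Delta(g) acting on the first letter and on psi of the tail, where the induction hypothesis in
  degree d applies.\<close>

lemma psi_gact: "x \<in> tens r m d \<Longrightarrow> psi (gact r m g x) = gact r m (gen_bar g) (psi x)"
proof (induction d arbitrary: x g)
  case 0
  have lin: "slin qbar (\<lambda>x. psi (gact r m g x))" "slin qbar (\<lambda>x. gact r m (gen_bar g) (psi x))"
    by (auto intro!: slinI simp: bar_tens_simps slin_simps[OF slin_gact])
  have "psi 1 = 1" using bar_tens_mon[of r m \<Theta> "[]"] by simp
  then show ?case
    by (intro tens_ext[OF lin 0]) (cases g; auto simp: gact_def bar_tens_simps)
next
  case (Suc d)
  have "slin qbar (\<lambda>x. psi (gact r m g x))" "slin qbar (\<lambda>x. gact r m (gen_bar g) (psi x))"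
    by (auto intro!: slinI simp: bar_tens_simps slin_simps[OF slin_gact])
  then show ?case using Suc.prems
  proof (rule tens_ext)
    fix f assume "f \<in> indices r m (Suc d)"
    then obtain a h where f: "f = a # h" "a \<in> II r m" "h \<in> indices r m d" by (auto simp: indices_Suc)
    define y where "y = mon h"
    have y: "y \<in> tens r m d" by (simp add: y_def f)
    note II = Iset_II
    have "gact r m (gen_bar g) (psi (mon [a] * y)) = op2 r m (Delta (mon [gen_bar g])) (psi (mon [a] * y))"
      by (rule op2_Delta_gen[symmetric, where d = d]) (simp add: f y)
    also have "\<dots> = Theta_op r m \<Theta> d (op2 r m (barUU (Delta (mon [g]))) (mon [a] * psi y))"
      unfolding psi_Cons[OF f(2) y]
      using Theta_intertwines[OF Theta tens_letter[OF f(2)] tens_psi[OF y], of "mon [gen_bar g]"]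
      by (simp add: barU_gen_eq gen_bar_bar)
    also have "\<dots> = psi (gact r m g (mon [a] * y))"
    proof (cases "gidx g \<in> Iset r m")
      case True
      have P: "psi (mon [b] * z) = Theta_op r m \<Theta> d (mon [b] * psi z)"
        if "b \<in> II r m" "z \<in> tens r m d" for b z
        using that by (rule psi_Cons)
      have T: "opr g y \<in> tens r m d" if "gidx g \<in> Iset r m" for g
        using tens_gact[OF y, of g] that by (simp add: gact_def)
      have IH: "psi (oE i y) = oE i (psi y)" "psi (oF i y) = oF i (psi y)"
        "psi (oK i y) = oL i (psi y)" "psi (oL i y) = oK i (psi y)" if "i \<in> Iset r m" for i
        using Suc.IH[OF y, of "GenE i"] Suc.IH[OF y, of "GenF i"] Suc.IH[OF y, of "GenK i"]
          Suc.IH[OF y, of "GenKinv i"] that by (simp_all add: gact_simps)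
      show ?thesis
        using True f(2) y
        by (cases g) (auto simp: barUU_Delta_gen op2_letter act2_lin act2_tensor gact_simps opr_letter opr_E opr_F
          slin_simps[OF slin_Theta_op] smul_mult_left smul_mult_right bar_tens_simps qbar_kap II P T IH)
    next
      case False
      then show ?thesis
        by (cases g) (simp_all add: barUU_Delta_gen op2_letter act2_lin act2_tensor gact_def
          slin_simps[OF slin_Theta_op] bar_tens_simps)
    qed
    finally show "psi (gact r m g (mon f)) = gact r m (gen_bar g) (psi (mon f))"
      by (simp add: f(1) y_def flip: mon_Cons)
  qed
qed

end

section \<open>Symmetry of the hermitian form twisted by psi\<close>

lemma hform_act_E: "hform (gact r m (GenE i) x) y = hform x (gact r m (GenE (- i)) y)"
  using adj_gact(1) by (simp add: adj_def)

lemma sum_eq_single: "finite S \<Longrightarrow> a \<in> S \<Longrightarrow> (\<And>b. b \<in> S \<Longrightarrow> b \<noteq> a \<Longrightarrow> f b = 0) \<Longrightarrow> sum f S = (f a :: qf)"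
  by (simp add: sum.remove[of S a])

context
  fixes r m :: nat and \<Theta> :: "rat multiset \<Rightarrow> gen falg2"
  assumes Theta: "quasi_R_matrix r m \<Theta>"
begin

text \<open>The largest letter. As F_i raises letters, the vector with this letter is the one of
  lowest weight.\<close>

abbreviation "lowest \<equiv> of_nat r + half m - 1/2"

lemma lowest_outside: "lowest + 1/2 \<notin> Iset r m" "- lowest - 1/2 \<notin> Iset r m"
  by (auto simp: Iset_iff abs_le_iff)

lemma Theta_op_leading:
  assumes "x \<in> tens r m 1" "y \<in> tens r m d"
    and zero: "\<And>is js. set is \<subseteq> Iset r m \<Longrightarrow> is \<noteq> [] \<Longrightarrow>
      hform w (act r m (mon (map GenF is)) x * act r m (mon (map GenE js)) y) = 0"
  shows "hform w (Theta_op r m \<Theta> d (x * y)) = hform w (x * y)"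
proof -
  have "hform w (act2 r m (\<Theta> \<nu>) x y) = 0" if "\<nu> \<noteq> {#}" for \<nu>
    by (rule Theta_induct[OF Theta assms(1,2), where P = "\<lambda>u. hform w u = 0"])
      (use that zero in \<open>auto simp: hform_simps\<close>)
  moreover have "{#} \<in> weights_upto r m (nil_bound r m d)" by (simp add: weights_upto_def)
  moreover have "act2 r m (\<Theta> {#}) x y = act2 r m (1 \<otimes>\<^sub>t 1) x y"
    using Theta by (intro ueq2_act2[OF _ assms(1,2)]) (auto simp: quasi_R_matrix_def)
  ultimately show ?thesis
    by (simp add: Theta_op_def hform_sum op2_mult[OF assms(1)] act2_tensor
      sum_eq_single[OF finite_weights_upto, of "{#}"])
qed

lemma F_word_lowest:
  assumes "set is \<subseteq> Iset r m" "is \<noteq> []"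
  shows "act r m (mon (map GenF is)) (mon [lowest]) = 0"
proof -
  obtain js j where "is": "is = js @ [j]" by (metis assms(2) rev_exhaust)
  have "j \<noteq> lowest + 1/2" using lowest_outside(1) assms(1) "is" by auto
  then have "gact r m (GenF j) (mon [lowest]) = 0" by (simp add: gact_def opr_letter)
  then show ?thesis by (simp add: "is" mon_append)
qed

text \<open>The outermost F_i produces the letter i + 1/2, which is never the smallest one, and the
  smallest letter is the only one that pairs with \<open>lowest\<close>.\<close>

lemma F_word_highest:
  assumes "set is \<subseteq> Iset r m" "is \<noteq> []" "x \<in> tens r m 1"
  shows "hform (mon [lowest] * w) (act r m (mon (map GenF is)) x * y) = 0"
proof -
  obtain i js where "is": "is = i # js" by (metis assms(2) list.exhaust)
  have iI: "i \<in> Iset r m" using assms(1) "is" by auto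
  have "lowest \<noteq> - (i + 1/2)"
  proof
    assume "lowest = - (i + 1/2)"
    then have "i = - lowest - 1/2" by simp
    then show False using lowest_outside(2) iI by metis
  qed
  note i = iI this
  have expand: "gact r m (GenF i) x' * y = (\<Sum>w\<in>Poly_Mapping.keys x'. coeff_at x' w *\<^sub>q (gact r m (GenF i) (mon (letters w)) * y))" for x'
    by (subst slin_expand[OF slin_gact]) (simp add: sum_distrib_right smul_mult_left)
  have zero: "hform (mon [lowest] * w) (gact r m (GenF i) (mon f) * y) = 0" if "f \<in> indices r m 1" for f
    using that i by (auto simp: indices_Suc gact_def opr_letter)
  have *: "hform (mon [lowest] * w) (gact r m (GenF i) x' * y) = 0" if "x' \<in> tens r m 1" for x'
  proof -
    have "letters u \<in> indices r m 1" if "u \<in> Poly_Mapping.keys x'" for u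
      using that \<open>x' \<in> tens r m 1\<close> by (auto simp: tens_def)
    then show ?thesis by (subst expand) (simp add: hform_sum hform_simps zero)
  qed
  show ?thesis unfolding "is" list.map mon_Cons[of "GenF i" "map GenF js"] act_mult act_gen
    by (rule *) (rule tens_act[OF assms(3)])
qed

lemma bar_form_symmetric:
  "x \<in> tens r m d \<Longrightarrow> y \<in> tens r m d \<Longrightarrow> hform x (psi r m \<Theta> y) = hform y (psi r m \<Theta> x)"
proof (induction d arbitrary: x y)
  case 0
  have one: "psi r m \<Theta> 1 = 1" using bar_tens_mon[of r m \<Theta> "[]"] by simp
  have "\<exists>c. x = c *\<^sub>q 1" if "x \<in> tens r m 0" for x
  proof -
    have "letters w = []" if "w \<in> Poly_Mapping.keys x" for w
      using that \<open>x \<in> tens r m 0\<close> by (auto simp: tens_def)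
    then have "x = (\<Sum>w\<in>Poly_Mapping.keys x. coeff_at x w) *\<^sub>q 1"
      by (subst expand_mon) (simp add: smul.scale_sum_left)
    then show ?thesis by blast
  qed
  then obtain c c' where "x = c *\<^sub>q 1" "y = c' *\<^sub>q 1" using 0 by metis
  then show ?case by (simp add: bar_tens_simps one hform_simps mult.commute)
next
  case (Suc d)
  define S where "S = {x \<in> tens r m (Suc d). \<forall>y\<in>tens r m (Suc d). hform x (psi r m \<Theta> y) = hform y (psi r m \<Theta> x)}"
  have S_add: "x + y \<in> S" if "x \<in> S" "y \<in> S" for x y
    using that by (auto simp: S_def hform_simps bar_tens_simps)
  have S_smul: "c *\<^sub>q x \<in> S" if "x \<in> S" for x c
    using that by (auto simp: S_def hform_simps bar_tens_simps)
  have S_E: "gact r m (GenE i) x \<in> S" if "x \<in> S" for x i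
  proof -
    have "hform (gact r m (GenE i) x) (psi r m \<Theta> y) = hform y (psi r m \<Theta> (gact r m (GenE i) x))" if y: "y \<in> tens r m (Suc d)" for y
    proof -
      have x: "x \<in> tens r m (Suc d)" using \<open>x \<in> S\<close> by (simp add: S_def)
      have "hform (gact r m (GenE i) x) (psi r m \<Theta> y) = hform x (psi r m \<Theta> (gact r m (GenE (- i)) y))"
        by (simp add: hform_act_E psi_gact[OF Theta y])
      also have "\<dots> = hform (gact r m (GenE (- i)) y) (psi r m \<Theta> x)"
        using \<open>x \<in> S\<close> y by (simp add: S_def)
      also have "\<dots> = hform y (psi r m \<Theta> (gact r m (GenE i) x))"
        by (simp add: hform_act_E psi_gact[OF Theta x])
      finally show ?thesis .
    qed
    then show ?thesis using that by (simp add: S_def)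
  qed
  have S_lowest: "mon [lowest] * x \<in> S" if x: "x \<in> tens r m d" "lowest \<in> II r m" for x
  proof -
    have "hform (mon [lowest] * x) (psi r m \<Theta> y) = hform y (psi r m \<Theta> (mon [lowest] * x))" if y: "y \<in> tens r m (Suc d)" for y
    proof -
      have *: "hform (mon [lowest] * x) (psi r m \<Theta> (mon [b] * mon g)) = hform (mon [b] * mon g) (psi r m \<Theta> (mon [lowest] * x))"
        if b: "b \<in> II r m" "g \<in> indices r m d" for b g
      proof -
        have g: "mon g \<in> tens r m d" using b by simp
        have "hform (mon [lowest] * x) (psi r m \<Theta> (mon [b] * mon g)) = hform (mon [lowest] * x) (mon [b] * psi r m \<Theta> (mon g))"
          unfolding psi_Cons[OF Theta b(1) g]
          by (rule Theta_op_leading) (use b g tens_psi[OF Theta g] F_word_highest in auto)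
        also have "\<dots> = (if lowest = - b then hform x (psi r m \<Theta> (mon g)) else 0)" by simp
        also have "\<dots> = (if b = - lowest then hform (mon g) (psi r m \<Theta> x) else 0)"
          using Suc.IH[OF x(1) g] by auto
        also have "\<dots> = hform (mon [b] * mon g) (mon [lowest] * psi r m \<Theta> x)" by simp
        also have "\<dots> = hform (mon [b] * mon g) (psi r m \<Theta> (mon [lowest] * x))"
          unfolding psi_Cons[OF Theta x(2,1)]
          by (rule Theta_op_leading[symmetric]) (use x tens_psi[OF Theta x(1)] F_word_lowest in auto)
        finally show ?thesis .
      qed
      have "hform (mon [lowest] * x) (psi r m \<Theta> (mon f)) = hform (mon f) (psi r m \<Theta> (mon [lowest] * x))"
        if fI: "f \<in> indices r m (Suc d)" for f
      proof -
        obtain b g where "f = b # g" "b \<in> II r m" "g \<in> indices r m d"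
          using fI by (auto simp: indices_Suc)
        with * show ?thesis by (simp only: mon_Cons[of b g])
      qed
      then show ?thesis using y
        by (intro functional_ext[where \<sigma> = "\<lambda>c. c" and F = "\<lambda>y. hform (mon [lowest] * x) (psi r m \<Theta> y)"
            and G = "\<lambda>y. hform y (psi r m \<Theta> (mon [lowest] * x))" and x = y])
          (auto simp: hform_simps bar_tens_simps tens_iff)
    qed
    then show ?thesis using x by (simp add: S_def)
  qed
  have S_letter: "mon [a] * x \<in> S" if a: "a \<in> II r m" and x: "x \<in> tens r m d" for a x
  proof -
    have "\<forall>a x. a \<in> II r m \<longrightarrow> x \<in> tens r m d \<longrightarrow> a + of_nat k = lowest \<longrightarrow> mon [a] * x \<in> S" for k
    proof (induction k)
      case 0
      then show ?case using S_lowest by auto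
    next
      case (Suc k)
      show ?case
      proof (intro allI impI)
        fix a x assume a: "a \<in> II r m" "x \<in> tens r m d" "a + of_nat (Suc k) = lowest"
        have a1: "a + 1 \<in> II r m"
        proof -
          have "a + 1 - (half m - 1/2) \<in> \<int>"
            using a(1) Ints_add[of "a - (half m - 1/2)" 1] by (simp add: II_iff algebra_simps)
          then show ?thesis using a by (auto simp: II_iff abs_le_iff)
        qed
        have i: "a + 1/2 \<in> Iset r m"
        proof -
          have "a + 1/2 - half m \<in> \<int>"
            using a(1) by (simp add: II_iff algebra_simps)
          then show ?thesis using a a1 by (auto simp: Iset_iff II_iff abs_le_iff)
        qed
        have IH: "mon [a + 1] * y \<in> S" if "y \<in> tens r m d" for y
          using Suc.IH a1 that a(3) by simp
        \<comment> \<open>E_{a+1/2} takes v_{a+1} tensor x to v_a tensor x plus a term that still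
          begins with v_{a+1}. So all first letters are reached by descending from
          \<open>lowest\<close>.\<close>
        have "gact r m (GenE (a + 1/2)) (mon [a + 1] * x)
            = mon [a] * x + inverse qq *\<^sub>q (mon [a + 1] * gact r m (GenE (a + 1/2)) x)"
          using i by (simp add: gact_simps opr_E kap_def)
        then have "mon [a] * x = gact r m (GenE (a + 1/2)) (mon [a + 1] * x)
            + (- inverse qq) *\<^sub>q (mon [a + 1] * gact r m (GenE (a + 1/2)) x)"
          by simp
        also have "\<dots> \<in> S" by (intro S_add S_smul S_E IH) (simp_all add: a)
        finally show "mon [a] * x \<in> S" .
      qed
    qed
    moreover obtain k where "a + of_nat k = lowest"
    proof -
      have "a - (half m - 1/2) \<in> \<int>" "a \<le> lowest" using a by (auto simp: II_iff)
      note a' = this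
      have "of_nat r - (a - (half m - 1/2)) \<in> \<int>" by (rule Ints_diff[OF Ints_of_nat a'(1)])
      moreover have "of_nat r - (a - (half m - 1/2)) = lowest - a" by simp
      ultimately obtain z where z: "lowest - a = of_int z" by (metis Ints_cases)
      then have "z \<ge> 0" using a'(2) by (metis diff_ge_0_iff_ge of_int_0_le_iff)
      then have "rat_of_nat (nat z) = lowest - a" unfolding z by simp
      then have "a + of_nat (nat z) = lowest" by simp
      then show ?thesis by (rule that)
    qed
    ultimately show ?thesis using a x by blast
  qed
  have "mon f \<in> S" if "f \<in> indices r m (Suc d)" for f
  proof -
    from that obtain b g where "f = b # g" "b \<in> II r m" "g \<in> indices r m d" by (auto simp: indices_Suc)
    then show ?thesis using S_letter[of b "mon g"] by (simp flip: mon_Cons)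
  qed
  then have "hform (mon f) (psi r m \<Theta> y) = hform y (psi r m \<Theta> (mon f))" if "f \<in> indices r m (Suc d)" for f
    using that Suc.prems by (auto simp: S_def)
  then show ?case using Suc.prems
    by (intro functional_ext[where \<sigma> = "\<lambda>c. c" and F = "\<lambda>x. hform x (psi r m \<Theta> y)"
        and G = "\<lambda>x. hform y (psi r m \<Theta> x)" and x = x])
      (auto simp: hform_simps bar_tens_simps tens_iff)
qed

end

section \<open>Singular vectors\<close>

lemma std_form_0 [simp]: "std_form 0 y = 0" "std_form x 0 = 0"
  by (simp_all add: std_form_def)

lemma std_form_Cons: "std_form (mon [a] * x) (mon [b] * y) = (if a = b then std_form x y else 0)"
proof -
  have words: "std_form (mon [a] * mon f) (mon [b] * y) = (if a = b then std_form (mon f) y else 0)" for f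
    by (rule functional_ext[where \<sigma> = "\<lambda>c. c" and x = y and F = "\<lambda>y. std_form (mon [a] * mon f) (mon [b] * y)"
          and G = "\<lambda>y. if a = b then std_form (mon f) y else 0"])
      (auto simp: std_form_add_right std_form_smul_right distrib_left smul_mult_right mon_append[symmetric] coeff_mon)
  show ?thesis
    by (rule functional_ext[where \<sigma> = "\<lambda>c. c" and x = x and F = "\<lambda>x. std_form (mon [a] * x) (mon [b] * y)"
          and G = "\<lambda>x. if a = b then std_form x y else 0"])
      (simp_all add: std_form_add_left std_form_smul_left distrib_left smul_mult_right words)
qed

lemma std_form_letter_one: "std_form (mon [a] * x) 1 = 0" "std_form 1 (mon [a] * x) = 0"
proof -
  have "std_form (mon [a] * x) (mon []) = 0"
    by (rule functional_ext[where \<sigma> = "\<lambda>c. c" and x = x and F = "\<lambda>x. std_form (mon [a] * x) (mon [])" and G = "\<lambda>x. 0"])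
      (simp_all add: std_form_add_left std_form_smul_left distrib_left smul_mult_right mon_append[symmetric] coeff_mon del: mon_Nil)
  moreover have "std_form (mon []) (mon [a] * x) = 0"
    by (rule functional_ext[where \<sigma> = "\<lambda>c. c" and x = x and F = "\<lambda>x. std_form (mon []) (mon [a] * x)" and G = "\<lambda>x. 0"])
      (simp_all add: std_form_add_right std_form_smul_right distrib_left smul_mult_right mon_append[symmetric] coeff_mon del: mon_Nil)
  ultimately show "std_form (mon [a] * x) 1 = 0" "std_form 1 (mon [a] * x) = 0" by simp_all
qed

text \<open>The coproduct of F_i K_i is F_i K_i tensor 1 + K_i tensor F_i K_i, which has the shape
  of that of E_i, and K_i is diagonal. The scalar 1/q is determined on V.\<close>

lemma std_form_oE: "std_form x (oE i y) = inverse qq * std_form (oF i (oK i x)) y"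
proof -
  have words: "std_form (mon f) (oE i (mon g)) = inverse qq * std_form (oF i (oK i (mon f))) (mon g)" for f g
  proof (induction f arbitrary: g)
    case Nil
    show ?case
    proof (cases g)
      case (Cons b g')
      then show ?thesis unfolding Cons mon_Cons[of b g'] by (simp add: opr_E std_form_add_right std_form_smul_right
         std_form_letter_one del: std_form_mon_left)
    qed simp
  next
    case (Cons a f)
    show ?case
    proof (cases g)
      case Nil
      then show ?thesis unfolding mon_Cons[of a f] by (simp add: opr_F std_form_add_left std_form_smul_left
         std_form_letter_one)
    next
      case g: (Cons b g')
      show ?thesis unfolding mon_Cons[of a f] g mon_Cons[of b g']
        using Cons.IH[of g']
        by (auto simp: opr_E opr_F std_form_add_left std_form_smul_left std_form_add_right std_form_smul_right
           std_form_Cons kap_def simp del: std_form_mon_left)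
    qed
  qed
  have "std_form (mon f) (oE i y) = inverse qq * std_form (oF i (oK i (mon f))) y" for f
    by (rule functional_ext[where \<sigma> = "\<lambda>c. c" and x = y and F = "\<lambda>y. std_form (mon f) (oE i y)"
          and G = "\<lambda>y. inverse qq * std_form (oF i (oK i (mon f))) y"])
      (simp_all add: std_form_add_right std_form_smul_right words distrib_left del: std_form_mon_left)
  then show ?thesis
    by (intro functional_ext[where \<sigma> = "\<lambda>c. c" and x = x and F = "\<lambda>x. std_form x (oE i y)"
          and G = "\<lambda>x. inverse qq * std_form (oF i (oK i x)) y"])
      (simp_all add: std_form_add_left std_form_smul_left distrib_left del: std_form_mon_left)
qed

text \<open>The field of rational functions is formally real, being ordered.\<close>

lemma std_form_anisotropic: "std_form x x = 0 \<Longrightarrow> x = 0"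
proof -
  assume "std_form x x = 0"
  then have "\<forall>f\<in>Poly_Mapping.keys x. coeff_at x f * coeff_at x f = 0"
    unfolding std_form_def by (subst (asm) sum_nonneg_eq_0_iff) auto
  then have "coeff_at x f = 0" for f by (cases "f \<in> Poly_Mapping.keys x") (auto simp: in_keys_iff)
  then show ?thesis by (intro poly_mapping_eqI) simp
qed

section \<open>The submodule generated by the singular vectors\<close>

definition singular :: "nat \<Rightarrow> nat \<Rightarrow> nat \<Rightarrow> rat falg set" where
  "singular r m d = {x \<in> tens r m d. \<forall>i\<in>Iset r m. oE i x = 0}"

text \<open>The level k bounds the number of F's from above, since singular vectors belong to every
  level. Closure under scalars follows, as singular vectors absorb them.\<close>

inductive lowered :: "nat \<Rightarrow> nat \<Rightarrow> nat \<Rightarrow> nat \<Rightarrow> rat falg \<Rightarrow> bool" for r m d where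
  lowered_singular: "x \<in> singular r m d \<Longrightarrow> lowered r m d k x"
| lowered_add: "lowered r m d k x \<Longrightarrow> lowered r m d k y \<Longrightarrow> lowered r m d k (x + y)"
| lowered_F: "lowered r m d k x \<Longrightarrow> i \<in> Iset r m \<Longrightarrow> lowered r m d (Suc k) (oF i x)"

lemma lowered_Suc: "lowered r m d k x \<Longrightarrow> lowered r m d (Suc k) x"
  by (induction rule: lowered.induct) (auto intro: lowered.intros)

lemma lowered_smul: "lowered r m d k x \<Longrightarrow> lowered r m d k (c *\<^sub>q x)"
proof (induction rule: lowered.induct)
  case (lowered_F k x i)
  then show ?case using lowered.lowered_F[of r m d k "c *\<^sub>q x" i] by simp
qed (auto simp: smul.scale_right_distrib singular_def intro: lowered.intros)

lemma lowered_tens: "lowered r m d k x \<Longrightarrow> x \<in> tens r m d"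
proof (induction rule: lowered.induct)
  case (lowered_F k x i)
  then show ?case using tens_gact[of x r m d "GenF i"] by (simp add: gact_simps)
qed (auto simp: singular_def)

lemma lowered_diff: "lowered r m d k x \<Longrightarrow> lowered r m d k y \<Longrightarrow> lowered r m d k (x - y)"
  using lowered_add[OF _ lowered_smul[of r m d k y "- 1"]] by simp

lemma lowered_K: "lowered r m d k x \<Longrightarrow> i \<in> Iset r m \<Longrightarrow> lowered r m d k (oK i x)"
proof (induction rule: lowered.induct)
  case (lowered_singular x k)
  have "oE j (oK i x) = 0" if "j \<in> Iset r m" for j
  proof -
    have "oK i (oE j x) = 0" using lowered_singular that by (simp add: singular_def)
    then show ?thesis by (simp add: oK_oE)
  qed
  then show ?case using lowered_singular tens_gact[of x r m d "GenK i"]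
    by (auto intro!: lowered.lowered_singular simp: singular_def gact_simps)
qed (auto simp: oK_oF intro: lowered.intros lowered_smul)

lemma lowered_L: "lowered r m d k x \<Longrightarrow> i \<in> Iset r m \<Longrightarrow> lowered r m d k (oL i x)"
proof (induction rule: lowered.induct)
  case (lowered_singular x k)
  have "oE j (oL i x) = 0" if "j \<in> Iset r m" for j
  proof -
    have "oL i (oE j x) = 0" using lowered_singular that by (simp add: singular_def)
    then show ?thesis by (simp add: oL_oE)
  qed
  then show ?case using lowered_singular tens_gact[of x r m d "GenKinv i"]
    by (auto intro!: lowered.lowered_singular simp: singular_def gact_simps)
qed (auto simp: oL_oF intro: lowered.intros lowered_smul)

text \<open>E_i lowers the level by one. Level 0 needs the separate claim E_i x = 0: with truncated
  subtraction F_j E_i x would otherwise be placed in level 1 instead of 0.\<close>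

lemma lowered_E_aux:
  "lowered r m d k x \<Longrightarrow> i \<in> Iset r m \<Longrightarrow> lowered r m d (k - 1) (oE i x) \<and> (k = 0 \<longrightarrow> oE i x = 0)"
proof (induction rule: lowered.induct)
  case (lowered_singular x k)
  then have "oE i x = 0" by (simp add: singular_def)
  moreover have "lowered r m d (k - 1) 0" by (rule lowered.lowered_singular) (simp add: singular_def)
  ultimately show ?case by simp
next
  case (lowered_F k x j)
  have "lowered r m d k (oF j (oE i x))"
  proof (cases k)
    case 0
    then have "oF j (oE i x) = 0" using lowered_F by simp
    moreover have "lowered r m d k 0" by (rule lowered.lowered_singular) (simp add: singular_def)
    ultimately show ?thesis by simp
  next
    case (Suc l)
    then show ?thesis using lowered_F by (auto intro: lowered.lowered_F)
  qed
  moreover have "lowered r m d k 0" by (rule lowered.lowered_singular) (simp add: singular_def)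
  ultimately show ?case using lowered_F
    by (auto simp: oE_oF intro!: lowered_add lowered_smul lowered_diff lowered_K lowered_L)
qed (auto intro: lowered_add)

lemma lowered_E: "lowered r m d k x \<Longrightarrow> lowered r m d k (gact r m (GenE i) x)"
proof (cases "i \<in> Iset r m")
  case True
  assume "lowered r m d k x"
  then have "lowered r m d (k - 1) (oE i x)" using lowered_E_aux True by blast
  then show ?thesis using True lowered_Suc[of r m d "k - 1" "oE i x"] by (cases k) (auto simp: gact_simps)
next
  case False
  have "lowered r m d k 0" by (rule lowered.lowered_singular) (simp add: singular_def)
  then show ?thesis using False by (simp add: gact_def)
qed

lemma lowered_root_E: "lowered r m d k x \<Longrightarrow> lowered r m d k (act r m (root_E n \<epsilon> t) x)"
  by (induction t arbitrary: x) (auto simp: qcomm_def intro: lowered_E lowered_diff lowered_smul)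

text \<open>All terms of B_i other than F_i are made of E's and K's, which preserve the level,
  whereas F_i x lies one level higher. This is what allows B_i to be traded for F_i.\<close>

lemma Bgen_lowered:
  assumes i: "i \<in> Iwhite r m" and ws: "longest_word r m ws" and x: "lowered r m d k x"
  shows "lowered r m d k (act r m (Bgen m p ws i) x - oF i x)"
proof -
  have iI: "i \<in> Iset r m" using i by (auto simp: Iwhite_def)
  note L = lowered_L[OF x iI]
  have main: ?thesis if "m \<ge> 1" "r \<ge> 1" "\<bar>\<epsilon>\<bar> = 1" "i = - (\<epsilon> * half m)" for \<epsilon>
  proof -
    have "act r m (T_word ws (gE (- i))) v = act r m (root_E (half m) \<epsilon> (m - 1)) v" for v
      using T_longest[OF ws that(1,2,3)] by (simp add: sim_def that(4))
    then have "act r m (Bgen m p ws i) x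
        = oF i x + varsigma m p i *\<^sub>q act r m (root_E (half m) \<epsilon> (m - 1)) (oL i x)"
      using that(1) by (intro act_Bgen[OF iI]) auto
    then show ?thesis using L by (simp add: lowered_smul lowered_root_E)
  qed
  from i show ?thesis
  proof (cases rule: Iwhite_cases)
    case 1
    then have "act r m (Bgen m p ws i) x - oF i x
        = varsigma m p 0 *\<^sub>q gact r m (GenE i) (oL i x) + kappa0 p *\<^sub>q oL i x"
      using iI by (simp add: Bgen_def gact_simps)
    then show ?thesis using L by (simp add: lowered_add lowered_smul lowered_E)
  next
    case 2
    then show ?thesis using main[of "- 1"] by simp
  next
    case 3
    then show ?thesis using main[of 1] by simp
  next
    case 4
    have "cartan j (- i) = 0" if "j \<in> set ws" for j
    proof -
      have "j \<in> Iblack m" using ws that by (auto simp: longest_word_def)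
      then show ?thesis using 4(1) by (auto simp: Iblack_iff cartan_def abs_if split: if_splits)
    qed
    then have "act r m (Bgen m p ws i) x - oF i x = varsigma m p i *\<^sub>q gact r m (GenE (- i)) (oL i x)"
      using 4 iI by (auto simp: Bgen_def gact_simps T_word_far)
    then show ?thesis using L by (simp add: lowered_smul lowered_E)
  qed
qed

text \<open>Induction on a length n such that all E words of length n kill y. By
  \<open>std_form_oE\<close> each E_i y is again orthogonal, and it is killed by words of length n -
  1, hence zero. So y is singular, therefore orthogonal to itself.\<close>

lemma lowered_orthogonal:
  assumes "y \<in> tens r m d" "\<And>k x. lowered r m d k x \<Longrightarrow> std_form x y = 0"
  shows "y = 0"
proof -
  have "\<forall>y\<in>tens r m d. (\<forall>k. \<forall>x. lowered r m d k x \<longrightarrow> std_form x y = 0) \<longrightarrow>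
      (\<forall>is. length is = n \<longrightarrow> act r m (mon (map GenE is)) y = 0) \<longrightarrow> y = 0" for n
  proof (induction n)
    case 0
    then show ?case by (metis act_one length_0_conv list.map(1) mon_Nil)
  next
    case (Suc n)
    show ?case
    proof (intro ballI impI)
      fix y assume y: "y \<in> tens r m d" and orth: "\<forall>k. \<forall>x. lowered r m d k x \<longrightarrow> std_form x y = 0"
        and nil: "\<forall>is. length is = Suc n \<longrightarrow> act r m (mon (map GenE is)) y = 0"
      have "oE i y = 0" if i: "i \<in> Iset r m" for i
      proof (rule Suc.IH[rule_format])
        show "oE i y \<in> tens r m d" using tens_gact[OF y, of "GenE i"] i by (simp add: gact_simps)
        show "std_form x (oE i y) = 0" if "lowered r m d k x" for k x
          using lowered_F[OF lowered_K[OF that i] i] orth by (simp add: std_form_oE)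
        fix "is" :: "rat list" assume "length is = n"
        then have "act r m (mon (map GenE (is @ [i]))) y = 0" by (intro nil[rule_format]) simp
        then show "act r m (mon (map GenE is)) (oE i y) = 0"
          using i by (simp add: mon_append gact_simps)
      qed
      then have "lowered r m d 0 y" using y by (intro lowered_singular) (simp add: singular_def)
      then have "std_form y y = 0" using orth by blast
      then show "y = 0" by (rule std_form_anisotropic)
    qed
  qed
  from this[of "nil_bound r m d"] show ?thesis
    using assms act_words_nilpotent(1)[OF assms(1)] by (metis order_refl)
qed

section \<open>The quasi K-matrix\<close>

lemma barU_mult: "barU (x * y) = barU x * barU y"
  and slin_barU: "slin qbar barU"
  by (simp_all add: barU_def slin_anti_alg_hom)

lemmas barU_simps = slin_simps[OF slin_barU] barU_mult

lemma psi_act: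
  assumes Theta: "quasi_R_matrix r m \<Theta>" and x: "x \<in> tens r m d"
  shows "psi r m \<Theta> (act r m u x) = act r m (barU u) (psi r m \<Theta> x)"
proof -
  have *: "psi r m \<Theta> (act r m (mon gs) x) = act r m (barU (mon gs)) (psi r m \<Theta> x)" for gs
  proof (induction gs)
    case (Cons g gs)
    have "psi r m \<Theta> (gact r m g (act r m (mon gs) x)) = gact r m (gen_bar g) (psi r m \<Theta> (act r m (mon gs) x))"
      using psi_gact[OF Theta tens_act[OF x]] .
    then show ?case unfolding mon_Cons[of g gs] barU_mult act_mult
      by (simp add: Cons barU_gen_eq)
  qed simp
  have "slin qbar (\<lambda>u. psi r m \<Theta> (act r m u x))" "slin qbar (\<lambda>u. act r m (barU u) (psi r m \<Theta> x))"
    by (auto intro!: slinI simp: bar_tens_simps barU_simps)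
  then show ?thesis by (rule slin_eq_mon) (rule *)
qed

section \<open>The quasi K-matrix as an operator on tensor powers\<close>

definition Upsilon_op :: "nat \<Rightarrow> nat \<Rightarrow> (rat multiset \<Rightarrow> gen falg) \<Rightarrow> nat \<Rightarrow> rat falg \<Rightarrow> rat falg" where
  "Upsilon_op r m \<Upsilon> d x = (\<Sum>\<mu>\<in>weights_upto r m (nil_bound r m d). act r m (\<Upsilon> \<mu>) x)"

lemma slin_Upsilon_op: "lin (Upsilon_op r m \<Upsilon> d)"
  unfolding Upsilon_op_def by (intro slin_summation slin_act)

lemma U_filt_act:
  assumes "u \<in> U_filt r m N" "x \<in> tens r m d" "nil_bound r m d \<le> N"
  shows "act r m u x = 0"
proof -
  obtain u' where u': "u' \<in> lspan {a * mon (map GenE is) | a is. set is \<subseteq> Iset r m \<and> N \<le> length is}" "ueq r m u u'"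
    using assms(1) unfolding U_filt_def by blast
  have "act r m u' x = 0" using u'(1) slin_act_left
  proof (rule lspan_induct[where P = "\<lambda>v. v = 0"])
    fix s assume "s \<in> {a * mon (map GenE is) | a is. set is \<subseteq> Iset r m \<and> N \<le> length is}"
    then obtain a "is" where "s = a * mon (map GenE is)" "N \<le> length is" by blast
    then show "act r m s x = 0"
      using act_words_nilpotent(1)[OF assms(2), of "is"] assms(3) by simp
  qed simp_all
  then show ?thesis using ueq_act[OF u'(2)] by simp
qed

lemma E_word_singular:
  assumes "\<And>i. gact r m (GenE i) z = 0" "is \<noteq> []"
  shows "act r m (mon (map GenE is)) z = 0"
proof -
  obtain js j where "is = js @ [j]" by (metis assms(2) rev_exhaust)
  then show ?thesis by (simp add: mon_append assms(1))
qed

lemma hform_singular: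
  assumes "\<And>i. gact r m (GenE i) z = 0" "is \<noteq> []"
  shows "hform z (act r m (mon (map GenE is)) y) = 0"
proof -
  obtain j js where "is": "is = j # js" by (metis assms(2) list.exhaust)
  have "hform z (gact r m (GenE j) y') = 0" for y'
    using hform_act_E[of r m "- j" z y'] assms(1) by simp
  then show ?thesis unfolding "is" list.map mon_Cons[of "GenE j" "map GenE js"] by simp
qed

locale iota_setup =
  fixes r m :: nat and k :: int and p :: qf and ws :: "rat list"
    and \<Theta> :: "rat multiset \<Rightarrow> gen falg2" and \<psi>\<^sub>i :: "gen falg \<Rightarrow> gen falg"
    and \<Upsilon> :: "rat multiset \<Rightarrow> gen falg"
  assumes p: "p = qq powi k" and ws: "longest_word r m ws" and Theta: "quasi_R_matrix r m \<Theta>"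
    and bar: "bar_U_iota r m p ws \<psi>\<^sub>i" and Upsilon: "quasi_K_matrix r m p ws \<psi>\<^sub>i \<Upsilon>"
begin

lemma Upsilon_induct:
  assumes P: "P 0" "\<And>c u v. P u \<Longrightarrow> P v \<Longrightarrow> P (c *\<^sub>q u + v)"
    and words: "\<And>is. set is \<subseteq> Iset r m \<Longrightarrow> mset is = \<mu> \<Longrightarrow> P (act r m (mon (map GenE is)) x)"
  shows "P (act r m (\<Upsilon> \<mu>) x)"
proof -
  have "\<Upsilon> \<mu> \<in> U_plus r m \<mu>" using Upsilon by (simp add: quasi_K_matrix_def)
  then obtain u where u: "u \<in> lspan {mon (map GenE is) | is. set is \<subseteq> Iset r m \<and> mset is = \<mu>}"
    "ueq r m (\<Upsilon> \<mu>) u" unfolding U_plus_def by blast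
  have "P (act r m u x)" using u(1) slin_act_left P by (rule lspan_induct) (auto simp: words)
  then show ?thesis using ueq_act[OF u(2)] by simp
qed

lemma Upsilon_zero: "act r m (\<Upsilon> {#}) x = x"
proof -
  have "ueq r m (\<Upsilon> {#}) 1" using Upsilon by (simp add: quasi_K_matrix_def)
  from ueq_act[OF this] show ?thesis by simp
qed

lemma Upsilon_vanish:
  assumes "\<mu> \<notin> weights_upto r m (nil_bound r m d)" "x \<in> tens r m d"
  shows "act r m (\<Upsilon> \<mu>) x = 0"
proof (rule Upsilon_induct[where P = "\<lambda>v. v = 0"])
  fix "is" assume "set is \<subseteq> Iset r m" "mset is = \<mu>"
  then have "nil_bound r m d \<le> length is" using assms(1) by (auto simp: weights_upto_def)
  then show "act r m (mon (map GenE is)) x = 0" by (rule act_words_nilpotent(1)[OF assms(2)])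
qed simp_all

lemma Upsilon_op_upto:
  assumes "nil_bound r m d \<le> L" "x \<in> tens r m d"
  shows "(\<Sum>\<mu>\<in>weights_upto r m L. act r m (\<Upsilon> \<mu>) x) = Upsilon_op r m \<Upsilon> d x"
proof -
  have "weights_upto r m (nil_bound r m d) \<subseteq> weights_upto r m L"
    using assms(1) by (auto simp: weights_upto_def)
  then show ?thesis unfolding Upsilon_op_def
    by (intro sum.mono_neutral_right finite_weights_upto) (auto simp: Upsilon_vanish[OF _ assms(2)])
qed

abbreviation "ibar \<equiv> ibar_tens r m \<Theta> \<Upsilon>"

text \<open>\<open>Sum_any\<close> is 0 by convention if infinitely many terms are nonzero.
  Semilinearity of \<open>ibar\<close> is therefore derived on a fixed tensor power, after this
  reduction to a finite sum.\<close>

lemma ibar_eq: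
  assumes "x \<in> tens r m d"
  shows "ibar x = Upsilon_op r m \<Upsilon> d (psi r m \<Theta> x)"
proof -
  have x: "psi r m \<Theta> x \<in> tens r m d" using tens_psi[OF Theta assms] .
  have "{\<mu>. act r m (\<Upsilon> \<mu>) (psi r m \<Theta> x) \<noteq> 0} \<subseteq> weights_upto r m (nil_bound r m d)"
    using Upsilon_vanish[OF _ x] by blast
  then show ?thesis
    by (simp add: ibar_tens_def Sum_any.expand_superset[OF finite_weights_upto] Upsilon_op_def)
qed

lemma Upsilon_intertwines:
  assumes u: "u \<in> U_iota r m p ws" and x: "x \<in> tens r m d"
  shows "act r m (\<psi>\<^sub>i u) (Upsilon_op r m \<Upsilon> d x) = Upsilon_op r m \<Upsilon> d (act r m (barU u) x)"
proof -
  let ?N = "nil_bound r m d"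
  have "\<forall>N. \<exists>L0. \<forall>L\<ge>L0. (\<Sum>\<mu>\<in>weights_upto r m L. \<psi>\<^sub>i u * \<Upsilon> \<mu> - \<Upsilon> \<mu> * barU u) \<in> U_filt r m N"
    using Upsilon u by (simp add: quasi_K_matrix_def)
  then obtain L0 where L0: "\<And>L. L \<ge> L0 \<Longrightarrow>
      (\<Sum>\<mu>\<in>weights_upto r m L. \<psi>\<^sub>i u * \<Upsilon> \<mu> - \<Upsilon> \<mu> * barU u) \<in> U_filt r m ?N" by blast
  define L where "L = max L0 ?N"
  have "act r m (\<Sum>\<mu>\<in>weights_upto r m L. \<psi>\<^sub>i u * \<Upsilon> \<mu> - \<Upsilon> \<mu> * barU u) x = 0"
    by (rule U_filt_act[OF L0 x]) (simp_all add: L_def)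
  then have "(\<Sum>\<mu>\<in>weights_upto r m L. act r m (\<psi>\<^sub>i u) (act r m (\<Upsilon> \<mu>) x))
      = (\<Sum>\<mu>\<in>weights_upto r m L. act r m (\<Upsilon> \<mu>) (act r m (barU u) x))"
    by (simp add: sum_subtractf)
  moreover have "(\<Sum>\<mu>\<in>weights_upto r m L. act r m (\<Upsilon> \<mu>) y) = Upsilon_op r m \<Upsilon> d y" if "y \<in> tens r m d" for y
    using that by (intro Upsilon_op_upto) (simp_all add: L_def)
  ultimately show ?thesis using x by (simp flip: act_lin(6))
qed

text \<open>Moving u through psi gives bar u, and Upsilon converts bar u into psi_i(u), which acts
  as u again.\<close>

lemma ibar_act:
  assumes "u \<in> U_iota r m p ws" "ueq r m (\<psi>\<^sub>i u) u" "x \<in> tens r m d"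
  shows "ibar (act r m u x) = act r m u (ibar x)"
proof -
  have "ibar (act r m u x) = Upsilon_op r m \<Upsilon> d (act r m (barU u) (psi r m \<Theta> x))"
    using assms(3) by (simp add: ibar_eq[of _ d] psi_act[OF Theta assms(3)])
  also have "\<dots> = act r m (\<psi>\<^sub>i u) (Upsilon_op r m \<Upsilon> d (psi r m \<Theta> x))"
    using Upsilon_intertwines[OF assms(1) tens_psi[OF Theta assms(3)]] by simp
  also have "\<dots> = act r m u (ibar x)"
    using assms(3) by (simp add: ibar_eq[of _ d] ueq_act[OF assms(2)])
  finally show ?thesis .
qed

text \<open>The radical of the antisymmetrized form; symmetry means that it is the whole tensor
  power.\<close>

definition symm_radical :: "nat \<Rightarrow> rat falg set" where
  "symm_radical d = {x \<in> tens r m d. \<forall>y\<in>tens r m d. hform x (ibar y) = hform y (ibar x)}"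

lemma ibar_add: "x \<in> tens r m d \<Longrightarrow> y \<in> tens r m d \<Longrightarrow> ibar (x + y) = ibar x + ibar y"
  and ibar_smul: "x \<in> tens r m d \<Longrightarrow> ibar (c *\<^sub>q x) = qbar c *\<^sub>q ibar x"
  by (simp_all add: ibar_eq[of _ d] bar_tens_simps slin_simps[OF slin_Upsilon_op])

lemma radical_add: "x \<in> symm_radical d \<Longrightarrow> y \<in> symm_radical d \<Longrightarrow> x + y \<in> symm_radical d"
  by (auto simp: symm_radical_def hform_simps ibar_add)

lemma radical_smul: "x \<in> symm_radical d \<Longrightarrow> c *\<^sub>q x \<in> symm_radical d"
  by (auto simp: symm_radical_def hform_simps ibar_smul)

lemma radical_diff: "x \<in> symm_radical d \<Longrightarrow> y \<in> symm_radical d \<Longrightarrow> x - y \<in> symm_radical d"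
  using radical_add[OF _ radical_smul[of y d "- 1"]] by simp

lemma radical_act:
  assumes u: "u \<in> U_iota r m p ws" "ueq r m (\<psi>\<^sub>i u) u" and v: "v \<in> U_iota r m p ws" "ueq r m (\<psi>\<^sub>i v) v"
    and adj: "adj (act r m u) (act r m v)" "adj (act r m v) (act r m u)" and x: "x \<in> symm_radical d"
  shows "act r m u x \<in> symm_radical d"
proof -
  have xt: "x \<in> tens r m d" using x by (simp add: symm_radical_def)
  have "hform (act r m u x) (ibar y) = hform y (ibar (act r m u x))" if y: "y \<in> tens r m d" for y
  proof -
    have "hform (act r m u x) (ibar y) = hform x (ibar (act r m v y))"
      using adj(1) by (simp add: adj_def ibar_act[OF v y])
    also have "\<dots> = hform (act r m v y) (ibar x)" using x y by (simp add: symm_radical_def)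
    also have "\<dots> = hform y (ibar (act r m u x))"
      using adj(2) by (simp add: adj_def ibar_act[OF u xt])
    finally show ?thesis .
  qed
  then show ?thesis using xt by (simp add: symm_radical_def)
qed

lemma Iwhite_neg: "i \<in> Iwhite r m \<Longrightarrow> - i \<in> Iwhite r m" and Iblack_neg: "i \<in> Iblack m \<Longrightarrow> - i \<in> Iblack m"
proof -
  have "Iblack m = Iset 0 m" by (auto simp: Iset_iff Iblack_iff)
  then show "i \<in> Iwhite r m \<Longrightarrow> - i \<in> Iwhite r m" "i \<in> Iblack m \<Longrightarrow> - i \<in> Iblack m"
    by (simp_all add: Iwhite_def Iset_neg)
qed

lemma radical_B:
  assumes i: "i \<in> Iwhite r m" and x: "x \<in> symm_radical d"
  shows "act r m (Bgen m p ws i) x \<in> symm_radical d"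
proof (rule radical_act[OF _ _ _ _ _ _ x])
  show "Bgen m p ws i \<in> U_iota r m p ws" "Bgen m p ws (- i) \<in> U_iota r m p ws"
    using i Iwhite_neg by (auto intro: Ui_B)
  show "ueq r m (\<psi>\<^sub>i (Bgen m p ws i)) (Bgen m p ws i)" "ueq r m (\<psi>\<^sub>i (Bgen m p ws (- i))) (Bgen m p ws (- i))"
    using bar i Iwhite_neg by (auto simp: bar_U_iota_def)
  show "adj (act r m (Bgen m p ws i)) (act r m (Bgen m p ws (- i)))"
    "adj (act r m (Bgen m p ws (- i))) (act r m (Bgen m p ws i))"
    using adj_Bgen[OF i ws p] adj_Bgen[OF Iwhite_neg[OF i] ws p] by simp_all
qed

lemma radical_F_black:
  assumes i: "i \<in> Iblack m" and x: "x \<in> symm_radical d"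
  shows "oF i x \<in> symm_radical d"
proof -
  have "act r m (gF i) x \<in> symm_radical d"
  proof (rule radical_act[OF _ _ _ _ _ _ x])
    show "gF i \<in> U_iota r m p ws" "gF (- i) \<in> U_iota r m p ws"
      using i Iblack_neg by (auto intro: Ui_F)
    show "ueq r m (\<psi>\<^sub>i (gF i)) (gF i)" "ueq r m (\<psi>\<^sub>i (gF (- i))) (gF (- i))"
      using bar i Iblack_neg by (auto simp: bar_U_iota_def)
    show "adj (act r m (gF i)) (act r m (gF (- i)))" "adj (act r m (gF (- i))) (act r m (gF i))"
      using adj_gact(2)[of r m i] adj_gact(2)[of r m "- i"] by (simp_all add: adj_def)
  qed
  moreover have "i \<in> Iset r m" using i Iblack_subset by blast
  ultimately show ?thesis by (simp add: gact_simps)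
qed

text \<open>A term of Upsilon other than the leading one is made of words with some E at both ends.
  The right end kills psi z, which is annihilated by the E's because z is; the left end, moved
  across the form as E_{-i}, kills z.\<close>

lemma radical_singular:
  assumes "z \<in> singular r m d"
  shows "z \<in> symm_radical d"
proof -
  have z: "z \<in> tens r m d" "gact r m (GenE i) z = 0" for i
    using assms by (auto simp: singular_def gact_def)
  have pz: "gact r m (GenE i) (psi r m \<Theta> z) = 0" for i
    using psi_gact[OF Theta z(1), of "GenE i"] z(2) by (simp add: bar_tens_simps)
  have zero: "{#} \<in> weights_upto r m (nil_bound r m d)" by (simp add: weights_upto_def)
  have U1: "act r m (\<Upsilon> \<mu>) (psi r m \<Theta> z) = 0" if "\<mu> \<noteq> {#}" for \<mu>
    by (rule Upsilon_induct[where P = "\<lambda>v. v = 0"]) (use that E_word_singular[OF pz] in auto)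
  have U2: "hform z (act r m (\<Upsilon> \<mu>) y) = 0" if "\<mu> \<noteq> {#}" for \<mu> y
    by (rule Upsilon_induct[where P = "\<lambda>v. hform z v = 0"])
      (use that hform_singular[OF z(2)] in \<open>auto simp: hform_simps\<close>)
  have "ibar z = psi r m \<Theta> z"
    unfolding ibar_eq[OF z(1)] Upsilon_op_def
    using U1 zero Upsilon_zero by (subst sum.remove[OF finite_weights_upto zero]) (simp add: sum.neutral)
  moreover have "hform z (ibar y) = hform z (psi r m \<Theta> y)" if "y \<in> tens r m d" for y
    unfolding ibar_eq[OF that] Upsilon_op_def hform_sum
    using U2 Upsilon_zero by (simp add: sum_eq_single[OF finite_weights_upto zero])
  ultimately show ?thesis
    using z(1) bar_form_symmetric[OF Theta z(1)] by (simp add: symm_radical_def)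
qed

lemma radical_lowered: "lowered r m d l x \<Longrightarrow> x \<in> symm_radical d"
proof (induction l arbitrary: x)
  case 0
  define l :: nat where "l = 0"
  have "lowered r m d l x" using 0 by (simp add: l_def)
  moreover have "l = 0" by (simp add: l_def)
  ultimately show ?case
    by (induction rule: lowered.induct) (auto intro: radical_singular radical_add)
next
  case (Suc l)
  define l' where "l' = Suc l"
  have "lowered r m d l' x" using Suc.prems by (simp add: l'_def)
  moreover have "l' = Suc l" by (simp add: l'_def)
  ultimately show ?case
  proof (induction rule: lowered.induct)
    case (lowered_F k x i)
    then have x: "lowered r m d l x" "x \<in> symm_radical d" using Suc.IH by auto
    show ?case
    proof (cases "i \<in> Iblack m")
      case True
      then show ?thesis using x(2) by (rule radical_F_black)
    next
      case False
      then have i: "i \<in> Iwhite r m" using lowered_F by (simp add: Iwhite_def)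
      \<comment> \<open>B_i x lies in the radical by adjointness. The correction B_i x - F_i x has
        the level l of x, so the induction hypothesis covers it.\<close>
      have "oF i x = act r m (Bgen m p ws i) x - (act r m (Bgen m p ws i) x - oF i x)" by simp
      also have "\<dots> \<in> symm_radical d"
        by (intro radical_diff radical_B i x(2) Suc.IH Bgen_lowered[OF i ws x(1)])
      finally show ?thesis .
    qed
  qed (auto intro: radical_singular radical_add)
qed

lemma finite_indices: "finite (indices r m d)"
proof -
  have "finite (II r m)" by (simp add: II_def finite_seg)
  then have "finite {f. set f \<subseteq> II r m \<and> length f = d}" by (rule finite_lists_length_eq)
  then show ?thesis by (simp add: indices_def conj_commute)
qed

lemma iform_symmetric:
  assumes x: "x \<in> tens r m d" and y: "y \<in> tens r m d"
  shows "hform x (ibar y) = hform y (ibar x)"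
proof -
  define \<phi> where "\<phi> x = hform x (ibar y) - hform y (ibar x)" for x
  \<comment> \<open>The vector that represents the linear functional phi for the standard form. It
    is orthogonal to everything on which phi vanishes, in particular to all \<open>lowered\<close>
    vectors.\<close>
  define z where "z = (\<Sum>f\<in>indices r m d. \<phi> (mon f) *\<^sub>q mon f)"
  have z: "z \<in> tens r m d" unfolding z_def by (intro tens_sum tens_smul) simp
  have add: "\<phi> (x + x') = \<phi> x + \<phi> x'" if "x \<in> tens r m d" "x' \<in> tens r m d" for x x'
    using that by (simp add: \<phi>_def hform_simps ibar_add)
  have smul: "\<phi> (c *\<^sub>q x) = c * \<phi> x" if "x \<in> tens r m d" for c x
    using that by (simp add: \<phi>_def hform_simps ibar_smul right_diff_distrib)
  have rep: "\<phi> x = std_form x z" if "x \<in> tens r m d" for x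
  proof -
    have "\<phi> (\<Sum>w\<in>W. coeff_at x w *\<^sub>q mon (letters w)) = (\<Sum>w\<in>W. coeff_at x w * \<phi> (mon (letters w)))"
      if "W \<subseteq> Poly_Mapping.keys x" for W
    proof -
      have "finite W" using that finite_keys finite_subset by blast
      then show ?thesis using that
      proof induction
        case empty
        then show ?case using smul[of 0 0] by simp
      next
        case (insert w W)
        have w: "letters v \<in> indices r m d" if "v \<in> insert w W" for v
          using that insert.prems \<open>x \<in> tens r m d\<close> by (auto simp: tens_def)
        have "(\<Sum>w\<in>W. coeff_at x w *\<^sub>q mon (letters w)) \<in> tens r m d"
          by (intro tens_sum tens_smul) (simp add: w)
        then show ?case using insert w by (simp add: add smul)
      qed
    qed
    from this[of "Poly_Mapping.keys x"] have "\<phi> x = (\<Sum>w\<in>Poly_Mapping.keys x. coeff_at x w * \<phi> (mon (letters w)))"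
      by (simp flip: expand_mon)
    also have "\<dots> = std_form x z"
      unfolding std_form_def
    proof (rule sum.cong)
      fix w assume w: "w \<in> Poly_Mapping.keys x"
      obtain g where g: "w = Word g" by (cases w)
      then have "g \<in> indices r m d" using w that by (auto simp: tens_def)
      moreover have "coeff_at z (Word g) = (\<Sum>f\<in>indices r m d. if f = g then \<phi> (mon f) else 0)"
        unfolding z_def lookup_sum by (rule sum.cong) (auto simp: coeff_mon)
      ultimately show "coeff_at x w * \<phi> (mon (letters w)) = coeff_at x w * coeff_at z w"
        using finite_indices by (simp add: g)
    qed simp
    finally show ?thesis .
  qed
  have "z = 0"
  proof (rule lowered_orthogonal[OF z])
    fix l x assume l: "lowered r m d l x"
    then have "\<phi> x = 0" using radical_lowered[OF l] y by (simp add: \<phi>_def symm_radical_def)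
    then show "std_form x z = 0" using rep[OF lowered_tens[OF l]] by simp
  qed
  then show ?thesis using rep[OF x] by (simp add: \<phi>_def)
qed

end

section \<open>Duality of the bases\<close>

lemma of_int_eq_to_fract: "(of_int c :: qf) = to_fract [:of_int c:]"
proof -
  have nat: "(of_nat n :: qf) = to_fract [:of_nat n:]" for n
  proof (induction n)
    case (Suc n)
    have "[:1 + of_nat n:] = 1 + [:of_nat n :: rat:]" by (simp add: one_pCons)
    then show ?case using Suc by simp
  qed simp
  obtain a b where "c = int a - int b" by (metis int_diff_cases)
  then show ?thesis using nat[of a] nat[of b] by (simp flip: to_fract_diff)
qed

lemma int_poly_eval: "poly (map_poly of_int P) z = eval_at z (map_poly of_int P)"
proof (induction P)
  case (pCons c P)
  then show ?case by (simp add: map_poly_pCons of_int_eq_to_fract)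
qed simp

lemma int_poly_multiples_iff: "x \<in> int_poly_multiples z \<longleftrightarrow> (\<exists>P :: int poly. x = z * eval_at z (map_poly of_int P))"
  by (auto simp: int_poly_multiples_def int_poly_eval)

lemma map_poly_of_int_add: "map_poly of_int (P + Q) = map_poly of_int P + (map_poly of_int Q :: rat poly)"
  by (rule poly_eqI) (simp add: coeff_map_poly)

lemma map_poly_of_int_mult: "map_poly of_int (P * Q) = map_poly of_int P * (map_poly of_int Q :: rat poly)"
proof (induction P)
  case (pCons c P)
  have "map_poly of_int (smult c Q) = smult (of_int c) (map_poly of_int Q :: rat poly)"
    by (rule poly_eqI) (simp add: coeff_map_poly)
  then show ?case using pCons by (simp add: map_poly_of_int_add map_poly_pCons)
qed simp

lemma int_poly_multiples_0 [simp]: "0 \<in> int_poly_multiples z"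
  unfolding int_poly_multiples_iff by (rule exI[of _ 0]) simp

lemma int_poly_multiples_add:
  assumes "x \<in> int_poly_multiples z" "y \<in> int_poly_multiples z"
  shows "x + y \<in> int_poly_multiples z"
proof -
  obtain P Q :: "int poly" where "x = z * eval_at z (map_poly of_int P)" "y = z * eval_at z (map_poly of_int Q)"
    using assms by (auto simp: int_poly_multiples_iff)
  then show ?thesis unfolding int_poly_multiples_iff
    by (intro exI[of _ "P + Q"]) (simp add: map_poly_of_int_add eval_at_add distrib_left)
qed

lemma int_poly_multiples_mult:
  assumes "x \<in> int_poly_multiples z" "y \<in> int_poly_multiples z"
  shows "x * y \<in> int_poly_multiples z"
proof -
  obtain P Q :: "int poly" where "x = z * eval_at z (map_poly of_int P)" "y = z * eval_at z (map_poly of_int Q)"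
    using assms by (auto simp: int_poly_multiples_iff)
  then show ?thesis unfolding int_poly_multiples_iff
    by (intro exI[of _ "pCons 0 (P * Q)"]) (simp add: map_poly_of_int_mult eval_at_mult map_poly_pCons mult_ac)
qed

lemma int_poly_multiples_sum: "(\<And>i. i \<in> I \<Longrightarrow> f i \<in> int_poly_multiples z) \<Longrightarrow> sum f I \<in> int_poly_multiples z"
  by (induction I rule: infinite_finite_induct) (simp_all add: int_poly_multiples_add)

lemma int_poly_multiples_qbar: "x \<in> int_poly_multiples z \<Longrightarrow> qbar x \<in> int_poly_multiples (qbar z)"
  by (auto simp: int_poly_multiples_iff qbar_eval_at)

lemma to_fract_monom: "to_fract (monom 1 n) = qq ^ n"
proof (induction n)
  case (Suc n)
  have "to_fract (monom 1 (Suc n)) = qq * to_fract (monom 1 n)"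
    using eval_at_pCons[of qq 0 "monom 1 n"] unfolding eval_at_qq by (simp add: monom_Suc)
  then show ?case using Suc by simp
qed simp

text \<open>Multiply q A(q) = q^{-1} B(1/q) by q^{deg B + 1}. The right side becomes a polynomial of
  degree at most deg B, while the left side is divisible by q^{deg B + 2}.\<close>

lemma int_poly_multiples_disjoint:
  assumes "x \<in> int_poly_multiples qq" "x \<in> int_poly_multiples (inverse qq)"
  shows "x = 0"
proof -
  obtain A B :: "rat poly" where A: "x = qq * eval_at qq A" and B: "x = inverse qq * eval_at (inverse qq) B"
    using assms unfolding int_poly_multiples_iff by blast
  let ?n = "degree B"
  have "qq ^ (?n + 2) * eval_at qq A = qq ^ ?n * (qq * (qq * eval_at qq A))"
    by (simp add: mult.assoc)
  also have "\<dots> = qq ^ ?n * eval_at (inverse qq) B"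
  proof -
    have "qq * x = eval_at (inverse qq) B" using B by simp
    then show ?thesis using A by simp
  qed
  also have "\<dots> = to_fract (reflect_poly B)" by (rule eval_at_inverse_qq)
  finally have "to_fract (monom 1 (?n + 2) * A) = to_fract (reflect_poly B)"
    by (simp only: to_fract_mult to_fract_monom eval_at_qq)
  then have eq: "monom 1 (?n + 2) * A = reflect_poly B" by (simp only: to_fract_eq_iff)
  have "A = 0"
  proof (rule ccontr)
    assume "A \<noteq> 0"
    then have "degree (monom 1 (?n + 2) * A) = ?n + 2 + degree A"
      by (simp add: degree_mult_eq degree_monom_eq)
    moreover have "degree (reflect_poly B) \<le> ?n" by (rule degree_reflect_poly_le)
    ultimately show False unfolding eq by simp
  qed
  then show ?thesis by (simp add: A)
qed

section \<open>Leading terms of pairings\<close>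

lemma coeff_Dmap: "coeff_at (Dmap y) (Word f) = qbar (coeff_at y (Word (map uminus f)))"
proof -
  have inv: "map uminus f = g \<longleftrightarrow> f = map uminus g" for f g :: "rat list"
    by (auto simp: comp_def)
  show ?thesis
    by (rule functional_ext[where \<sigma> = qbar and x = y and F = "\<lambda>y. coeff_at (Dmap y) (Word f)"
          and G = "\<lambda>y. qbar (coeff_at y (Word (map uminus f)))"])
      (auto simp: lookup_add coeff_mon inv)
qed

lemma std_form_leading:
  assumes "\<And>f. coeff_at x f \<in> int_poly_multiples z" "\<And>f. coeff_at y f \<in> int_poly_multiples z"
  shows "std_form (mon g + x) (mon h + y) - (if g = h then 1 else 0) \<in> int_poly_multiples z"
proof -
  have "std_form x (mon h) = coeff_at x (Word h)"
    by (rule functional_ext[where \<sigma> = "\<lambda>c. c" and x = x and F = "\<lambda>x. std_form x (mon h)"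
          and G = "\<lambda>x. coeff_at x (Word h)"])
      (auto simp: std_form_add_left std_form_smul_left lookup_add coeff_mon)
  then have "std_form (mon g + x) (mon h + y) - (if g = h then 1 else 0)
      = coeff_at y (Word g) + (coeff_at x (Word h) + std_form x y)"
    by (simp add: std_form_add_left std_form_add_right coeff_mon)
  moreover have "std_form x y \<in> int_poly_multiples z"
    unfolding std_form_def by (intro int_poly_multiples_sum int_poly_multiples_mult assms)
  ultimately show ?thesis using assms by (simp add: int_poly_multiples_add)
qed

text \<open>D conjugates coefficients and negates words. Hence the second argument may be taken
  modulo the lattice of the conjugate of z, with leading word -h, while the pairing is controlled by
  z.\<close>

lemma hform_leading:
  assumes "C - mon g \<in> M_lattice r m d z" "C' - mon (map uminus h) \<in> M_lattice r m d (qbar z)"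
  shows "hform C C' - (if g = h then 1 else 0) \<in> int_poly_multiples z"
proof -
  let ?x = "C - mon g" and ?y = "C' - mon (map uminus h)"
  have "coeff_at (Dmap ?y) (Word f) \<in> int_poly_multiples z" for f
    using assms(2) int_poly_multiples_qbar[of _ "qbar z", unfolded qbar_qbar]
    unfolding coeff_Dmap M_lattice_def by blast
  then have "coeff_at (Dmap ?y) w \<in> int_poly_multiples z" for w by (cases w) simp
  moreover have "coeff_at ?x w \<in> int_poly_multiples z" for w
    using assms(1) by (simp add: M_lattice_def)
  ultimately have "std_form (mon g + ?x) (mon h + Dmap ?y) - (if g = h then 1 else 0) \<in> int_poly_multiples z"
    by (intro std_form_leading)
  then show ?thesis by (simp add: hform_def comp_def)
qed

lemma indices_uminus: "f \<in> indices r m d \<Longrightarrow> map uminus f \<in> indices r m d"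
  by (auto simp: indices_def II_neg)

lemma refl_B_indices:
  assumes "f \<in> indices r m d" "j < d"
  shows "refl_B r m j f \<in> indices r m d"
proof (cases "j = 0")
  case True
  then obtain a g where f: "f = a # g" using assms by (cases f) (auto simp: indices_def)
  then show ?thesis using assms True by (auto simp: refl_B_def indices_def II_neg)
next
  case False
  then have "f ! j \<in> II r m" "f ! (j - 1) \<in> II r m" using assms by (auto simp: indices_def)
  then show ?thesis using assms False set_update_subset_insert
    by (fastforce simp: refl_B_def indices_def dest!: set_update_subset_insert[THEN subsetD])
qed

lemma orbit_B_indices:
  assumes "f \<in> indices r m d" "g \<in> orbit_B r m f"
  shows "g \<in> indices r m d"
  using assms(2)
proof induction
  case (orbit_step g j)
  then show ?case using assms(1) by (intro refl_B_indices) (auto simp: indices_def)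
qed (rule assms(1))

theorem theoremD:
  fixes r m d :: nat and k :: int and p :: qf and ws :: "rat list"
    and \<Theta> :: "rat multiset \<Rightarrow> gen falg2"
    and \<psi>\<^sub>i :: "gen falg \<Rightarrow> gen falg"
    and \<Upsilon> :: "rat multiset \<Rightarrow> gen falg"
  assumes "r \<noteq> 0 \<or> m \<noteq> 0" and "d \<ge> 1"
    and "p = qq powi k"
    and "longest_word r m ws"
    and "quasi_R_matrix r m \<Theta>"
    and "bar_U_iota r m p ws \<psi>\<^sub>i"
    and "quasi_K_matrix r m p ws \<psi>\<^sub>i \<Upsilon>"
  shows
    "(\<forall>x\<in>tens r m d. \<forall>y\<in>tens r m d. iform r m \<Theta> \<Upsilon> x y = iform r m \<Theta> \<Upsilon> y x) \<and>
     (\<forall>C Cdual. icanonical_basis r m d \<Theta> \<Upsilon> C \<and> dual_icanonical_basis r m d \<Theta> \<Upsilon> Cdual \<longrightarrow>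
       (\<forall>f\<in>indices r m d. antidominant m f \<longrightarrow>
         (\<forall>g\<in>orbit_B r m f. \<forall>h\<in>orbit_B r m f.
           iform r m \<Theta> \<Upsilon> (C g) (Cdual (map uminus h)) = (if g = h then 1 else 0))))"
proof -
  interpret iota_setup r m k p ws \<Theta> \<psi>\<^sub>i \<Upsilon>
    using assms by unfold_locales
  have iform: "iform r m \<Theta> \<Upsilon> x y = hform x (ibar y)" for x y
    by (simp add: iform_def hform_def)
  have "iform r m \<Theta> \<Upsilon> (C g) (Cdual (map uminus h)) = (if g = h then 1 else 0)"
    if C: "icanonical_basis r m d \<Theta> \<Upsilon> C" and D: "dual_icanonical_basis r m d \<Theta> \<Upsilon> Cdual"
      and g: "g \<in> indices r m d" and h: "h \<in> indices r m d" for C Cdual g h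
  proof -
    let ?h = "map uminus h"
    have h': "?h \<in> indices r m d" using h by (rule indices_uminus)
    have Cg: "ibar (C g) = C g" "C g - mon g \<in> M_lattice r m d (inverse qq)"
      using C g by (simp_all add: icanonical_basis_def)
    have Dh: "ibar (Cdual ?h) = Cdual ?h" "Cdual ?h - mon ?h \<in> M_lattice r m d qq"
      using D h' by (simp_all add: dual_icanonical_basis_def)
    have "C g \<in> tens r m d" "Cdual ?h \<in> tens r m d"
      using tens_add[of "C g - mon g" r m d "mon g"] tens_add[of "Cdual ?h - mon ?h" r m d "mon ?h"] Cg(2) Dh(2) g h'
      by (simp_all add: M_lattice_def)
    then have symm: "hform (C g) (Cdual ?h) = hform (Cdual ?h) (C g)"
      using iform_symmetric Cg(1) Dh(1) by metis
    \<comment> \<open>The same number is estimated twice. With C_g in the first argument the error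
      lies in the ideal of 1/q; after exchanging the arguments by symmetry, D conjugates the
      coefficients of C_g instead, and the error lies in the ideal of q.\<close>
    have "hform (C g) (Cdual ?h) - (if g = h then 1 else 0) \<in> int_poly_multiples (inverse qq)"
      using hform_leading[OF Cg(2), of "Cdual ?h" h] Dh(2) by simp
    moreover have "hform (Cdual ?h) (C g) - (if ?h = map uminus g then 1 else 0) \<in> int_poly_multiples qq"
      using hform_leading[OF Dh(2), of "C g" "map uminus g"] Cg(2) by (simp add: comp_def)
    moreover have "?h = map uminus g \<longleftrightarrow> g = h" by (auto simp: inj_map_eq_map)
    ultimately show ?thesis
      using int_poly_multiples_disjoint[of "hform (C g) (Cdual ?h) - (if g = h then 1 else 0)"]
      by (simp add: iform Dh(1) symm split: if_splits)
  qed
  then show ?thesis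
    using iform_symmetric orbit_B_indices by (auto simp: iform)
qed

end
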